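(* Let $u_0\in C(0,1)$ take values in $[0,1]$, let $v_{0,-},v_{0,+}\in[0,1]$, and let $u$ be the unique bounded function in $C^{2,1}([0,1]\times(0,\infty))$ such that $$u_t=\tfrac12u_{rr}\ \text{ on } (0,1)\times(0,\infty),\qquad \lim_{t\downarrow0}u(r,t)=u_0(r)\ \text{ for } r\in(0,1),$$ and such that $v_-(t):=u(0,t)$ and $v_+(t):=u(1,t)$ satisfy, for every $t>0$, $\frac{d}{dt}v_-(t)=\frac12u_r(0,t)$ and $\frac{d}{dt}v_+(t)=-\frac12u_r(1,t)$, with $\lim_{t\downarrow0}v_{-}(t)=v_{0,-}$ and $\lim_{t\downarrow0}v_+(t)=v_{0,+}$. Then for all $r\in[0,1]$ and $t>0$, $$u(r,t)=E_r\big[u_0(\mathbf{B}(t))\mathbf 1_{0<\mathbf{B}(t)<1}+v_{0,-}\mathbf 1_{\mathbf{B}(t)=0}+v_{0,+}\mathbf 1_{\mathbf{B}(t)=1}\big],$$ where $\mathbf{B}$ solves the stochastic differential equation $$d\mathbf{B}(t)=\mathbf 1_{0<\mathbf{B}(t)<1}\,dW(t)+\tfrac12\,\mathbf 1_{\mathbf{B}(t)=0}\,dt-\tfrac12\,\mathbf 1_{\mathbf{B}(t)=1}\,dt,\qquad \mathbf{B}(0)=r,$$ for some standard Brownian motion $W$.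
   Context: $C^{2,1}([0,1]\times(0,\infty))$ is the set of real functions $u(r,t)$ on $[0,1]\times(0,\infty)$ that are twice continuously differentiable in $r$ and once continuously differentiable in $t$, up to and including the boundary points $r=0$ and $r=1$ (with one-sided $r$-derivatives there). Subscripts $r,t$ denote partial derivatives. Existence and uniqueness of $u$ is a separate theorem of the paper. A solution of the stochastic differential equation is understood in the weak sense: a continuous adapted process $\mathbf{B}$ on some filtered probability space carrying a standard Brownian motion $W$ such that the integrated equation holds. Existence and uniqueness in law of the solution are known. $E_r$ denotes expectation with respect to the process $\mathbf{B}$ started from $r$. The product $u_0(\mathbf{B}(t))\mathbf 1_{0<\mathbf{B}(t)<1}$ is read as $0$ when $\mathbf{B}(t)\in\{0,1\}$. *)

theory Defs
  imports "HOL-Probability.Probability"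
begin

section \<open>Functions of class C(2,1) on [0,1] x (0,oo)\<close>

text \<open>Functions are written \<open>u r t\<close>.  At \<open>r = 0\<close> and \<open>r = 1\<close> the space derivative is the
  one-sided one, since the difference quotients are taken within \<open>{0..1}\<close>.\<close>

definition d_r :: "(real \<Rightarrow> real \<Rightarrow> real) \<Rightarrow> real \<Rightarrow> real \<Rightarrow> real" where
  "d_r u r t = vector_derivative (\<lambda>x. u x t) (at r within {0..1})"

definition d_t :: "(real \<Rightarrow> real \<Rightarrow> real) \<Rightarrow> real \<Rightarrow> real \<Rightarrow> real" where
  "d_t u r t = deriv (\<lambda>s. u r s) t"

text \<open>The derivatives are continuous jointly in \<open>(r, t)\<close>, up to and including \<open>r = 0\<close> and \<open>r = 1\<close>.\<close>

definition C21 :: "(real \<Rightarrow> real \<Rightarrow> real) \<Rightarrow> bool" where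
  "C21 u \<longleftrightarrow>
     (\<forall>r\<in>{0..1}. \<forall>t>0.
        (\<lambda>x. u x t) differentiable (at r within {0..1}) \<and>
        (\<lambda>x. d_r u x t) differentiable (at r within {0..1}) \<and>
        (\<lambda>s. u r s) differentiable (at t)) \<and>
     continuous_on ({0..1} \<times> {0<..}) (\<lambda>(r, t). u r t) \<and>
     continuous_on ({0..1} \<times> {0<..}) (\<lambda>(r, t). d_r u r t) \<and>
     continuous_on ({0..1} \<times> {0<..}) (\<lambda>(r, t). d_r (d_r u) r t) \<and>
     continuous_on ({0..1} \<times> {0<..}) (\<lambda>(r, t). d_t u r t)"

section \<open>Filtered probability spaces and Brownian motion\<close>

text \<open>Time runs through \<open>{0..}\<close>; the index type of the filtration is \<open>real\<close>, and its values at
  negative times play no role (a filtration given on \<open>{0..}\<close> extends by \<open>F 0\<close>).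
  No completeness or right-continuity is assumed.\<close>

locale filtered_prob_space = prob_space M + filtration "space M" F
  for M :: "'a measure" and F :: "real \<Rightarrow> 'a measure" +
  assumes subalgebra_F: "\<And>t. 0 \<le> t \<Longrightarrow> subalgebra M (F t)"
begin

definition continuous_adapted :: "(real \<Rightarrow> 'a \<Rightarrow> real) \<Rightarrow> bool" where
  "continuous_adapted X \<longleftrightarrow>
     (\<forall>t\<ge>0. X t \<in> borel_measurable (F t)) \<and>
     (\<forall>\<omega>\<in>space M. continuous_on {0..} (\<lambda>t. X t \<omega>))"

definition standard_brownian_motion :: "(real \<Rightarrow> 'a \<Rightarrow> real) \<Rightarrow> bool" where
  "standard_brownian_motion W \<longleftrightarrow>
     continuous_adapted W \<and>
     (AE \<omega> in M. W 0 \<omega> = 0) \<and>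
     (\<forall>s t. 0 \<le> s \<and> s < t \<longrightarrow>
        distributed M lborel (\<lambda>\<omega>. W t \<omega> - W s \<omega>) (normal_density 0 (sqrt (t - s))) \<and>
        indep_set (sets (F s)) {(\<lambda>\<omega>. W t \<omega> - W s \<omega>) -` A \<inter> space M |A. A \<in> sets borel})"

section \<open>The Ito integral\<close>

text \<open>A triple \<open>(n, \<tau>, \<xi>)\<close> encodes the simple process
  \<open>\<Sum>i<n. \<xi> i * 1 {\<tau> i <.. \<tau> (Suc i)}\<close>.\<close>

definition simple_process :: "nat \<Rightarrow> (nat \<Rightarrow> real) \<Rightarrow> (nat \<Rightarrow> 'a \<Rightarrow> real) \<Rightarrow> bool" where
  "simple_process n \<tau> \<xi> \<longleftrightarrow>
     0 \<le> \<tau> 0 \<and>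
     (\<forall>i<n. \<tau> i \<le> \<tau> (Suc i) \<and> \<xi> i \<in> borel_measurable (F (\<tau> i)) \<and>
        bounded (\<xi> i ` space M))"

definition simple_value ::
    "nat \<Rightarrow> (nat \<Rightarrow> real) \<Rightarrow> (nat \<Rightarrow> 'a \<Rightarrow> real) \<Rightarrow> real \<Rightarrow> 'a \<Rightarrow> real" where
  "simple_value n \<tau> \<xi> s \<omega> = (\<Sum>i<n. \<xi> i \<omega> * indicat_real {\<tau> i <.. \<tau> (Suc i)} s)"

definition simple_integral ::
    "(real \<Rightarrow> 'a \<Rightarrow> real) \<Rightarrow> nat \<Rightarrow> (nat \<Rightarrow> real) \<Rightarrow> (nat \<Rightarrow> 'a \<Rightarrow> real) \<Rightarrow> real \<Rightarrow> 'a \<Rightarrow> real" where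
  "simple_integral W n \<tau> \<xi> t \<omega> =
     (\<Sum>i<n. \<xi> i \<omega> * (W (min t (\<tau> (Suc i))) \<omega> - W (min t (\<tau> i)) \<omega>))"

definition progressively_measurable :: "(real \<Rightarrow> 'a \<Rightarrow> real) \<Rightarrow> bool" where
  "progressively_measurable H \<longleftrightarrow>
     (\<forall>t\<ge>0. (\<lambda>(s, \<omega>). H s \<omega>) \<in> borel_measurable (restrict_space borel {0..t} \<Otimes>\<^sub>M F t))"

text \<open>\<open>X\<close> is a version of \<open>\<integral>\<^sub>0\<^sup>t H dW\<close>: the \<open>L\<^sup>2(M)\<close>-limit of the integrals of simple processes
  that converge to \<open>H\<close> in \<open>L\<^sup>2({0..t} \<times> M)\<close>.  This is a relation, because the limit is
  determined only almost surely.\<close>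

definition ito_integral_at ::
    "(real \<Rightarrow> 'a \<Rightarrow> real) \<Rightarrow> (real \<Rightarrow> 'a \<Rightarrow> real) \<Rightarrow> real \<Rightarrow> ('a \<Rightarrow> real) \<Rightarrow> bool" where
  "ito_integral_at W H t X \<longleftrightarrow>
     progressively_measurable H \<and> X \<in> borel_measurable M \<and>
     (\<exists>n \<tau> \<xi>. (\<forall>k. simple_process (n k) (\<tau> k) (\<xi> k)) \<and>
        (\<lambda>k. \<integral>\<^sup>+\<omega>. (\<integral>\<^sup>+s\<in>{0..t}.
            ennreal ((H s \<omega> - simple_value (n k) (\<tau> k) (\<xi> k) s \<omega>)\<^sup>2) \<partial>lborel) \<partial>M)
          \<longlonglongrightarrow> 0 \<and>
        (\<lambda>k. \<integral>\<^sup>+\<omega>. ennreal ((X \<omega> - simple_integral W (n k) (\<tau> k) (\<xi> k) t \<omega>)\<^sup>2) \<partial>M)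
          \<longlonglongrightarrow> 0)"

definition ito_integral ::
    "(real \<Rightarrow> 'a \<Rightarrow> real) \<Rightarrow> (real \<Rightarrow> 'a \<Rightarrow> real) \<Rightarrow> (real \<Rightarrow> 'a \<Rightarrow> real) \<Rightarrow> bool" where
  "ito_integral W H I \<longleftrightarrow>
     (\<forall>t\<ge>0. ito_integral_at W H t (I t)) \<and>
     (AE \<omega> in M. continuous_on {0..} (\<lambda>t. I t \<omega>))"

end

section \<open>Weak solutions\<close>

text \<open>\<open>X\<close> on \<open>(M, F)\<close> with Brownian motion \<open>W\<close> is a weak solution of
  \<open>dX = \<sigma>(X) dW + b(X) dt\<close>, \<open>X 0 = x\<close>.  The integral against \<open>W\<close> is the \<open>L\<^sup>2\<close> one, so this is
  the usual notion when \<open>\<sigma>\<close> is bounded and Borel measurable.\<close>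

definition weak_solution ::
    "(real \<Rightarrow> real) \<Rightarrow> (real \<Rightarrow> real) \<Rightarrow> real \<Rightarrow>
     'a measure \<Rightarrow> (real \<Rightarrow> 'a measure) \<Rightarrow> (real \<Rightarrow> 'a \<Rightarrow> real) \<Rightarrow> (real \<Rightarrow> 'a \<Rightarrow> real) \<Rightarrow> bool" where
  "weak_solution \<sigma> b x M F W X \<longleftrightarrow>
     filtered_prob_space M F \<and>
     filtered_prob_space.standard_brownian_motion M F W \<and>
     filtered_prob_space.continuous_adapted M F X \<and>
     (AE \<omega> in M. X 0 \<omega> = x) \<and>
     (\<exists>I. filtered_prob_space.ito_integral M F W (\<lambda>s \<omega>. \<sigma> (X s \<omega>)) I \<and>
        (AE \<omega> in M. \<forall>t\<ge>0.
           set_integrable lborel {0..t} (\<lambda>s. b (X s \<omega>)) \<and>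
           X t \<omega> = x + I t \<omega> + (LINT s:{0..t}|lborel. b (X s \<omega>))))"

end

theory Submission
  imports Defs
begin

text \<open>For \<open>\<epsilon> > 0\<close> the function \<open>f s y = u y (t + \<epsilon> - s)\<close> is \<open>C\<^sup>2\<^sup>,\<^sup>1\<close> on \<open>{0..t} \<times> {0..1}\<close> and is annihilated by
  the time-dependent generator: inside the interval this is the heat equation, and at the end points,
  where the noise is switched off, it is the dynamic boundary condition.  Hence \<open>E f s (B s)\<close> does
  not depend on \<open>s\<close>, which gives \<open>E u (B t) \<epsilon> = u r (t + \<epsilon>)\<close>.  Letting \<open>\<epsilon>\<close> tend to \<open>0\<close> with the space
  argument \<open>B t\<close> fixed only needs the pointwise initial condition and dominated convergence, although
  \<open>u\<close> may be discontinuous at the corners.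

  The constancy of \<open>E f s (B s)\<close> is the expectation of Ito's formula.  It follows from a second-order
  Taylor expansion over a uniform partition, where the Ito isometry conditioned on the past
  evaluates the main terms and a Lindeberg condition controls the quadratic remainder.  The same
  argument, applied to a function vanishing on \<open>{..1}\<close> (or on \<open>{0..}\<close>) and positive elsewhere, shows
  that \<open>B\<close> stays in \<open>{0..1}\<close>.\<close>

section \<open>Square-integrable functions\<close>

text \<open>The obstacle is that both coefficients jump at the end points, so in an expansion over a
  short interval from \<open>s\<close> to \<open>t\<close> they cannot be frozen at time
  \<open>s\<close>. Only the derivatives of the test function are frozen; the coefficients stay
  inside the time integral. This leaves the integral of
  \<open>fs + b fx + \<sigma>^2 fxx / 2\<close> with derivatives taken at \<open>(s, X s)\<close>
  and coefficients at \<open>X u\<close>. It differs from the integral of the generator at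
  \<open>(u, X u)\<close>, which is 0, only by the oscillation of the derivatives.

  The shift by \<open>\<epsilon>\<close> keeps the time argument of \<open>u\<close> in
  \<open>{\<epsilon>..t + \<epsilon>}\<close>. Near time 0 nothing bounds the derivatives of
  \<open>u\<close>, but on this compact strip they are bounded and uniformly continuous.

  Confinement has to be proved because the equation is posed on the whole line while
  \<open>u\<close> is controlled only on \<open>{0..1}\<close>. It holds because both coefficients
  vanish outside \<open>{0..1}\<close>.\<close>

definition square_integrable :: "'a measure \<Rightarrow> ('a \<Rightarrow> real) \<Rightarrow> bool" where
  "square_integrable M f \<longleftrightarrow> f \<in> borel_measurable M \<and> integrable M (\<lambda>x. (f x)\<^sup>2)"

lemma square_integrable_measurable: "square_integrable M f \<Longrightarrow> f \<in> borel_measurable M"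
  by (simp add: square_integrable_def)

lemma square_integrable_power2: "square_integrable M f \<Longrightarrow> integrable M (\<lambda>x. (f x)\<^sup>2)"
  by (simp add: square_integrable_def)

text \<open>The weight \<open>w\<close> serves for conditioning: later it is a bounded variable
  known at the left end of a time interval over which \<open>f\<close> and \<open>g\<close> are
  increments. The domination is \<open>|f g| \<le> f^2 + g^2\<close>.\<close>

lemma integrable_weighted_mult:
  fixes f g w :: "'a \<Rightarrow> real"
  assumes f: "square_integrable M f" and g: "square_integrable M g"
    and w [measurable]: "w \<in> borel_measurable M" and C: "\<And>x. x \<in> space M \<Longrightarrow> \<bar>w x\<bar> \<le> C"
  shows "integrable M (\<lambda>x. w x * (f x * g x))"
proof (rule Bochner_Integration.integrable_bound)
  have [measurable]: "f \<in> borel_measurable M" "g \<in> borel_measurable M"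
    using f g by (auto simp: square_integrable_def)
  show "integrable M (\<lambda>x. C * ((f x)\<^sup>2 + (g x)\<^sup>2))"
    using f g by (auto simp: square_integrable_def)
  show "(\<lambda>x. w x * (f x * g x)) \<in> borel_measurable M" by measurable
  have "\<bar>w x * (f x * g x)\<bar> \<le> \<bar>C * ((f x)\<^sup>2 + (g x)\<^sup>2)\<bar>" if "x \<in> space M" for x
  proof -
    have "\<bar>f x * g x\<bar> \<le> (f x)\<^sup>2 + (g x)\<^sup>2"
      using sum_squares_bound[of "\<bar>f x\<bar>" "\<bar>g x\<bar>"] zero_le_power2[of "f x"] zero_le_power2[of "g x"]
        abs_ge_zero[of "f x * g x"] unfolding abs_mult power2_abs by linarith
    then have "\<bar>w x\<bar> * \<bar>f x * g x\<bar> \<le> C * ((f x)\<^sup>2 + (g x)\<^sup>2)"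
      using C[OF that] by (intro mult_mono) auto
    also have "\<dots> \<le> \<bar>C * ((f x)\<^sup>2 + (g x)\<^sup>2)\<bar>" by (rule abs_ge_self)
    finally show ?thesis by (simp only: abs_mult)
  qed
  then show "AE x in M. norm (w x * (f x * g x)) \<le> norm (C * ((f x)\<^sup>2 + (g x)\<^sup>2))"
    by (intro AE_I2) auto
qed

lemma integrable_mult_of_square_integrable:
  assumes "square_integrable M f" "square_integrable M g"
  shows "integrable M (\<lambda>x. f x * g x)"
  using integrable_weighted_mult[OF assms, of "\<lambda>_. 1" 1] by simp

lemma square_integrable_mult_bounded:
  fixes w :: "'a \<Rightarrow> real"
  assumes f: "square_integrable M f"
    and w [measurable]: "w \<in> borel_measurable M" and C: "\<And>x. x \<in> space M \<Longrightarrow> \<bar>w x\<bar> \<le> C"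
  shows "square_integrable M (\<lambda>x. w x * f x)"
proof -
  have [measurable]: "f \<in> borel_measurable M" using f by (simp add: square_integrable_def)
  have "\<bar>(w x)\<^sup>2\<bar> \<le> C\<^sup>2" if "x \<in> space M" for x
    using C[OF that] by (simp add: abs_le_square_iff[symmetric])
  from integrable_weighted_mult[OF f f _ this] have "integrable M (\<lambda>x. (w x)\<^sup>2 * (f x * f x))"
    by simp
  then show ?thesis
    by (simp add: square_integrable_def power2_eq_square mult_ac)
qed

lemma square_integrable_add:
  assumes f: "square_integrable M f" and g: "square_integrable M g"
  shows "square_integrable M (\<lambda>x. f x + g x)"
proof -
  have "integrable M (\<lambda>x. (f x)\<^sup>2 + (g x)\<^sup>2 + 2 * (f x * g x))"
    using integrable_mult_of_square_integrable[OF f g] f g by (auto simp: square_integrable_def)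
  then show ?thesis using f g
    by (auto simp: square_integrable_def power2_sum algebra_simps)
qed

lemma square_integrable_cmult: "square_integrable M f \<Longrightarrow> square_integrable M (\<lambda>x. c * f x)"
  using square_integrable_mult_bounded[of M f "\<lambda>_. c" "\<bar>c\<bar>"] by simp

lemma square_integrable_diff:
  assumes f: "square_integrable M f" and g: "square_integrable M g"
  shows "square_integrable M (\<lambda>x. f x - g x)"
  using square_integrable_add[OF f square_integrable_cmult[OF g, of "-1"]] by simp

lemma square_integrable_sum:
  assumes "\<And>i. i \<in> I \<Longrightarrow> square_integrable M (f i)"
  shows "square_integrable M (\<lambda>x. \<Sum>i\<in>I. f i x)"
  using assms
proof (induction I rule: infinite_finite_induct)
  case (insert i I)
  then show ?case by (simp add: square_integrable_add)
qed (simp_all add: square_integrable_def)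

lemma (in finite_measure) square_integrable_bounded:
  fixes f :: "'a \<Rightarrow> real"
  assumes [measurable]: "f \<in> borel_measurable M" and C: "\<And>x. x \<in> space M \<Longrightarrow> \<bar>f x\<bar> \<le> C"
  shows "square_integrable M f"
  unfolding square_integrable_def
proof (intro conjI integrable_const_bound[where B="C\<^sup>2"] AE_I2)
  fix x assume "x \<in> space M"
  from C[OF this] show "norm ((f x)\<^sup>2) \<le> C\<^sup>2"
    by (simp add: abs_le_square_iff[symmetric])
qed measurable

lemma square_le_add: "(x::real)\<^sup>2 \<le> 2 * (x - y)\<^sup>2 + 2 * y\<^sup>2"
proof -
  have "2 * (x - y)\<^sup>2 + 2 * y\<^sup>2 - x\<^sup>2 = (x - 2 * y)\<^sup>2" by (simp add: power2_eq_square algebra_simps)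
  then show ?thesis by (metis diff_ge_0_iff_ge zero_le_power2)
qed

text \<open>Square integrability is part of the notion because the Bochner integral of a
  non-integrable function is 0, so that the limit by itself would carry no information.\<close>

definition L2_tendsto :: "'a measure \<Rightarrow> (nat \<Rightarrow> 'a \<Rightarrow> real) \<Rightarrow> ('a \<Rightarrow> real) \<Rightarrow> bool" where
  "L2_tendsto M f g \<longleftrightarrow> (\<forall>k. square_integrable M (f k)) \<and> square_integrable M g \<and>
     (\<lambda>k. \<integral>x. (f k x - g x)\<^sup>2 \<partial>M) \<longlonglongrightarrow> 0"

text \<open>The bridge from the definition of the Ito integral, which uses nonnegative integrals and
  asks only measurability of the limit. A single index at finite distance makes \<open>g\<close>
  square integrable, being the sum of \<open>g - f k\<close> and \<open>f k\<close>.\<close>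

lemma L2_tendstoI_nn_integral:
  assumes f: "\<And>k. square_integrable M (f k)" and [measurable]: "g \<in> borel_measurable M"
    and lim: "(\<lambda>k. \<integral>\<^sup>+x. ennreal ((g x - f k x)\<^sup>2) \<partial>M) \<longlonglongrightarrow> 0"
  shows "L2_tendsto M f g"
proof -
  have [measurable]: "f k \<in> borel_measurable M" for k using f by (simp add: square_integrable_def)
  from lim have "\<forall>\<^sub>F k in sequentially. (\<integral>\<^sup>+x. ennreal ((g x - f k x)\<^sup>2) \<partial>M) < \<infinity>"
    by (rule order_tendstoD) simp
  then obtain k where "(\<integral>\<^sup>+x. ennreal ((g x - f k x)\<^sup>2) \<partial>M) < \<infinity>"
    by (meson eventually_sequentially order_refl)
  then have "integrable M (\<lambda>x. (g x - f k x)\<^sup>2)"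
    by (subst integrable_iff_bounded) simp
  then have "square_integrable M (\<lambda>x. g x - f k x)" by (simp add: square_integrable_def)
  from square_integrable_add[OF this f[of k]] have g: "square_integrable M g" by simp
  have "(\<integral>\<^sup>+x. ennreal ((g x - f k x)\<^sup>2) \<partial>M) = ennreal (\<integral>x. (f k x - g x)\<^sup>2 \<partial>M)" for k
    using square_integrable_diff[OF f[of k] g]
    by (subst nn_integral_eq_integral[symmetric])
       (auto simp: square_integrable_def power2_commute)
  with lim have "(\<lambda>k. ennreal (\<integral>x. (f k x - g x)\<^sup>2 \<partial>M)) \<longlonglongrightarrow> ennreal 0" by simp
  then have "(\<lambda>k. \<integral>x. (f k x - g x)\<^sup>2 \<partial>M) \<longlonglongrightarrow> 0"
    by (subst (asm) tendsto_ennreal_iff) auto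
  with f g show ?thesis by (simp add: L2_tendsto_def)
qed

lemma L2_tendsto_const: "square_integrable M g \<Longrightarrow> L2_tendsto M (\<lambda>_. g) g"
  by (simp add: L2_tendsto_def)

lemma L2_tendsto_add:
  assumes "L2_tendsto M f f'" "L2_tendsto M g g'"
  shows "L2_tendsto M (\<lambda>k x. f k x + g k x) (\<lambda>x. f' x + g' x)"
proof -
  have sf: "square_integrable M (f k)" "square_integrable M f'"
    and sg: "square_integrable M (g k)" "square_integrable M g'" for k
    using assms by (auto simp: L2_tendsto_def)
  have df: "integrable M (\<lambda>x. (f k x - f' x)\<^sup>2)" and dg: "integrable M (\<lambda>x. (g k x - g' x)\<^sup>2)" for k
    using square_integrable_diff[OF sf] square_integrable_diff[OF sg]
    by (auto simp: square_integrable_def)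
  have le: "(\<integral>x. (f k x + g k x - (f' x + g' x))\<^sup>2 \<partial>M)
      \<le> 2 * (\<integral>x. (f k x - f' x)\<^sup>2 \<partial>M) + 2 * (\<integral>x. (g k x - g' x)\<^sup>2 \<partial>M)" for k
  proof -
    have "(\<integral>x. (f k x + g k x - (f' x + g' x))\<^sup>2 \<partial>M)
      \<le> (\<integral>x. 2 * (f k x - f' x)\<^sup>2 + 2 * (g k x - g' x)\<^sup>2 \<partial>M)"
    proof (rule integral_mono)
      show "integrable M (\<lambda>x. (f k x + g k x - (f' x + g' x))\<^sup>2)"
        using square_integrable_diff[OF square_integrable_add[OF sf(1) sg(1), of k k]
            square_integrable_add[OF sf(2) sg(2)]]
        by (simp add: square_integrable_def)
    next
      fix x
      show "(f k x + g k x - (f' x + g' x))\<^sup>2 \<le> 2 * (f k x - f' x)\<^sup>2 + 2 * (g k x - g' x)\<^sup>2"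
        using square_le_add[of "f k x + g k x - (f' x + g' x)" "g k x - g' x"]
        by (simp add: algebra_simps)
    qed (use df dg in auto)
    then show ?thesis using df dg by simp
  qed
  have "(\<lambda>k. 2 * (\<integral>x. (f k x - f' x)\<^sup>2 \<partial>M) + 2 * (\<integral>x. (g k x - g' x)\<^sup>2 \<partial>M)) \<longlonglongrightarrow> 2 * 0 + 2 * 0"
      using assms by (intro tendsto_intros) (auto simp: L2_tendsto_def)
  from this[simplified] have "(\<lambda>k. \<integral>x. (f k x + g k x - (f' x + g' x))\<^sup>2 \<partial>M) \<longlonglongrightarrow> 0"
    by (rule tendsto_sandwich[OF _ _ tendsto_const, rotated -1])
      (use le in auto)
  then show ?thesis
    using square_integrable_add[OF sf(1) sg(1)] square_integrable_add[OF sf(2) sg(2)]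
    by (simp add: L2_tendsto_def)
qed

lemma L2_tendsto_mult_bounded:
  fixes w :: "'a \<Rightarrow> real"
  assumes "L2_tendsto M f g"
    and w [measurable]: "w \<in> borel_measurable M" and C: "\<And>x. x \<in> space M \<Longrightarrow> \<bar>w x\<bar> \<le> C"
  shows "L2_tendsto M (\<lambda>k x. w x * f k x) (\<lambda>x. w x * g x)"
proof -
  have sf: "square_integrable M (f k)" "square_integrable M g" for k
    using assms by (auto simp: L2_tendsto_def)
  have le: "(\<integral>x. (w x * f k x - w x * g x)\<^sup>2 \<partial>M) \<le> C\<^sup>2 * (\<integral>x. (f k x - g x)\<^sup>2 \<partial>M)" for k
  proof -
    have "(\<integral>x. (w x * f k x - w x * g x)\<^sup>2 \<partial>M) \<le> (\<integral>x. C\<^sup>2 * (f k x - g x)\<^sup>2 \<partial>M)"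
    proof (rule integral_mono)
      show "integrable M (\<lambda>x. (w x * f k x - w x * g x)\<^sup>2)"
        using square_integrable_mult_bounded[OF square_integrable_diff[OF sf, of k] w C]
        by (simp add: square_integrable_def algebra_simps)
      fix x assume "x \<in> space M"
      then have "\<bar>w x\<bar> \<le> \<bar>C\<bar>" using C[of x] by linarith
      then have "(w x)\<^sup>2 \<le> C\<^sup>2" by (simp only: abs_le_square_iff)
      then have "(w x)\<^sup>2 * (f k x - g x)\<^sup>2 \<le> C\<^sup>2 * (f k x - g x)\<^sup>2" by (rule mult_right_mono) simp
      moreover have "(w x * f k x - w x * g x)\<^sup>2 = (w x)\<^sup>2 * (f k x - g x)\<^sup>2"
        by (simp add: right_diff_distrib[symmetric] power_mult_distrib)
      ultimately show "(w x * f k x - w x * g x)\<^sup>2 \<le> C\<^sup>2 * (f k x - g x)\<^sup>2" by simp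
    qed (use square_integrable_diff[OF sf] in \<open>auto simp: square_integrable_def\<close>)
    then show ?thesis by simp
  qed
  have "(\<lambda>k. C\<^sup>2 * (\<integral>x. (f k x - g x)\<^sup>2 \<partial>M)) \<longlonglongrightarrow> C\<^sup>2 * 0"
      using assms by (intro tendsto_intros) (auto simp: L2_tendsto_def)
  from this[simplified] have "(\<lambda>k. \<integral>x. (w x * f k x - w x * g x)\<^sup>2 \<partial>M) \<longlonglongrightarrow> 0"
    by (rule tendsto_sandwich[OF _ _ tendsto_const, rotated -1])
      (use le in auto)
  then show ?thesis
    using square_integrable_mult_bounded[OF sf(1) w C] square_integrable_mult_bounded[OF sf(2) w C]
    by (simp add: L2_tendsto_def)
qed

lemma L2_tendsto_diff:
  assumes f: "L2_tendsto M f f'" and g: "L2_tendsto M g g'"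
  shows "L2_tendsto M (\<lambda>k x. f k x - g k x) (\<lambda>x. f' x - g' x)"
  using L2_tendsto_add[OF f L2_tendsto_mult_bounded[OF g, of "\<lambda>_. -1" 1]] by simp

lemma young_abs_mult:
  fixes a b \<theta> :: real
  assumes "\<theta> > 0"
  shows "\<bar>a * b\<bar> \<le> a\<^sup>2 / \<theta> + \<theta> * b\<^sup>2"
proof -
  have "0 \<le> (\<bar>a\<bar> - \<theta> * \<bar>b\<bar>)\<^sup>2" by simp
  then have "2 * \<theta> * \<bar>a * b\<bar> \<le> a\<^sup>2 + \<theta>\<^sup>2 * b\<^sup>2"
    by (simp add: power2_diff power_mult_distrib abs_mult algebra_simps)
  moreover have "\<theta> * \<bar>a * b\<bar> \<ge> 0" using assms by simp
  ultimately have "\<theta> * \<bar>a * b\<bar> \<le> a\<^sup>2 + \<theta>\<^sup>2 * b\<^sup>2" by linarith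
  also have "\<dots> = \<theta> * (a\<^sup>2 / \<theta> + \<theta> * b\<^sup>2)"
    using assms by (simp add: distrib_left power2_eq_square mult.assoc)
  finally have "\<theta> * \<bar>a * b\<bar> \<le> \<theta> * (a\<^sup>2 / \<theta> + \<theta> * b\<^sup>2)" .
  then show ?thesis using assms by simp
qed

text \<open>With \<open>g = f\<close> this carries weighted second moments to the limit, with
  \<open>g\<close> constantly 1 weighted means. Expanding the product around the limits gives two
  mixed terms and a product of errors; Young's inequality splits each mixed term into a part that
  vanishes with \<open>k\<close> and a part proportional to \<open>\<theta>\<close>.\<close>

lemma L2_tendsto_integral_mult:
  fixes w :: "'a \<Rightarrow> real"
  assumes F: "L2_tendsto M f f'" and G: "L2_tendsto M g g'"
    and w [measurable]: "w \<in> borel_measurable M" and C: "\<And>x. x \<in> space M \<Longrightarrow> \<bar>w x\<bar> \<le> C"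
  shows "(\<lambda>k. \<integral>x. w x * (f k x * g k x) \<partial>M) \<longlonglongrightarrow> (\<integral>x. w x * (f' x * g' x) \<partial>M)"
proof (rule LIMSEQ_I)
  fix r :: real assume r: "0 < r"
  have sf: "square_integrable M (f k)" "square_integrable M f'"
    and sg: "square_integrable M (g k)" "square_integrable M g'" for k
    using assms by (auto simp: L2_tendsto_def)
  note wi = integrable_weighted_mult[OF _ _ w C]
  define a where "a k = (\<integral>x. (f k x - f' x)\<^sup>2 \<partial>M)" for k
  define b where "b k = (\<integral>x. (g k x - g' x)\<^sup>2 \<partial>M)" for k
  define A where "A = (\<integral>x. (f' x)\<^sup>2 \<partial>M) + (\<integral>x. (g' x)\<^sup>2 \<partial>M)"
  have A0: "A \<ge> 0" by (simp add: A_def)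
  have df: "square_integrable M (\<lambda>x. f k x - f' x)" and dg: "square_integrable M (\<lambda>x. g k x - g' x)" for k
    using square_integrable_diff[OF sf] square_integrable_diff[OF sg] by auto
  \<comment> \<open>The only contribution that survives the limit in \<open>k\<close> is
    \<open>|C| \<theta> A\<close>; this choice makes it at most \<open>r / 2\<close>. The summand 1
    keeps the denominator positive.\<close>
  define \<theta> where "\<theta> = r / (2 * (\<bar>C\<bar> * A + 1))"
  have den: "\<bar>C\<bar> * A + 1 > 0" using A0 by (simp add: add_nonneg_pos)
  then have \<theta>: "\<theta> > 0" using r by (simp add: \<theta>_def)
  have bound: "\<bar>(\<integral>x. w x * (f k x * g k x) \<partial>M) - (\<integral>x. w x * (f' x * g' x) \<partial>M)\<bar>
      \<le> \<bar>C\<bar> * ((a k + b k) / \<theta> + \<theta> * A + a k + b k)" for k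
  proof -
    have "\<bar>(\<integral>x. w x * (f k x * g k x) \<partial>M) - (\<integral>x. w x * (f' x * g' x) \<partial>M)\<bar>
      = \<bar>\<integral>x. w x * (f k x * g k x) - w x * (f' x * g' x) \<partial>M\<bar>"
      using wi[OF sf(1) sg(1)] wi[OF sf(2) sg(2)] by simp
    also have "\<dots> \<le> (\<integral>x. \<bar>w x * (f k x * g k x) - w x * (f' x * g' x)\<bar> \<partial>M)"
      by (rule integral_abs_bound)
    also have "\<dots> \<le> (\<integral>x. \<bar>C\<bar> * (((f k x - f' x)\<^sup>2 + (g k x - g' x)\<^sup>2) / \<theta>
        + \<theta> * ((f' x)\<^sup>2 + (g' x)\<^sup>2) + (f k x - f' x)\<^sup>2 + (g k x - g' x)\<^sup>2) \<partial>M)"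
    proof (rule integral_mono)
      show "integrable M (\<lambda>x. \<bar>w x * (f k x * g k x) - w x * (f' x * g' x)\<bar>)"
        using wi[OF sf(1) sg(1)] wi[OF sf(2) sg(2)] by simp
      fix x assume x: "x \<in> space M"
      let ?d = "f k x - f' x" and ?e = "g k x - g' x"
      have "\<bar>f k x * g k x - f' x * g' x\<bar> = \<bar>?d * g' x + ?e * f' x + ?d * ?e\<bar>"
        by (simp add: algebra_simps)
      also have "\<dots> \<le> \<bar>?d * g' x\<bar> + \<bar>?e * f' x\<bar> + \<bar>?d * ?e\<bar>" by linarith
      also have "\<dots> \<le> (?d\<^sup>2 / \<theta> + \<theta> * (g' x)\<^sup>2) + (?e\<^sup>2 / \<theta> + \<theta> * (f' x)\<^sup>2) + (?d\<^sup>2 / 1 + 1 * ?e\<^sup>2)"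
        by (intro add_mono young_abs_mult \<theta>) simp
      also have "\<dots> = (?d\<^sup>2 + ?e\<^sup>2) / \<theta> + \<theta> * ((f' x)\<^sup>2 + (g' x)\<^sup>2) + ?d\<^sup>2 + ?e\<^sup>2"
        by (simp add: add_divide_distrib algebra_simps)
      finally have "\<bar>w x\<bar> * \<bar>f k x * g k x - f' x * g' x\<bar>
        \<le> \<bar>C\<bar> * ((?d\<^sup>2 + ?e\<^sup>2) / \<theta> + \<theta> * ((f' x)\<^sup>2 + (g' x)\<^sup>2) + ?d\<^sup>2 + ?e\<^sup>2)"
        using C[OF x] by (intro mult_mono) auto
      then show "\<bar>w x * (f k x * g k x) - w x * (f' x * g' x)\<bar>
        \<le> \<bar>C\<bar> * ((?d\<^sup>2 + ?e\<^sup>2) / \<theta> + \<theta> * ((f' x)\<^sup>2 + (g' x)\<^sup>2) + ?d\<^sup>2 + ?e\<^sup>2)"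
        by (simp only: right_diff_distrib[symmetric] abs_mult)
    qed (use df dg sf sg in \<open>auto simp: square_integrable_def\<close>)
    also have "\<dots> = \<bar>C\<bar> * ((a k + b k) / \<theta> + \<theta> * A + a k + b k)"
      using df dg sf sg by (simp add: square_integrable_def a_def b_def A_def)
    finally show ?thesis .
  qed
  have "(\<lambda>k. \<bar>C\<bar> * ((a k + b k) / \<theta> + \<theta> * A + a k + b k)) \<longlonglongrightarrow> \<bar>C\<bar> * ((0 + 0) / \<theta> + \<theta> * A + 0 + 0)"
    using F G \<theta> by (intro tendsto_intros) (auto simp: L2_tendsto_def a_def b_def)
  moreover have "\<bar>C\<bar> * ((0 + 0) / \<theta> + \<theta> * A + 0 + 0) < r"
  proof -
    have "\<theta> * (\<bar>C\<bar> * A) \<le> \<theta> * (\<bar>C\<bar> * A + 1)" using \<theta> by simp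
    also have "\<dots> = r / 2" using den by (simp add: \<theta>_def field_simps)
    also have "\<dots> < r" using r by simp
    finally show ?thesis by (simp add: mult_ac)
  qed
  ultimately have "\<forall>\<^sub>F k in sequentially. \<bar>C\<bar> * ((a k + b k) / \<theta> + \<theta> * A + a k + b k) < r"
    by (rule order_tendstoD(2))
  then show "\<exists>no. \<forall>k\<ge>no. norm ((\<integral>x. w x * (f k x * g k x) \<partial>M) - (\<integral>x. w x * (f' x * g' x) \<partial>M)) < r"
    using bound by (auto simp: eventually_sequentially intro: order.strict_trans1)
qed

section \<open>Brownian increments\<close>

locale brownian_motion = filtered_prob_space M F
  for M :: "'a measure" and F :: "real \<Rightarrow> 'a measure" +
  fixes W :: "real \<Rightarrow> 'a \<Rightarrow> real"
  assumes brownian: "standard_brownian_motion W"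
begin

lemma measurable_M: "0 \<le> t \<Longrightarrow> f \<in> borel_measurable (F t) \<Longrightarrow> f \<in> borel_measurable M"
  by (rule measurable_from_subalg[OF subalgebra_F])

lemma measurable_F_mono: "s \<le> t \<Longrightarrow> f \<in> borel_measurable (F s) \<Longrightarrow> f \<in> borel_measurable (F t)"
  using sets_F_mono[of s t] by (auto simp: measurable_def space_F)

lemma W_measurable_F: "0 \<le> s \<Longrightarrow> s \<le> t \<Longrightarrow> W s \<in> borel_measurable (F t)"
  using brownian measurable_F_mono[of s t "W s"]
  by (auto simp: standard_brownian_motion_def continuous_adapted_def)

lemma W_measurable: "0 \<le> t \<Longrightarrow> W t \<in> borel_measurable M"
  using W_measurable_F[of t t] measurable_M by auto

lemma indep_increment:
  assumes st: "0 \<le> s" "s < t" and G: "G \<in> borel_measurable (F s)"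
  shows "indep_var borel G borel (\<lambda>\<omega>. W t \<omega> - W s \<omega>)"
proof -
  have indep: "indep_set (sets (F s)) {(\<lambda>\<omega>. W t \<omega> - W s \<omega>) -` A \<inter> space M |A. A \<in> sets borel}"
    using brownian st by (auto simp: standard_brownian_motion_def)
  have [measurable]: "W t \<in> borel_measurable M" "W s \<in> borel_measurable M" using W_measurable st by auto
  have "indep_set {G -` A \<inter> space M |A. A \<in> sets borel} {(\<lambda>\<omega>. W t \<omega> - W s \<omega>) -` A \<inter> space M |A. A \<in> sets borel}"
    using indep measurable_sets[OF G] unfolding indep_sets2_eq space_F by blast
  \<comment> \<open>\<open>indep_var\<close> is phrased through a family indexed by the Booleans;
    this identity brings its sets into the two-family form just established.\<close>
  moreover have "(\<lambda>b. {case_bool G (\<lambda>\<omega>. W t \<omega> - W s \<omega>) b -` A \<inter> space M |A. A \<in> sets (case_bool borel borel b)})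
    = case_bool {G -` A \<inter> space M |A. A \<in> sets borel} {(\<lambda>\<omega>. W t \<omega> - W s \<omega>) -` A \<inter> space M |A. A \<in> sets borel}"
    by (simp add: fun_eq_iff split: bool.split)
  ultimately show ?thesis
    using measurable_M[OF st(1) G]
    by (simp add: indep_var_def indep_vars_def2 indep_set_def split: bool.split)
qed

section \<open>Gaussian moments of the increments\<close>

lemma increment_moment:
  assumes "0 \<le> s" "s < t"
  shows "integrable M (\<lambda>\<omega>. (W t \<omega> - W s \<omega>) ^ k)"
    and "(\<integral>\<omega>. (W t \<omega> - W s \<omega>) ^ k \<partial>M) = (\<integral>x. normal_density 0 (sqrt (t - s)) x * x ^ k \<partial>lborel)"
proof -
  have D: "distributed M lborel (\<lambda>\<omega>. W t \<omega> - W s \<omega>) (normal_density 0 (sqrt (t - s)))"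
    using brownian assms by (auto simp: standard_brownian_motion_def)
  show "integrable M (\<lambda>\<omega>. (W t \<omega> - W s \<omega>) ^ k)"
    using assms by (subst distributed_integrable[OF D, symmetric])
      (auto intro: integrable_normal_moment[where \<mu>=0, simplified])
  show "(\<integral>\<omega>. (W t \<omega> - W s \<omega>) ^ k \<partial>M) = (\<integral>x. normal_density 0 (sqrt (t - s)) x * x ^ k \<partial>lborel)"
    by (subst distributed_integral[OF D, symmetric]) auto
qed

lemma integrable_increment_power:
  assumes "0 \<le> s" "s \<le> t"
  shows "integrable M (\<lambda>\<omega>. (W t \<omega> - W s \<omega>) ^ k)"
  using increment_moment(1)[of s t k] assms by (cases "s = t") auto

lemma square_integrable_increment:
  assumes "0 \<le> s" "s \<le> t"
  shows "square_integrable M (\<lambda>\<omega>. W t \<omega> - W s \<omega>)"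
  using integrable_increment_power[OF assms, of 2] W_measurable assms
  by (simp add: square_integrable_def)

lemma expectation_increment_power4:
  assumes "0 \<le> s" "s \<le> t"
  shows "(\<integral>\<omega>. (W t \<omega> - W s \<omega>) ^ 4 \<partial>M) = 3 * (t - s)\<^sup>2"
proof (cases "s = t")
  case False
  then have "0 < sqrt (t - s)" using assms by simp
  from integral_normal_moment_even[OF this, of 0 2] show ?thesis
    using False assms by (subst increment_moment) (auto simp: fact_numeral field_simps power2_eq_square)
qed simp

lemma expectation_mult_increment_power:
  assumes st: "0 \<le> s" "s < t" and G: "G \<in> borel_measurable (F s)" "integrable M G"
  shows "(\<integral>\<omega>. G \<omega> * (W t \<omega> - W s \<omega>) ^ k \<partial>M)
    = (\<integral>\<omega>. G \<omega> \<partial>M) * (\<integral>x. normal_density 0 (sqrt (t - s)) x * x ^ k \<partial>lborel)"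
proof -
  have "indep_var borel (id \<circ> G) borel ((\<lambda>x. x ^ k) \<circ> (\<lambda>\<omega>. W t \<omega> - W s \<omega>))"
    by (rule indep_var_compose[OF indep_increment[OF st G(1)]]) auto
  then have "indep_var borel G borel (\<lambda>\<omega>. (W t \<omega> - W s \<omega>) ^ k)" by (simp add: comp_def)
  from indep_var_lebesgue_integral[OF this G(2) increment_moment(1)[OF st]] show ?thesis
    by (simp add: increment_moment(2)[OF st])
qed

lemma expectation_mult_increment:
  assumes "0 \<le> s" "s \<le> t" "G \<in> borel_measurable (F s)" "integrable M G"
  shows "(\<integral>\<omega>. G \<omega> * (W t \<omega> - W s \<omega>) \<partial>M) = 0"
proof (cases "s = t")
  case False
  then have "0 < sqrt (t - s)" using assms by simp
  from integral_normal_moment_odd[OF this, of 0 0] show ?thesis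
    using False assms expectation_mult_increment_power[of s t G 1] by simp
qed simp

lemma expectation_mult_increment_square:
  assumes "0 \<le> s" "s \<le> t" "G \<in> borel_measurable (F s)" "integrable M G"
  shows "(\<integral>\<omega>. G \<omega> * (W t \<omega> - W s \<omega>)\<^sup>2 \<partial>M) = (t - s) * (\<integral>\<omega>. G \<omega> \<partial>M)"
proof (cases "s = t")
  case False
  then have "0 < sqrt (t - s)" using assms by simp
  have "(\<integral>x. normal_density 0 (sqrt (t - s)) x * x ^ 2 \<partial>lborel) = t - s"
    using integral_normal_moment_even[OF \<open>0 < sqrt (t - s)\<close>, of 0 1] assms
    by (simp add: power_divide field_simps power2_eq_square)
  then show ?thesis
    using False assms expectation_mult_increment_power[of s t G 2] by simp
qed simp

text \<open>The factor \<open>max 0 (min b d - c)\<close> is the length of the overlap of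
  \<open>{a<..b}\<close> and \<open>{c<..d}\<close>. The increments are cut at \<open>c\<close> and
  at the smaller right end point. A product over disjoint pieces has mean 0, since the later
  increment is centred and independent of the earlier one and of \<open>Z\<close>; only the square
  over the overlap contributes.\<close>

lemma expectation_increment_product_aux:
  assumes ab: "0 \<le> a" "a \<le> c" "a \<le> b" "c \<le> d"
    and Z: "Z \<in> borel_measurable (F c)" and C: "\<And>\<omega>. \<omega> \<in> space M \<Longrightarrow> \<bar>Z \<omega>\<bar> \<le> C"
  shows "(\<integral>\<omega>. Z \<omega> * ((W b \<omega> - W a \<omega>) * (W d \<omega> - W c \<omega>)) \<partial>M)
    = max 0 (min b d - c) * (\<integral>\<omega>. Z \<omega> \<partial>M)"
proof -
  have [measurable]: "Z \<in> borel_measurable M" using Z ab measurable_M[of c] by auto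
  have Zi: "integrable M Z" using C by (intro integrable_const_bound[where B=C] AE_I2) auto
  have int: "integrable M (\<lambda>\<omega>. Z \<omega> * ((W q \<omega> - W p \<omega>) * (W q' \<omega> - W p' \<omega>)))"
    if "0 \<le> p" "p \<le> q" "0 \<le> p'" "p' \<le> q'" for p q p' q'
    using C that by (intro integrable_weighted_mult[where C=C] square_integrable_increment) auto
  have sqZ: "square_integrable M Z" using C by (intro square_integrable_bounded) auto
  have zero: "(\<integral>\<omega>. Z \<omega> * ((W q \<omega> - W p \<omega>) * (W q' \<omega> - W p' \<omega>)) \<partial>M) = 0"
    if "0 \<le> p" "p \<le> q" "q \<le> p'" "p' \<le> q'" "c \<le> p'" for p q p' q'
  proof -
    have [measurable]: "Z \<in> borel_measurable (F p')" using measurable_F_mono[OF that(5) Z] .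
    have [measurable]: "W q \<in> borel_measurable (F p')" "W p \<in> borel_measurable (F p')"
      by (rule W_measurable_F; use that in linarith)+
    have "integrable M (\<lambda>\<omega>. Z \<omega> * (W q \<omega> - W p \<omega>))"
      using that by (intro integrable_mult_of_square_integrable sqZ square_integrable_increment) auto
    then show ?thesis
      using expectation_mult_increment[of p' q' "\<lambda>\<omega>. Z \<omega> * (W q \<omega> - W p \<omega>)"] that
      by (simp add: mult.assoc)
  qed
  have sq: "(\<integral>\<omega>. Z \<omega> * ((W q \<omega> - W c \<omega>) * (W q \<omega> - W c \<omega>)) \<partial>M) = (q - c) * (\<integral>\<omega>. Z \<omega> \<partial>M)"
    if "c \<le> q" for q
    using expectation_mult_increment_square[of c q Z] that ab Z Zi by (simp add: power2_eq_square)
  consider "b \<le> c" | "c < b" "b \<le> d" | "c < b" "d < b" by linarith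
  then show ?thesis
  proof cases
    case 1
    then show ?thesis using zero[of a b c d] ab by simp
  next
    case 2
    have "(\<integral>\<omega>. Z \<omega> * ((W b \<omega> - W a \<omega>) * (W d \<omega> - W c \<omega>)) \<partial>M)
      = (\<integral>\<omega>. Z \<omega> * ((W c \<omega> - W a \<omega>) * (W d \<omega> - W c \<omega>)) + Z \<omega> * ((W b \<omega> - W c \<omega>) * (W b \<omega> - W c \<omega>))
        + Z \<omega> * ((W b \<omega> - W c \<omega>) * (W d \<omega> - W b \<omega>)) \<partial>M)"
      by (rule Bochner_Integration.integral_cong) (auto simp: algebra_simps)
    also have "\<dots> = (b - c) * (\<integral>\<omega>. Z \<omega> \<partial>M)"
      using 2 ab by (simp add: int zero sq)
    finally show ?thesis using 2 by simp
  next
    case 3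
    have "(\<integral>\<omega>. Z \<omega> * ((W b \<omega> - W a \<omega>) * (W d \<omega> - W c \<omega>)) \<partial>M)
      = (\<integral>\<omega>. Z \<omega> * ((W c \<omega> - W a \<omega>) * (W d \<omega> - W c \<omega>)) + Z \<omega> * ((W d \<omega> - W c \<omega>) * (W d \<omega> - W c \<omega>))
        + Z \<omega> * ((W d \<omega> - W c \<omega>) * (W b \<omega> - W d \<omega>)) \<partial>M)"
      by (rule Bochner_Integration.integral_cong) (auto simp: algebra_simps)
    also have "\<dots> = (d - c) * (\<integral>\<omega>. Z \<omega> \<partial>M)"
      using 3 ab by (simp add: int zero sq)
    finally show ?thesis using 3 ab by simp
  qed
qed

text \<open>The later of the two left end points takes the role of \<open>c\<close> in the preceding
  lemma. Measurability of \<open>Z\<close> is asked only for nonempty intervals; if one of them is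
  empty, both sides are 0.\<close>

lemma expectation_increment_product:
  assumes ab: "0 \<le> a" "0 \<le> c" "a \<le> b" "c \<le> d"
    and Z: "a < b \<Longrightarrow> c < d \<Longrightarrow> Z \<in> borel_measurable (F (max a c))"
    and C: "\<And>\<omega>. \<omega> \<in> space M \<Longrightarrow> \<bar>Z \<omega>\<bar> \<le> C"
  shows "(\<integral>\<omega>. Z \<omega> * ((W b \<omega> - W a \<omega>) * (W d \<omega> - W c \<omega>)) \<partial>M)
    = max 0 (min b d - max a c) * (\<integral>\<omega>. Z \<omega> \<partial>M)"
proof -
  consider "a = b" | "c = d" | "a < b" "c < d" "a \<le> c" | "a < b" "c < d" "c \<le> a" using ab by linarith
  then show ?thesis
  proof cases
    case 3
    then show ?thesis using expectation_increment_product_aux[of a c b d Z C] ab Z C by (simp add: max_def)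
  next
    case 4
    then show ?thesis using expectation_increment_product_aux[of c a d b Z C] ab Z C
      by (simp add: max_def min.commute mult.commute)
  qed (use ab in \<open>auto simp: max_def min_def\<close>)
qed

end

section \<open>Elementary processes\<close>

text \<open>Restricting time to a bounded interval makes the product a finite measure when
  \<open>M\<close> is one, so that bounded measurable functions are integrable.\<close>

definition time_product :: "'a measure \<Rightarrow> real \<Rightarrow> ('a \<times> real) measure" where
  "time_product M T = M \<Otimes>\<^sub>M restrict_space lborel {0..T}"

lemma finite_measure_time: "finite_measure (restrict_space lborel {0..T::real})"
  by (rule finite_measureI) (simp add: emeasure_restrict_space space_restrict_space emeasure_lborel_Icc_eq)

context brownian_motion
begin

lemma finite_measure_time_product: "finite_measure (time_product M T)"
  unfolding time_product_def
  by (intro finite_measure_pair_measure finite_measure_time finite_measure_axioms)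

lemma pair_sigma_finite_time: "pair_sigma_finite M (restrict_space lborel {0..T::real})"
  by (intro pair_sigma_finite.intro sigma_finite_measure_axioms finite_measure.axioms(1)[OF finite_measure_time])

lemma space_time_product: "space (time_product M T) = space M \<times> {0..T}"
  by (simp add: time_product_def space_pair_measure space_restrict_space)

text \<open>The intervals \<open>{a j<..b j}\<close> may overlap, so the difference of two simple processes is elementary
  without passing to a common refinement.  No adaptedness is required on empty intervals, because
  truncating a simple process at \<open>t\<close> collapses its later intervals to \<open>{t<..t}\<close>.\<close>

definition elementary ::
    "'i set \<Rightarrow> ('i \<Rightarrow> real) \<Rightarrow> ('i \<Rightarrow> real) \<Rightarrow> ('i \<Rightarrow> 'a \<Rightarrow> real) \<Rightarrow> bool" where
  "elementary J a b \<xi> \<longleftrightarrow> finite J \<and> (\<forall>j\<in>J. 0 \<le> a j \<and> a j \<le> b j \<and> \<xi> j \<in> borel_measurable M \<and>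
     bounded (\<xi> j ` space M) \<and> (a j < b j \<longrightarrow> \<xi> j \<in> borel_measurable (F (a j))))"

definition elementary_integral ::
    "'i set \<Rightarrow> ('i \<Rightarrow> real) \<Rightarrow> ('i \<Rightarrow> real) \<Rightarrow> ('i \<Rightarrow> 'a \<Rightarrow> real) \<Rightarrow> 'a \<Rightarrow> real" where
  "elementary_integral J a b \<xi> \<omega> = (\<Sum>j\<in>J. \<xi> j \<omega> * (W (b j) \<omega> - W (a j) \<omega>))"

definition elementary_value ::
    "'i set \<Rightarrow> ('i \<Rightarrow> real) \<Rightarrow> ('i \<Rightarrow> real) \<Rightarrow> ('i \<Rightarrow> 'a \<Rightarrow> real) \<Rightarrow> 'a \<times> real \<Rightarrow> real" where
  "elementary_value J a b \<xi> p = (\<Sum>j\<in>J. \<xi> j (fst p) * indicat_real {a j<..b j} (snd p))"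

lemma elementary_bound:
  assumes "elementary J a b \<xi>"
  obtains K where "K \<ge> 0" "\<And>j \<omega>. j \<in> J \<Longrightarrow> \<omega> \<in> space M \<Longrightarrow> \<bar>\<xi> j \<omega>\<bar> \<le> K"
proof -
  have "\<exists>k. \<forall>\<omega>\<in>space M. \<bar>\<xi> j \<omega>\<bar> \<le> k" if "j \<in> J" for j
    using assms that by (auto simp: elementary_def bounded_iff)
  then obtain k where k: "\<And>j \<omega>. j \<in> J \<Longrightarrow> \<omega> \<in> space M \<Longrightarrow> \<bar>\<xi> j \<omega>\<bar> \<le> k j" by metis
  show ?thesis
  proof
    show "(\<Sum>j\<in>J. \<bar>k j\<bar>) \<ge> 0" by (simp add: sum_nonneg)
    fix j \<omega> assume "j \<in> J" "\<omega> \<in> space M"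
    then have "\<bar>\<xi> j \<omega>\<bar> \<le> \<bar>k j\<bar>" using k by fastforce
    also have "\<dots> \<le> (\<Sum>j\<in>J. \<bar>k j\<bar>)"
      using assms \<open>j \<in> J\<close> by (intro member_le_sum) (auto simp: elementary_def)
    finally show "\<bar>\<xi> j \<omega>\<bar> \<le> (\<Sum>j\<in>J. \<bar>k j\<bar>)" .
  qed
qed

lemma square_integrable_elementary_integral:
  assumes e: "elementary J a b \<xi>"
  shows "square_integrable M (elementary_integral J a b \<xi>)"
proof -
  obtain K where K: "\<And>j \<omega>. j \<in> J \<Longrightarrow> \<omega> \<in> space M \<Longrightarrow> \<bar>\<xi> j \<omega>\<bar> \<le> K" using elementary_bound[OF e] by blast
  have "square_integrable M (\<lambda>\<omega>. \<xi> j \<omega> * (W (b j) \<omega> - W (a j) \<omega>))" if "j \<in> J" for j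
    by (rule square_integrable_mult_bounded[OF square_integrable_increment])
      (use e K that in \<open>auto simp: elementary_def\<close>)
  then show ?thesis
    unfolding elementary_integral_def[abs_def] by (rule square_integrable_sum)
qed

lemma measurable_fst_time_product:
  "f \<in> M \<rightarrow>\<^sub>M N \<Longrightarrow> (\<lambda>p. f (fst p)) \<in> time_product M T \<rightarrow>\<^sub>M N"
  unfolding time_product_def by (rule measurable_compose[OF measurable_fst])

lemma measurable_snd_time_product:
  "f \<in> borel \<rightarrow>\<^sub>M N \<Longrightarrow> (\<lambda>p. f (snd p)) \<in> time_product M T \<rightarrow>\<^sub>M N"
proof -
  assume "f \<in> borel \<rightarrow>\<^sub>M N"
  then have "f \<in> restrict_space lborel {0..T} \<rightarrow>\<^sub>M N" by (intro measurable_restrict_space1) simp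
  then show ?thesis unfolding time_product_def by (rule measurable_compose[OF measurable_snd])
qed

lemma square_integrable_elementary_value:
  assumes e: "elementary J a b \<xi>"
  shows "square_integrable (time_product M T) (elementary_value J a b \<xi>)"
proof -
  interpret P: finite_measure "time_product M T" by (rule finite_measure_time_product)
  obtain K where K: "K \<ge> 0" "\<And>j \<omega>. j \<in> J \<Longrightarrow> \<omega> \<in> space M \<Longrightarrow> \<bar>\<xi> j \<omega>\<bar> \<le> K"
    using elementary_bound[OF e] by blast
  have "square_integrable (time_product M T) (\<lambda>p. \<xi> j (fst p) * indicat_real {a j<..b j} (snd p))"
    if j: "j \<in> J" for j
  proof (rule P.square_integrable_bounded)
    show "(\<lambda>p. \<xi> j (fst p) * indicat_real {a j<..b j} (snd p)) \<in> borel_measurable (time_product M T)"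
      using e j by (intro borel_measurable_times measurable_fst_time_product measurable_snd_time_product)
        (simp_all add: elementary_def)
    show "\<bar>\<xi> j (fst p) * indicat_real {a j<..b j} (snd p)\<bar> \<le> K" if "p \<in> space (time_product M T)" for p
      using K j that by (auto simp: space_time_product indicator_def)
  qed
  then show ?thesis
    unfolding elementary_value_def[abs_def] by (rule square_integrable_sum)
qed

lemma integral_time_product_mult:
  fixes f :: "'a \<Rightarrow> real" and g :: "real \<Rightarrow> real"
  assumes f: "f \<in> borel_measurable M" "\<And>\<omega>. \<omega> \<in> space M \<Longrightarrow> \<bar>f \<omega>\<bar> \<le> C"
    and g: "g \<in> borel_measurable borel" "\<And>s. \<bar>g s\<bar> \<le> D"
  shows "(\<integral>p. f (fst p) * g (snd p) \<partial>time_product M T) = (\<integral>\<omega>. f \<omega> \<partial>M) * (\<integral>s. indicat_real {0..T} s * g s \<partial>lborel)"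
proof -
  interpret P: pair_sigma_finite M "restrict_space lborel {0..T}" by (rule pair_sigma_finite_time)
  interpret Q: finite_measure "time_product M T" by (rule finite_measure_time_product)
  have "integrable (time_product M T) (\<lambda>p. f (fst p) * g (snd p))"
  proof (rule Q.integrable_const_bound[where B="\<bar>C\<bar> * \<bar>D\<bar>"])
    show "AE p in time_product M T. norm (f (fst p) * g (snd p)) \<le> \<bar>C\<bar> * \<bar>D\<bar>"
      using f(2) g(2)
      by (intro AE_I2) (force simp: space_time_product abs_mult intro!: mult_mono intro: order_trans[OF _ abs_ge_self])
    show "(\<lambda>p. f (fst p) * g (snd p)) \<in> borel_measurable (time_product M T)"
      by (intro borel_measurable_times measurable_fst_time_product measurable_snd_time_product f g)
  qed
  then show ?thesis
    using P.integral_fst'[of "\<lambda>p. f (fst p) * g (snd p)"]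
    by (simp add: time_product_def integral_restrict_space)
qed

text \<open>Both squares expand into double sums over pairs \<open>(i, j)\<close>, and the two sums
  agree term by term: each term is the length of the overlap of the two intervals times the mean of
  \<open>G \<xi> i \<xi> j\<close>. All intervals begin at or after \<open>s\<close>, so the weight
  \<open>G\<close> is known when any of them starts; this is the isometry conditioned on
  \<open>F s\<close>.\<close>

lemma elementary_isometry:
  assumes e: "elementary J a b \<xi>" and s: "0 \<le> s" "\<And>j. j \<in> J \<Longrightarrow> s \<le> a j" "\<And>j. j \<in> J \<Longrightarrow> b j \<le> T"
    and G: "G \<in> borel_measurable (F s)" and C: "\<And>\<omega>. \<omega> \<in> space M \<Longrightarrow> \<bar>G \<omega>\<bar> \<le> C"
  shows "(\<integral>\<omega>. G \<omega> * (elementary_integral J a b \<xi> \<omega>)\<^sup>2 \<partial>M)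
    = (\<integral>p. G (fst p) * (elementary_value J a b \<xi> p)\<^sup>2 \<partial>time_product M T)"
proof -
  interpret P: finite_measure "time_product M T" by (rule finite_measure_time_product)
  obtain K where K: "K \<ge> 0" "\<And>j \<omega>. j \<in> J \<Longrightarrow> \<omega> \<in> space M \<Longrightarrow> \<bar>\<xi> j \<omega>\<bar> \<le> K"
    using elementary_bound[OF e] by blast
  have j: "0 \<le> a j" "a j \<le> b j" "\<xi> j \<in> borel_measurable M" "a j < b j \<Longrightarrow> \<xi> j \<in> borel_measurable (F (a j))"
    if "j \<in> J" for j using e that by (auto simp: elementary_def)
  have GM: "G \<in> borel_measurable M" using measurable_M[OF s(1) G] .
  have ZC: "\<bar>G \<omega> * (\<xi> i \<omega> * \<xi> j \<omega>)\<bar> \<le> \<bar>C\<bar> * (K * K)" if "i \<in> J" "j \<in> J" "\<omega> \<in> space M" for i j \<omega>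
    using C[OF that(3)] K that by (auto simp: abs_mult intro!: mult_mono)
  have ZM: "(\<lambda>\<omega>. G \<omega> * (\<xi> i \<omega> * \<xi> j \<omega>)) \<in> borel_measurable M" if "i \<in> J" "j \<in> J" for i j
    using j that GM by auto
  have eq1: "(\<integral>\<omega>. (G \<omega> * (\<xi> i \<omega> * \<xi> j \<omega>)) * ((W (b i) \<omega> - W (a i) \<omega>) * (W (b j) \<omega> - W (a j) \<omega>)) \<partial>M)
     = max 0 (min (b i) (b j) - max (a i) (a j)) * (\<integral>\<omega>. G \<omega> * (\<xi> i \<omega> * \<xi> j \<omega>) \<partial>M)"
    if "i \<in> J" "j \<in> J" for i j
  proof (rule expectation_increment_product)
    assume "a i < b i" "a j < b j"
    then have "\<xi> i \<in> borel_measurable (F (max (a i) (a j)))" "\<xi> j \<in> borel_measurable (F (max (a i) (a j)))"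
       "G \<in> borel_measurable (F (max (a i) (a j)))"
      using j[OF that(1)] j[OF that(2)] G s(2)[OF that(1)]
      by (auto intro: measurable_F_mono[rotated])
    then show "(\<lambda>\<omega>. G \<omega> * (\<xi> i \<omega> * \<xi> j \<omega>)) \<in> borel_measurable (F (max (a i) (a j)))" by auto
  qed (use ZC that j in auto)
  have eq2: "(\<integral>p. (G (fst p) * (\<xi> i (fst p) * \<xi> j (fst p))) *
       (indicat_real {a i<..b i} (snd p) * indicat_real {a j<..b j} (snd p)) \<partial>time_product M T)
     = max 0 (min (b i) (b j) - max (a i) (a j)) * (\<integral>\<omega>. G \<omega> * (\<xi> i \<omega> * \<xi> j \<omega>) \<partial>M)"
    if "i \<in> J" "j \<in> J" for i j
  proof -
    have "(\<integral>u. indicat_real {0..T} u * (indicat_real {a i<..b i} u * indicat_real {a j<..b j} u) \<partial>lborel)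
      = (\<integral>u. indicat_real {max (a i) (a j)<..min (b i) (b j)} u \<partial>lborel)"
      using j[OF that(1)] j[OF that(2)] s(3)[OF that(1)] s(3)[OF that(2)]
      by (intro Bochner_Integration.integral_cong) (auto simp: indicator_def)
    also have "\<dots> = max 0 (min (b i) (b j) - max (a i) (a j))"
      by (cases "max (a i) (a j) \<le> min (b i) (b j)") auto
    finally have I: "(\<integral>u. indicat_real {0..T} u * (indicat_real {a i<..b i} u * indicat_real {a j<..b j} u) \<partial>lborel)
      = max 0 (min (b i) (b j) - max (a i) (a j))" .
    have "(\<lambda>u. indicat_real {a i<..b i} u * indicat_real {a j<..b j} u) \<in> borel_measurable borel"
      by measurable
    from integral_time_product_mult[OF ZM[OF that] ZC[OF that] this, of 1 T] show ?thesis
      unfolding I by (simp add: abs_mult mult_le_one mult.commute)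
  qed
  have "(\<integral>\<omega>. G \<omega> * (elementary_integral J a b \<xi> \<omega>)\<^sup>2 \<partial>M)
    = (\<integral>\<omega>. (\<Sum>i\<in>J. \<Sum>j\<in>J. (G \<omega> * (\<xi> i \<omega> * \<xi> j \<omega>)) * ((W (b i) \<omega> - W (a i) \<omega>) * (W (b j) \<omega> - W (a j) \<omega>))) \<partial>M)"
    by (intro Bochner_Integration.integral_cong refl)
       (simp add: elementary_integral_def power2_eq_square sum_product sum_distrib_left mult_ac)
  also have "\<dots> = (\<Sum>i\<in>J. \<Sum>j\<in>J. max 0 (min (b i) (b j) - max (a i) (a j)) * (\<integral>\<omega>. G \<omega> * (\<xi> i \<omega> * \<xi> j \<omega>) \<partial>M))"
  proof -
    have "integrable M (\<lambda>\<omega>. (G \<omega> * (\<xi> i \<omega> * \<xi> j \<omega>)) * ((W (b i) \<omega> - W (a i) \<omega>) * (W (b j) \<omega> - W (a j) \<omega>)))"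
      if "i \<in> J" "j \<in> J" for i j
      using that j ZC[OF that] ZM[OF that]
      by (intro integrable_weighted_mult square_integrable_increment) auto
    then show ?thesis by (simp add: eq1)
  qed
  also have "\<dots> = (\<integral>p. (\<Sum>i\<in>J. \<Sum>j\<in>J. (G (fst p) * (\<xi> i (fst p) * \<xi> j (fst p))) *
       (indicat_real {a i<..b i} (snd p) * indicat_real {a j<..b j} (snd p))) \<partial>time_product M T)"
  proof -
    have "integrable (time_product M T) (\<lambda>p. (G (fst p) * (\<xi> i (fst p) * \<xi> j (fst p))) *
       (indicat_real {a i<..b i} (snd p) * indicat_real {a j<..b j} (snd p)))"
      if "i \<in> J" "j \<in> J" for i j
    proof (rule P.integrable_const_bound[where B="\<bar>C\<bar> * (K * K)"])
      show "AE p in time_product M T. norm (G (fst p) * (\<xi> i (fst p) * \<xi> j (fst p)) *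
         (indicat_real {a i<..b i} (snd p) * indicat_real {a j<..b j} (snd p))) \<le> \<bar>C\<bar> * (K * K)"
        using ZC[OF that] K(1) by (intro AE_I2) (auto simp: space_time_product indicator_def)
      show "(\<lambda>p. G (fst p) * (\<xi> i (fst p) * \<xi> j (fst p)) *
         (indicat_real {a i<..b i} (snd p) * indicat_real {a j<..b j} (snd p))) \<in> borel_measurable (time_product M T)"
        by (intro borel_measurable_times[OF measurable_fst_time_product[OF ZM[OF that]]]
            measurable_snd_time_product) measurable
    qed
    then show ?thesis by (simp add: eq2)
  qed
  also have "\<dots> = (\<integral>p. G (fst p) * (elementary_value J a b \<xi> p)\<^sup>2 \<partial>time_product M T)"
    by (intro Bochner_Integration.integral_cong refl)
       (simp only: elementary_value_def power2_eq_square sum_product sum_distrib_left mult_ac)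
  finally show ?thesis .
qed

lemma elementary_mean_zero:
  assumes e: "elementary J a b \<xi>" and s: "0 \<le> s" "\<And>j. j \<in> J \<Longrightarrow> s \<le> a j"
    and G: "G \<in> borel_measurable (F s)" and C: "\<And>\<omega>. \<omega> \<in> space M \<Longrightarrow> \<bar>G \<omega>\<bar> \<le> C"
  shows "(\<integral>\<omega>. G \<omega> * elementary_integral J a b \<xi> \<omega> \<partial>M) = 0"
proof -
  obtain K where K: "K \<ge> 0" "\<And>j \<omega>. j \<in> J \<Longrightarrow> \<omega> \<in> space M \<Longrightarrow> \<bar>\<xi> j \<omega>\<bar> \<le> K"
    using elementary_bound[OF e] by blast
  have j: "0 \<le> a j" "a j \<le> b j" "\<xi> j \<in> borel_measurable M" "a j < b j \<Longrightarrow> \<xi> j \<in> borel_measurable (F (a j))"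
    if "j \<in> J" for j using e that by (auto simp: elementary_def)
  have GM: "G \<in> borel_measurable M" using measurable_M[OF s(1) G] .
  have ZC: "\<bar>G \<omega> * \<xi> j \<omega>\<bar> \<le> \<bar>C\<bar> * K" if "j \<in> J" "\<omega> \<in> space M" for j \<omega>
    using C[OF that(2)] K that by (auto simp: abs_mult intro!: mult_mono)
  have Zs: "square_integrable M (\<lambda>\<omega>. G \<omega> * \<xi> j \<omega>)" if "j \<in> J" for j
    using ZC that GM j by (intro square_integrable_bounded[where C="\<bar>C\<bar> * K"]) auto
  have Zi: "integrable M (\<lambda>\<omega>. G \<omega> * \<xi> j \<omega>)" if "j \<in> J" for j
    using ZC that GM j by (intro integrable_const_bound[where B="\<bar>C\<bar> * K"] AE_I2) auto
  have z: "(\<integral>\<omega>. (G \<omega> * \<xi> j \<omega>) * (W (b j) \<omega> - W (a j) \<omega>) \<partial>M) = 0" if "j \<in> J" for j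
  proof (cases "a j = b j")
    case False
    then have "\<xi> j \<in> borel_measurable (F (a j))" "G \<in> borel_measurable (F (a j))"
      using j[OF that] G s(2)[OF that] by (auto intro: measurable_F_mono[rotated])
    then show ?thesis
      using Zi[OF that] j[OF that] by (intro expectation_mult_increment) auto
  qed simp
  have "(\<integral>\<omega>. G \<omega> * elementary_integral J a b \<xi> \<omega> \<partial>M)
    = (\<integral>\<omega>. (\<Sum>j\<in>J. (G \<omega> * \<xi> j \<omega>) * (W (b j) \<omega> - W (a j) \<omega>)) \<partial>M)"
    by (simp add: elementary_integral_def sum_distrib_left mult_ac)
  also have "\<dots> = 0"
    using integrable_mult_of_square_integrable[OF Zs square_integrable_increment] j
    by (subst Bochner_Integration.integral_sum) (auto simp: z)
  finally show ?thesis .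
qed

end

section \<open>The Ito isometry\<close>

context brownian_motion
begin

lemma simple_process_time_nonneg:
  assumes "simple_process n \<tau> \<xi>" "i \<le> n"
  shows "0 \<le> \<tau> i"
  using assms(2)
proof (induction i)
  case (Suc i)
  then have "\<tau> i \<le> \<tau> (Suc i)" using assms(1) by (auto simp: simple_process_def)
  with Suc show ?case by simp
qed (use assms(1) in \<open>simp add: simple_process_def\<close>)

text \<open>Clamping the partition points to \<open>{s..t}\<close> turns the increment of the simple
  integral between \<open>s\<close> and \<open>t\<close> into an elementary integral whose intervals
  all begin at or after \<open>s\<close>, as weights measurable at time \<open>s\<close>
  require.\<close>

lemma simple_process_elementary:
  assumes p: "simple_process n \<tau> \<xi>" and st: "0 \<le> s" "s \<le> t"
  shows "elementary {..<n} (\<lambda>i. max s (min t (\<tau> i))) (\<lambda>i. max s (min t (\<tau> (Suc i)))) \<xi>"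
proof -
  have q: "0 \<le> \<tau> i" "\<tau> i \<le> \<tau> (Suc i)" "\<xi> i \<in> borel_measurable (F (\<tau> i))" "bounded (\<xi> i ` space M)"
    if "i < n" for i
    using p that simple_process_time_nonneg[OF p, of i] by (auto simp: simple_process_def)
  show ?thesis
    unfolding elementary_def
  proof (intro conjI ballI impI)
    fix i assume "i \<in> {..<n}"
    then have i: "i < n" by simp
    show "\<xi> i \<in> borel_measurable M" "bounded (\<xi> i ` space M)"
      using measurable_M[OF q(1,3)[OF i]] q(4)[OF i] .
    show "0 \<le> max s (min t (\<tau> i))" "max s (min t (\<tau> i)) \<le> max s (min t (\<tau> (Suc i)))"
      using st q(2)[OF i] by auto
    assume less: "max s (min t (\<tau> i)) < max s (min t (\<tau> (Suc i)))"
    show "\<xi> i \<in> borel_measurable (F (max s (min t (\<tau> i))))"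
    proof (rule measurable_F_mono[OF _ q(3)[OF i]])
      \<comment> \<open>A nonempty clamped interval forces \<open>\<tau> i < t\<close>, so clamping
        can only have moved the left end point to the right.\<close>
      show "\<tau> i \<le> max s (min t (\<tau> i))" using less st by (auto simp: max_def min_def split: if_splits)
    qed
  qed simp
qed

lemma simple_integral_increment:
  assumes p: "simple_process n \<tau> \<xi>" and st: "0 \<le> s" "s \<le> t"
  shows "simple_integral W n \<tau> \<xi> t \<omega> - simple_integral W n \<tau> \<xi> s \<omega>
    = elementary_integral {..<n} (\<lambda>i. max s (min t (\<tau> i))) (\<lambda>i. max s (min t (\<tau> (Suc i)))) \<xi> \<omega>"
proof -
  \<comment> \<open>For a single point,
    \<open>W (min t x) - W (min s x) = W (max s (min t x)) - W s\<close>; subtracting the instances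
    for \<open>y\<close> and \<open>x\<close> gives the claim.\<close>
  have "W (min t y) \<omega> - W (min t x) \<omega> - (W (min s y) \<omega> - W (min s x) \<omega>)
    = W (max s (min t y)) \<omega> - W (max s (min t x)) \<omega>" for x y
    using st by (auto simp: min_def max_def)
  then show ?thesis
    by (simp add: simple_integral_def elementary_integral_def sum_subtractf[symmetric] right_diff_distrib[symmetric])
qed

lemma simple_integral_0: "simple_process n \<tau> \<xi> \<Longrightarrow> simple_integral W n \<tau> \<xi> 0 \<omega> = 0"
  using simple_process_time_nonneg[of n \<tau> \<xi>] by (simp add: simple_integral_def)

lemma simple_value_elementary:
  assumes p: "simple_process n \<tau> \<xi>" and st: "0 \<le> s" "s \<le> t"
  shows "elementary_value {..<n} (\<lambda>i. max s (min t (\<tau> i))) (\<lambda>i. max s (min t (\<tau> (Suc i)))) \<xi> p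
    = indicat_real {s<..t} (snd p) * simple_value n \<tau> \<xi> (snd p) (fst p)"
proof -
  have "indicat_real {max s (min t x)<..max s (min t y)} u = indicat_real {s<..t} u * indicat_real {x<..y} u"
    for x y u using st by (auto simp: indicator_def)
  then show ?thesis
    unfolding elementary_value_def simple_value_def sum_distrib_left
    by (intro sum.cong refl) (simp only: mult_ac)
qed

lemma square_integrable_simple_increment:
  assumes p: "simple_process n \<tau> \<xi>" and st: "0 \<le> s" "s \<le> t"
  shows "square_integrable M (\<lambda>\<omega>. simple_integral W n \<tau> \<xi> t \<omega> - simple_integral W n \<tau> \<xi> s \<omega>)"
  using square_integrable_elementary_integral[OF simple_process_elementary[OF p st]]
  by (simp add: simple_integral_increment[OF p st])

lemma square_integrable_simple_integral:
  assumes p: "simple_process n \<tau> \<xi>" and t: "0 \<le> t"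
  shows "square_integrable M (simple_integral W n \<tau> \<xi> t)"
  using square_integrable_simple_increment[OF p order.refl t] by (simp add: simple_integral_0[OF p])

lemma square_integrable_simple_value:
  assumes p: "simple_process n \<tau> \<xi>" and st: "0 \<le> s" "s \<le> t"
  shows "square_integrable (time_product M T) (\<lambda>p. indicat_real {s<..t} (snd p) * simple_value n \<tau> \<xi> (snd p) (fst p))"
  using square_integrable_elementary_value[OF simple_process_elementary[OF p st], of T]
  by (simp add: simple_value_elementary[OF p st, abs_def])

lemma simple_difference_isometry:
  assumes p: "simple_process n \<tau> \<xi>" and p': "simple_process n' \<tau>' \<xi>'" and st: "0 \<le> s" "s \<le> t" "t \<le> T"
    and G: "G \<in> borel_measurable (F s)" and C: "\<And>\<omega>. \<omega> \<in> space M \<Longrightarrow> \<bar>G \<omega>\<bar> \<le> C"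
  shows "(\<integral>\<omega>. G \<omega> * ((simple_integral W n \<tau> \<xi> t \<omega> - simple_integral W n \<tau> \<xi> s \<omega>)
        - (simple_integral W n' \<tau>' \<xi>' t \<omega> - simple_integral W n' \<tau>' \<xi>' s \<omega>))\<^sup>2 \<partial>M)
    = (\<integral>p. G (fst p) * (indicat_real {s<..t} (snd p) * simple_value n \<tau> \<xi> (snd p) (fst p)
         - indicat_real {s<..t} (snd p) * simple_value n' \<tau>' \<xi>' (snd p) (fst p))\<^sup>2 \<partial>time_product M T)"
proof -
  \<comment> \<open>The disjoint sum of the index sets, with negated coefficients on the right
    summand, presents the difference as one elementary process.\<close>
  define J where "J = {..<n} <+> {..<n'}"
  define a where "a = case_sum (\<lambda>i. max s (min t (\<tau> i))) (\<lambda>i. max s (min t (\<tau>' i)))"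
  define b where "b = case_sum (\<lambda>i. max s (min t (\<tau> (Suc i)))) (\<lambda>i. max s (min t (\<tau>' (Suc i))))"
  define \<zeta> where "\<zeta> = case_sum \<xi> (\<lambda>i \<omega>. - \<xi>' i \<omega>)"
  have e: "elementary J a b \<zeta>"
    using simple_process_elementary[OF p st(1,2)] simple_process_elementary[OF p' st(1,2)]
    unfolding elementary_def J_def a_def b_def \<zeta>_def
    by (auto simp: bounded_iff image_iff split: sum.split)
  have I: "elementary_integral J a b \<zeta> \<omega> = (simple_integral W n \<tau> \<xi> t \<omega> - simple_integral W n \<tau> \<xi> s \<omega>)
        - (simple_integral W n' \<tau>' \<xi>' t \<omega> - simple_integral W n' \<tau>' \<xi>' s \<omega>)" for \<omega>
    unfolding simple_integral_increment[OF p st(1,2)] simple_integral_increment[OF p' st(1,2)]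
    by (simp add: elementary_integral_def J_def a_def b_def \<zeta>_def sum.Plus sum_negf)
  have V: "elementary_value J a b \<zeta> p = indicat_real {s<..t} (snd p) * simple_value n \<tau> \<xi> (snd p) (fst p)
         - indicat_real {s<..t} (snd p) * simple_value n' \<tau>' \<xi>' (snd p) (fst p)" for p
    unfolding simple_value_elementary[OF p st(1,2), symmetric] simple_value_elementary[OF p' st(1,2), symmetric]
    unfolding elementary_value_def J_def
    by (subst sum.Plus) (simp_all only: finite_lessThan comp_def a_def b_def \<zeta>_def sum.case mult_minus_left sum_negf
        add_uminus_conv_diff)
  have ab: "s \<le> a j" "b j \<le> T" if "j \<in> J" for j
    using st by (auto simp: a_def b_def split: sum.split)
  show ?thesis
    using elementary_isometry[OF e st(1) ab G C] by (simp only: I V)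
qed

lemma simple_increment_mean_zero:
  assumes p: "simple_process n \<tau> \<xi>" and st: "0 \<le> s" "s \<le> t"
    and G: "G \<in> borel_measurable (F s)" and C: "\<And>\<omega>. \<omega> \<in> space M \<Longrightarrow> \<bar>G \<omega>\<bar> \<le> C"
  shows "(\<integral>\<omega>. G \<omega> * (simple_integral W n \<tau> \<xi> t \<omega> - simple_integral W n \<tau> \<xi> s \<omega>) \<partial>M) = 0"
  unfolding simple_integral_increment[OF p st]
  by (rule elementary_mean_zero[OF simple_process_elementary[OF p st] st(1) _ G C]) auto

text \<open>Progressive measurability is used at the horizon \<open>T\<close> itself:
  \<open>F T\<close> is contained in \<open>M\<close>, and only the order of the coordinates has to
  be exchanged.\<close>

lemma progressively_measurable_time_product:
  assumes H: "progressively_measurable H" and T: "0 \<le> T"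
  shows "(\<lambda>p. H (snd p) (fst p)) \<in> borel_measurable (time_product M T)"
proof -
  have [measurable]: "(\<lambda>(s, \<omega>). H s \<omega>) \<in> borel_measurable (restrict_space borel {0..T} \<Otimes>\<^sub>M F T)"
    using H T by (auto simp: progressively_measurable_def)
  have [measurable]: "(\<lambda>x. x) \<in> M \<rightarrow>\<^sub>M F T"
    by (rule measurable_from_subalg[OF subalgebra_F[OF T]]) simp
  have [measurable]: "(\<lambda>x. x) \<in> restrict_space lborel {0..T} \<rightarrow>\<^sub>M restrict_space borel {0..T}"
    by (rule measurable_ident_sets) (simp add: sets_restrict_space)
  have "(\<lambda>p. (snd p, fst p)) \<in> time_product M T \<rightarrow>\<^sub>M restrict_space borel {0..T} \<Otimes>\<^sub>M F T"
    unfolding time_product_def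
    by (intro measurable_Pair measurable_compose[OF measurable_fst] measurable_compose[OF measurable_snd])
       measurable
  from measurable_compose[OF this, of "\<lambda>(s, \<omega>). H s \<omega>"] show ?thesis by simp
qed

text \<open>The interval \<open>{0<..s}\<close> is open on the left like those of simple processes,
  which makes the restricted simple process elementary. The horizon \<open>T\<close> is kept apart
  from \<open>s\<close> so that approximations for different \<open>s\<close> live on the same
  product space.\<close>

definition approximates_ito_at where
  "approximates_ito_at H T s X n \<tau> \<xi> \<longleftrightarrow> (\<forall>k. simple_process (n k) (\<tau> k) (\<xi> k)) \<and>
    L2_tendsto M (\<lambda>k. simple_integral W (n k) (\<tau> k) (\<xi> k) s) X \<and>
    L2_tendsto (time_product M T)
      (\<lambda>k p. indicat_real {0<..s} (snd p) * simple_value (n k) (\<tau> k) (\<xi> k) (snd p) (fst p))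
      (\<lambda>p. indicat_real {0<..s} (snd p) * H (snd p) (fst p))"

lemma approximates_ito_atD:
  assumes "approximates_ito_at H T s X n \<tau> \<xi>"
  shows "simple_process (n k) (\<tau> k) (\<xi> k)"
    "L2_tendsto M (\<lambda>k. simple_integral W (n k) (\<tau> k) (\<xi> k) s) X"
    "L2_tendsto (time_product M T)
      (\<lambda>k p. indicat_real {0<..s} (snd p) * simple_value (n k) (\<tau> k) (\<xi> k) (snd p) (fst p))
      (\<lambda>p. indicat_real {0<..s} (snd p) * H (snd p) (fst p))"
  using assms by (simp_all add: approximates_ito_at_def)

lemma ito_approximation:
  assumes I: "ito_integral_at W H s X" and s: "0 \<le> s" "s \<le> T"
  shows "\<exists>n \<tau> \<xi>. approximates_ito_at H T s X n \<tau> \<xi>"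
proof -
  interpret R: sigma_finite_measure "restrict_space lborel {0..T}"
    by (rule finite_measure.axioms(1)[OF finite_measure_time])
  from I obtain n \<tau> \<xi> where p: "\<And>k. simple_process (n k) (\<tau> k) (\<xi> k)"
    and limH: "(\<lambda>k. \<integral>\<^sup>+\<omega>. (\<integral>\<^sup>+u\<in>{0..s}.
            ennreal ((H u \<omega> - simple_value (n k) (\<tau> k) (\<xi> k) u \<omega>)\<^sup>2) \<partial>lborel) \<partial>M) \<longlonglongrightarrow> 0"
    and limX: "(\<lambda>k. \<integral>\<^sup>+\<omega>. ennreal ((X \<omega> - simple_integral W (n k) (\<tau> k) (\<xi> k) s \<omega>)\<^sup>2) \<partial>M) \<longlonglongrightarrow> 0"
    and X: "X \<in> borel_measurable M" and prog: "progressively_measurable H"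
    by (auto simp: ito_integral_at_def)
  have H: "(\<lambda>p. indicat_real {0<..s} (snd p) * H (snd p) (fst p)) \<in> borel_measurable (time_product M T)"
    using progressively_measurable_time_product[OF prog, of T] s
    by (intro borel_measurable_times measurable_snd_time_product) auto
  define V where "V k p = indicat_real {0<..s} (snd p) * simple_value (n k) (\<tau> k) (\<xi> k) (snd p) (fst p)" for k p
  have V: "square_integrable (time_product M T) (V k)" for k
    unfolding V_def[abs_def] using square_integrable_simple_value[OF p order.refl s(1)] .
  \<comment> \<open>An inequality is enough: on \<open>{0<..s}\<close> the integrands coincide, and
    elsewhere the left one is 0.\<close>
  have le: "(\<integral>\<^sup>+p. ennreal ((indicat_real {0<..s} (snd p) * H (snd p) (fst p) - V k p)\<^sup>2) \<partial>time_product M T)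
     \<le> (\<integral>\<^sup>+\<omega>. (\<integral>\<^sup>+u\<in>{0..s}.
            ennreal ((H u \<omega> - simple_value (n k) (\<tau> k) (\<xi> k) u \<omega>)\<^sup>2) \<partial>lborel) \<partial>M)" for k
  proof -
    have "(\<lambda>p. ennreal ((indicat_real {0<..s} (snd p) * H (snd p) (fst p) - V k p)\<^sup>2))
      \<in> borel_measurable (time_product M T)"
      using H square_integrable_measurable[OF V[of k]] by measurable
    then have "(\<integral>\<^sup>+p. ennreal ((indicat_real {0<..s} (snd p) * H (snd p) (fst p) - V k p)\<^sup>2) \<partial>time_product M T)
      = (\<integral>\<^sup>+\<omega>. (\<integral>\<^sup>+u. ennreal ((indicat_real {0<..s} u * H u \<omega> - V k (\<omega>, u))\<^sup>2) \<partial>restrict_space lborel {0..T}) \<partial>M)"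
      unfolding time_product_def by (subst R.nn_integral_fst[symmetric]) auto
    also have "\<dots> \<le> (\<integral>\<^sup>+\<omega>. (\<integral>\<^sup>+u\<in>{0..s}.
            ennreal ((H u \<omega> - simple_value (n k) (\<tau> k) (\<xi> k) u \<omega>)\<^sup>2) \<partial>lborel) \<partial>M)"
      by (intro nn_integral_mono, subst nn_integral_restrict_space, simp)
         (auto intro!: nn_integral_mono simp: V_def indicator_def)
    finally show ?thesis .
  qed
  have "(\<lambda>k. \<integral>\<^sup>+p. ennreal ((indicat_real {0<..s} (snd p) * H (snd p) (fst p) - V k p)\<^sup>2) \<partial>time_product M T) \<longlonglongrightarrow> 0"
    by (rule tendsto_sandwich[OF _ _ tendsto_const limH]) (use le in auto)
  from L2_tendstoI_nn_integral[OF V H this]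
  have "L2_tendsto (time_product M T) V (\<lambda>p. indicat_real {0<..s} (snd p) * H (snd p) (fst p))" .
  moreover have "L2_tendsto M (\<lambda>k. simple_integral W (n k) (\<tau> k) (\<xi> k) s) X"
    by (rule L2_tendstoI_nn_integral[OF square_integrable_simple_integral[OF p s(1)] X limX])
  ultimately have "approximates_ito_at H T s X n \<tau> \<xi>"
    using p unfolding approximates_ito_at_def V_def[abs_def] by simp
  then show ?thesis by blast
qed

text \<open>The definition of the integral allows a different approximating sequence at each time; the
  isometry makes a sequence chosen for the final time work at all earlier times.\<close>

lemma ito_approximation_consistent:
  assumes I: "ito_integral_at W H s X" and s: "0 \<le> s" "s \<le> T"
    and p: "\<And>k. simple_process (n k) (\<tau> k) (\<xi> k)"
    and V: "L2_tendsto (time_product M T)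
      (\<lambda>k p. indicat_real {0<..T} (snd p) * simple_value (n k) (\<tau> k) (\<xi> k) (snd p) (fst p))
      (\<lambda>p. indicat_real {0<..T} (snd p) * H (snd p) (fst p))"
  shows "L2_tendsto M (\<lambda>k. simple_integral W (n k) (\<tau> k) (\<xi> k) s) X"
proof -
  obtain n' \<tau>' \<xi>' where "approximates_ito_at H T s X n' \<tau>' \<xi>'"
    using ito_approximation[OF I s] by blast
  note p' = approximates_ito_atD(1)[OF this] and J' = approximates_ito_atD(2)[OF this]
    and V' = approximates_ito_atD(3)[OF this]
  have ind: "indicat_real {0<..s} u * (indicat_real {0<..T} u * x) = indicat_real {0<..s} u * x" for u x
    using s by (auto simp: indicator_def)
  have "L2_tendsto (time_product M T)
      (\<lambda>k p. indicat_real {0<..s} (snd p) * (indicat_real {0<..T} (snd p) * simple_value (n k) (\<tau> k) (\<xi> k) (snd p) (fst p)))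
      (\<lambda>p. indicat_real {0<..s} (snd p) * (indicat_real {0<..T} (snd p) * H (snd p) (fst p)))"
    by (rule L2_tendsto_mult_bounded[OF V, where C=1]) (auto intro: measurable_snd_time_product)
  from L2_tendsto_diff[OF this[unfolded ind] V']
  have "(\<lambda>k. \<integral>p. (indicat_real {0<..s} (snd p) * simple_value (n k) (\<tau> k) (\<xi> k) (snd p) (fst p)
     - indicat_real {0<..s} (snd p) * simple_value (n' k) (\<tau>' k) (\<xi>' k) (snd p) (fst p))\<^sup>2 \<partial>time_product M T) \<longlonglongrightarrow> 0"
    by (simp add: L2_tendsto_def)
  \<comment> \<open>Simple integrals vanish at time 0, so the isometry on \<open>{0<..s}\<close>
    with weight 1 turns closeness of the integrands into closeness of the integrals.\<close>
  then have "(\<lambda>k. \<integral>\<omega>. (simple_integral W (n k) (\<tau> k) (\<xi> k) s \<omega> - simple_integral W (n' k) (\<tau>' k) (\<xi>' k) s \<omega>)\<^sup>2 \<partial>M) \<longlonglongrightarrow> 0"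
    using simple_difference_isometry[OF p p' order.refl s, of "\<lambda>_. 1" 1]
    by (simp add: simple_integral_0[OF p] simple_integral_0[OF p'])
  then have "L2_tendsto M (\<lambda>k \<omega>. simple_integral W (n k) (\<tau> k) (\<xi> k) s \<omega> - simple_integral W (n' k) (\<tau>' k) (\<xi>' k) s \<omega>) (\<lambda>_. 0)"
    using square_integrable_diff[OF square_integrable_simple_integral[OF p s(1)] square_integrable_simple_integral[OF p' s(1)]]
    by (simp add: L2_tendsto_def square_integrable_def)
  from L2_tendsto_add[OF this J'] show ?thesis by simp
qed

definition approximates_ito where
  "approximates_ito H I T n \<tau> \<xi> \<longleftrightarrow> (\<forall>k. simple_process (n k) (\<tau> k) (\<xi> k)) \<and>
    (\<forall>s. 0 \<le> s \<longrightarrow> s \<le> T \<longrightarrow> L2_tendsto M (\<lambda>k. simple_integral W (n k) (\<tau> k) (\<xi> k) s) (I s)) \<and>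
    L2_tendsto (time_product M T)
      (\<lambda>k p. indicat_real {0<..T} (snd p) * simple_value (n k) (\<tau> k) (\<xi> k) (snd p) (fst p))
      (\<lambda>p. indicat_real {0<..T} (snd p) * H (snd p) (fst p))"

lemma approximates_itoD:
  assumes "approximates_ito H I T n \<tau> \<xi>"
  shows "simple_process (n k) (\<tau> k) (\<xi> k)"
    "0 \<le> s \<Longrightarrow> s \<le> T \<Longrightarrow> L2_tendsto M (\<lambda>k. simple_integral W (n k) (\<tau> k) (\<xi> k) s) (I s)"
    "L2_tendsto (time_product M T)
      (\<lambda>k p. indicat_real {0<..T} (snd p) * simple_value (n k) (\<tau> k) (\<xi> k) (snd p) (fst p))
      (\<lambda>p. indicat_real {0<..T} (snd p) * H (snd p) (fst p))"
  using assms by (simp_all add: approximates_ito_def)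

lemma ito_increment_approximation:
  assumes I: "ito_integral W H I" and T: "0 \<le> T"
  shows "\<exists>n \<tau> \<xi>. approximates_ito H I T n \<tau> \<xi>"
proof -
  have at: "ito_integral_at W H s (I s)" if "0 \<le> s" for s using I that by (auto simp: ito_integral_def)
  obtain n \<tau> \<xi> where "approximates_ito_at H T T (I T) n \<tau> \<xi>"
    using ito_approximation[OF at[OF T] T order.refl] by blast
  note p = approximates_ito_atD(1)[OF this] and V = approximates_ito_atD(3)[OF this]
  have "approximates_ito H I T n \<tau> \<xi>"
    using p ito_approximation_consistent[OF at _ _ p V] V by (simp add: approximates_ito_def)
  then show ?thesis by blast
qed

lemma ito_increment_mean_zero:
  assumes I: "ito_integral W H I" and st: "0 \<le> s" "s \<le> t"
    and G: "G \<in> borel_measurable (F s)" and C: "\<And>\<omega>. \<omega> \<in> space M \<Longrightarrow> \<bar>G \<omega>\<bar> \<le> C"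
  shows "(\<integral>\<omega>. G \<omega> * (I t \<omega> - I s \<omega>) \<partial>M) = 0"
proof -
  obtain n \<tau> \<xi> where "approximates_ito H I t n \<tau> \<xi>"
    using ito_increment_approximation[OF I, of t] st by auto
  note p = approximates_itoD(1)[OF this] and J = approximates_itoD(2)[OF this]
  \<comment> \<open>Pairing with the constant 1 turns the continuity of weighted products into that
    of weighted means.\<close>
  have one: "L2_tendsto M (\<lambda>_ _. 1) (\<lambda>_. 1)"
    by (intro L2_tendsto_const square_integrable_bounded[where C=1]) auto
  have "(\<lambda>k. \<integral>\<omega>. G \<omega> * ((simple_integral W (n k) (\<tau> k) (\<xi> k) t \<omega> - simple_integral W (n k) (\<tau> k) (\<xi> k) s \<omega>) * 1) \<partial>M)
    \<longlonglongrightarrow> (\<integral>\<omega>. G \<omega> * ((I t \<omega> - I s \<omega>) * 1) \<partial>M)"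
    using st by (intro L2_tendsto_integral_mult[OF L2_tendsto_diff[OF J J] one measurable_M[OF st(1) G] C]) auto
  moreover have "(\<integral>\<omega>. G \<omega> * ((simple_integral W (n k) (\<tau> k) (\<xi> k) t \<omega> - simple_integral W (n k) (\<tau> k) (\<xi> k) s \<omega>) * 1) \<partial>M) = 0" for k
    using simple_increment_mean_zero[OF p st G C] by simp
  ultimately show ?thesis by (simp add: LIMSEQ_const_iff)
qed

lemma square_integrable_ito_integral:
  assumes I: "ito_integral W H I" and t: "0 \<le> t"
  shows "square_integrable M (I t)"
proof -
  obtain n \<tau> \<xi> where "approximates_ito H I t n \<tau> \<xi>"
    using ito_increment_approximation[OF I t] by blast
  from approximates_itoD(2)[OF this t] show ?thesis by (simp add: L2_tendsto_def)
qed

text \<open>Subtracting a simple process costs nothing in the proof and serves two purposes: the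
  empty process gives the isometry itself, and a process close to \<open>H\<close> gives the small
  remainder in the Lindeberg estimate.\<close>

lemma ito_isometry_diff_simple:
  assumes I: "ito_integral W H I" and V: "simple_process n' \<tau>' \<xi>'" and st: "0 \<le> s" "s \<le> t" "t \<le> T"
    and G: "G \<in> borel_measurable (F s)" and C: "\<And>\<omega>. \<omega> \<in> space M \<Longrightarrow> \<bar>G \<omega>\<bar> \<le> C"
  defines "Y \<equiv> \<lambda>\<omega>. (I t \<omega> - I s \<omega>)
        - (simple_integral W n' \<tau>' \<xi>' t \<omega> - simple_integral W n' \<tau>' \<xi>' s \<omega>)"
    and "K \<equiv> \<lambda>p. indicat_real {s<..t} (snd p) * (H (snd p) (fst p) - simple_value n' \<tau>' \<xi>' (snd p) (fst p))"
  shows "(\<integral>\<omega>. G \<omega> * (Y \<omega>)\<^sup>2 \<partial>M) = (\<integral>p. G (fst p) * (K p)\<^sup>2 \<partial>time_product M T)"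
    and "square_integrable M Y" "square_integrable (time_product M T) K"
proof -
  have T: "0 \<le> T" using st by simp
  obtain n \<tau> \<xi> where "approximates_ito H I T n \<tau> \<xi>"
    using ito_increment_approximation[OF I T] by blast
  note p = approximates_itoD(1)[OF this] and J = approximates_itoD(2)[OF this]
    and L = approximates_itoD(3)[OF this]
  define S where "S = (\<lambda>\<omega>. simple_integral W n' \<tau>' \<xi>' t \<omega> - simple_integral W n' \<tau>' \<xi>' s \<omega>)"
  define U where "U = (\<lambda>p. indicat_real {s<..t} (snd p) * simple_value n' \<tau>' \<xi>' (snd p) (fst p))"
  have Y: "L2_tendsto M (\<lambda>k \<omega>. (simple_integral W (n k) (\<tau> k) (\<xi> k) t \<omega> - simple_integral W (n k) (\<tau> k) (\<xi> k) s \<omega>) - S \<omega>) Y"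
    unfolding Y_def S_def
    using st by (intro L2_tendsto_diff[OF L2_tendsto_diff[OF J J]
        L2_tendsto_const[OF square_integrable_simple_increment[OF V st(1,2)]]]) auto
  have ind: "indicat_real {s<..t} u * (indicat_real {0<..T} u * x) = indicat_real {s<..t} u * x" for u x
    using st by (auto simp: indicator_def)
  have "L2_tendsto (time_product M T)
      (\<lambda>k p. indicat_real {s<..t} (snd p) * (indicat_real {0<..T} (snd p) * simple_value (n k) (\<tau> k) (\<xi> k) (snd p) (fst p)))
      (\<lambda>p. indicat_real {s<..t} (snd p) * (indicat_real {0<..T} (snd p) * H (snd p) (fst p)))"
    by (rule L2_tendsto_mult_bounded[OF L, where C=1]) (auto intro: measurable_snd_time_product)
  then have "L2_tendsto (time_product M T)
      (\<lambda>k p. indicat_real {s<..t} (snd p) * simple_value (n k) (\<tau> k) (\<xi> k) (snd p) (fst p) - U p)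
      (\<lambda>p. indicat_real {s<..t} (snd p) * H (snd p) (fst p) - U p)"
    unfolding ind
    unfolding U_def
    by (rule L2_tendsto_diff[OF _ L2_tendsto_const[OF square_integrable_simple_value[OF V st(1,2)]]])
  then have K: "L2_tendsto (time_product M T)
      (\<lambda>k p. indicat_real {s<..t} (snd p) * simple_value (n k) (\<tau> k) (\<xi> k) (snd p) (fst p) - U p) K"
    by (simp add: K_def U_def right_diff_distrib)
  show "square_integrable M Y" "square_integrable (time_product M T) K"
    using Y K by (auto simp: L2_tendsto_def)
  have GT: "(\<lambda>p. G (fst p)) \<in> borel_measurable (time_product M T)"
    by (rule measurable_fst_time_product[OF measurable_M[OF st(1) G]])
  have CT: "\<bar>G (fst p)\<bar> \<le> C" if "p \<in> space (time_product M T)" for p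
    using that C by (auto simp: space_time_product)
  note lim1 = L2_tendsto_integral_mult[OF Y Y measurable_M[OF st(1) G] C, unfolded power2_eq_square[symmetric]]
  note lim2 = L2_tendsto_integral_mult[OF K K GT CT, unfolded power2_eq_square[symmetric]]
  have "(\<integral>\<omega>. G \<omega> * ((simple_integral W (n k) (\<tau> k) (\<xi> k) t \<omega> - simple_integral W (n k) (\<tau> k) (\<xi> k) s \<omega>) - S \<omega>)\<^sup>2 \<partial>M)
    = (\<integral>p. G (fst p) * (indicat_real {s<..t} (snd p) * simple_value (n k) (\<tau> k) (\<xi> k) (snd p) (fst p) - U p)\<^sup>2 \<partial>time_product M T)" for k
    unfolding S_def U_def by (rule simple_difference_isometry[OF p V st G C])
  then show "(\<integral>\<omega>. G \<omega> * (Y \<omega>)\<^sup>2 \<partial>M) = (\<integral>p. G (fst p) * (K p)\<^sup>2 \<partial>time_product M T)"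
    using LIMSEQ_unique[OF lim1] lim2 by simp
qed

lemma ito_isometry:
  assumes I: "ito_integral W H I" and st: "0 \<le> s" "s \<le> t" "t \<le> T"
    and G: "G \<in> borel_measurable (F s)" and C: "\<And>\<omega>. \<omega> \<in> space M \<Longrightarrow> \<bar>G \<omega>\<bar> \<le> C"
  shows "(\<integral>\<omega>. G \<omega> * (I t \<omega> - I s \<omega>)\<^sup>2 \<partial>M)
    = (\<integral>p. G (fst p) * (indicat_real {s<..t} (snd p) * (H (snd p) (fst p))\<^sup>2) \<partial>time_product M T)"
proof -
  \<comment> \<open>The empty simple process, so that nothing is subtracted.\<close>
  have "simple_process 0 (\<lambda>_. 0) (\<lambda>_ _. 0)" by (simp add: simple_process_def)
  moreover have "(indicat_real S x)\<^sup>2 = indicat_real S x" for S :: "real set" and x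
    by (cases "x \<in> S") auto
  ultimately show ?thesis
    using ito_isometry_diff_simple(1)[OF I _ st G C]
    by (force simp: simple_integral_def simple_value_def power_mult_distrib)
qed

end

section \<open>A Lindeberg condition for the increments\<close>

text \<open>Cauchy-Schwarz twice: for the \<open>f i\<close>, then for their squares.\<close>

lemma sum_power4_le:
  fixes f :: "'b \<Rightarrow> real"
  shows "(\<Sum>i\<in>I. f i) ^ 4 \<le> real (card I) ^ 3 * (\<Sum>i\<in>I. f i ^ 4)"
proof -
  let ?n = "real (card I)"
  have "(\<Sum>i\<in>I. f i) ^ 4 = ((\<Sum>i\<in>I. f i)\<^sup>2)\<^sup>2" by simp
  also have "\<dots> \<le> ((\<Sum>i\<in>I. (f i)\<^sup>2) * ?n)\<^sup>2"
    by (intro power_mono sum_squared_le_sum_of_squares) simp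
  also have "\<dots> = ?n\<^sup>2 * (\<Sum>i\<in>I. (f i)\<^sup>2)\<^sup>2" by (simp add: power_mult_distrib)
  also have "\<dots> \<le> ?n\<^sup>2 * ((\<Sum>i\<in>I. ((f i)\<^sup>2)\<^sup>2) * ?n)"
    by (intro mult_left_mono sum_squared_le_sum_of_squares) simp
  also have "\<dots> = ?n ^ 3 * (\<Sum>i\<in>I. f i ^ 4)" by (simp add: power3_eq_cube power2_eq_square power4_eq_xxxx mult.assoc)
  finally show ?thesis .
qed

text \<open>The larger of \<open>a\<close> and \<open>D\<close> dominates the sum. If it is
  \<open>D\<close>, the square is at most \<open>4 D^2\<close>. If it is \<open>a\<close>, then
  \<open>|a + D| > \<delta>\<close> forces \<open>|2 a| > \<delta>\<close>, and a square above this
  level is at most the fourth power divided by \<open>\<delta>^2\<close>. Only \<open>a\<close> thus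
  needs a fourth moment.\<close>

lemma square_truncated_le:
  fixes a D \<delta> :: real
  assumes "\<delta> > 0"
  shows "(a + D)\<^sup>2 * indicat_real {x. \<bar>x\<bar> > \<delta>} (a + D) \<le> 4 * D\<^sup>2 + 16 * a ^ 4 / \<delta>\<^sup>2"
proof (cases "\<bar>a + D\<bar> > \<delta>")
  case big: True
  show ?thesis
  proof (cases "\<bar>a\<bar> \<le> \<bar>D\<bar>")
    case True
    then have "\<bar>a + D\<bar> \<le> \<bar>2 * D\<bar>" by linarith
    then have "(a + D)\<^sup>2 \<le> (2 * D)\<^sup>2" by (simp only: abs_le_square_iff)
    also have "\<dots> \<le> 4 * D\<^sup>2 + 16 * a ^ 4 / \<delta>\<^sup>2" by (simp add: power_mult_distrib)
    finally show ?thesis using big by simp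
  next
    case False
    then have le: "\<bar>a + D\<bar> \<le> \<bar>2 * a\<bar>" by linarith
    then have "(a + D)\<^sup>2 \<le> (2 * a)\<^sup>2" by (simp only: abs_le_square_iff)
    moreover have "\<delta>\<^sup>2 \<le> (2 * a)\<^sup>2" using le big assms by (intro abs_le_square_iff[THEN iffD1]) auto
    ultimately have "(a + D)\<^sup>2 * \<delta>\<^sup>2 \<le> (2 * a)\<^sup>2 * (2 * a)\<^sup>2" by (intro mult_mono) auto
    also have "\<dots> = 16 * a ^ 4" by (simp add: power_mult_distrib)
    finally have "(a + D)\<^sup>2 \<le> 16 * a ^ 4 / \<delta>\<^sup>2" using assms by (simp add: pos_le_divide_eq)
    also have "\<dots> \<le> 4 * D\<^sup>2 + 16 * a ^ 4 / \<delta>\<^sup>2" by simp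
    finally show ?thesis using big by simp
  qed
qed simp

context brownian_motion
begin

text \<open>The crude dependence on the number of intervals is harmless: the simple process is fixed
  while the partition is refined, and what counts is the order \<open>h^2\<close>, which summed over
  order \<open>1 / h\<close> cells tends to 0.\<close>

lemma elementary_integral_power4:
  assumes e: "elementary J a b \<xi>" and K: "\<And>j \<omega>. j \<in> J \<Longrightarrow> \<omega> \<in> space M \<Longrightarrow> \<bar>\<xi> j \<omega>\<bar> \<le> K"
    and h: "\<And>j. j \<in> J \<Longrightarrow> b j - a j \<le> h"
  shows "integrable M (\<lambda>\<omega>. elementary_integral J a b \<xi> \<omega> ^ 4)"
    and "(\<integral>\<omega>. elementary_integral J a b \<xi> \<omega> ^ 4 \<partial>M) \<le> 3 * real (card J) ^ 4 * K ^ 4 * h\<^sup>2"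
proof -
  have j: "0 \<le> a j" "a j \<le> b j" if "j \<in> J" for j using e that by (auto simp: elementary_def)
  let ?B = "\<lambda>\<omega>. real (card J) ^ 3 * (\<Sum>j\<in>J. K ^ 4 * (W (b j) \<omega> - W (a j) \<omega>) ^ 4)"
  have Bi: "integrable M ?B" using integrable_increment_power j by auto
  have le: "elementary_integral J a b \<xi> \<omega> ^ 4 \<le> ?B \<omega>" if "\<omega> \<in> space M" for \<omega>
  proof -
    have "elementary_integral J a b \<xi> \<omega> ^ 4 \<le> real (card J) ^ 3 * (\<Sum>j\<in>J. (\<xi> j \<omega> * (W (b j) \<omega> - W (a j) \<omega>)) ^ 4)"
      unfolding elementary_integral_def by (rule sum_power4_le)
    also have "\<dots> \<le> ?B \<omega>"
    proof (intro mult_left_mono sum_mono)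
      fix j assume "j \<in> J"
      then have "\<bar>\<xi> j \<omega>\<bar> ^ 4 \<le> K ^ 4" using K[OF _ that] by (intro power_mono) auto
      then show "(\<xi> j \<omega> * (W (b j) \<omega> - W (a j) \<omega>)) ^ 4 \<le> K ^ 4 * (W (b j) \<omega> - W (a j) \<omega>) ^ 4"
        by (simp add: power_mult_distrib mult_right_mono)
    qed simp
    finally show ?thesis .
  qed
  show i: "integrable M (\<lambda>\<omega>. elementary_integral J a b \<xi> \<omega> ^ 4)"
  proof (rule Bochner_Integration.integrable_bound[OF Bi])
    show "(\<lambda>\<omega>. elementary_integral J a b \<xi> \<omega> ^ 4) \<in> borel_measurable M"
      using square_integrable_measurable[OF square_integrable_elementary_integral[OF e]] by measurable
    show "AE \<omega> in M. norm (elementary_integral J a b \<xi> \<omega> ^ 4) \<le> norm (?B \<omega>)"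
      using le by (intro AE_I2) (auto intro: order_trans[OF _ abs_ge_self])
  qed
  have "(\<integral>\<omega>. elementary_integral J a b \<xi> \<omega> ^ 4 \<partial>M) \<le> (\<integral>\<omega>. ?B \<omega> \<partial>M)"
    by (rule integral_mono[OF i Bi le])
  also have "\<dots> = real (card J) ^ 3 * (\<Sum>j\<in>J. K ^ 4 * (3 * (b j - a j)\<^sup>2))"
    using integrable_increment_power expectation_increment_power4 j by simp
  also have "\<dots> \<le> real (card J) ^ 3 * (\<Sum>j\<in>J. K ^ 4 * (3 * h\<^sup>2))"
  proof (intro mult_left_mono sum_mono power_mono)
    fix j assume "j \<in> J" then show "b j - a j \<le> h" "0 \<le> b j - a j" using h j by auto
  qed auto
  also have "\<dots> = 3 * real (card J) ^ 4 * K ^ 4 * h\<^sup>2" by (simp add: eval_nat_numeral)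
  finally show "(\<integral>\<omega>. elementary_integral J a b \<xi> \<omega> ^ 4 \<partial>M) \<le> 3 * real (card J) ^ 4 * K ^ 4 * h\<^sup>2" .
qed

text \<open>Each increment splits into that of a simple process close to the integrand in \<open>L\<^sup>2\<close>, which has
  fourth moments of order \<open>1 / N\<^sup>2\<close>, and a remainder whose second moments sum to little.\<close>

lemma ito_lindeberg:
  assumes I: "ito_integral W H I" and T: "0 < T" and \<delta>: "0 < \<delta>" and \<epsilon>: "0 < \<epsilon>"
  defines "\<Delta> \<equiv> \<lambda>N i \<omega>. I (T * real (Suc i) / real N) \<omega> - I (T * real i / real N) \<omega>"
  shows "\<forall>\<^sub>F N in sequentially. (\<Sum>i<N. \<integral>\<omega>. (\<Delta> N i \<omega>)\<^sup>2 * indicat_real {x. \<bar>x\<bar> > \<delta>} (\<Delta> N i \<omega>) \<partial>M) < \<epsilon>"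
proof -
  obtain n' \<tau>' \<xi>' where "approximates_ito H I T n' \<tau>' \<xi>'"
    using ito_increment_approximation[OF I, of T] T by auto
  note p' = approximates_itoD(1)[OF this] and L = approximates_itoD(3)[OF this]
  let ?R = "\<lambda>n \<tau> \<xi>. \<integral>p. (indicat_real {0<..T} (snd p) * (H (snd p) (fst p) - simple_value n \<tau> \<xi> (snd p) (fst p)))\<^sup>2 \<partial>time_product M T"
  have "(\<lambda>k. ?R (n' k) (\<tau>' k) (\<xi>' k)) \<longlonglongrightarrow> 0"
    using L by (simp add: L2_tendsto_def right_diff_distrib power2_commute)
  \<comment> \<open>The factor 4 of \<open>square_truncated_le\<close> turns
    \<open>\<epsilon> / 8\<close> into \<open>\<epsilon> / 2\<close>; the other half is left for the
    fourth moments.\<close>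
  then have "\<forall>\<^sub>F k in sequentially. ?R (n' k) (\<tau>' k) (\<xi>' k) < \<epsilon> / 8"
    by (rule order_tendstoD) (use \<epsilon> in simp)
  then obtain k where k: "?R (n' k) (\<tau>' k) (\<xi>' k) < \<epsilon> / 8" by (meson eventually_sequentially order_refl)
  define n \<tau> \<xi> where "n = n' k" "\<tau> = \<tau>' k" "\<xi> = \<xi>' k"
  have p: "simple_process n \<tau> \<xi>" and R: "?R n \<tau> \<xi> < \<epsilon> / 8" using p' k by (simp_all add: n_\<tau>_\<xi>_def)
  obtain K where K: "\<And>j \<omega>. j < n \<Longrightarrow> \<omega> \<in> space M \<Longrightarrow> \<bar>\<xi> j \<omega>\<bar> \<le> K"
    using elementary_bound[OF simple_process_elementary[OF p order.refl order.refl]] by (metis lessThan_iff)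
  \<comment> \<open>Each of the \<open>N\<close> cells has a fourth-moment term of order
    \<open>(T / N)^2\<close>; together they give \<open>Q / N\<close>.\<close>
  define Q where "Q = 16 * (3 * real n ^ 4 * K ^ 4 * T\<^sup>2) / \<delta>\<^sup>2"
  have bound: "(\<Sum>i<N. \<integral>\<omega>. (\<Delta> N i \<omega>)\<^sup>2 * indicat_real {x. \<bar>x\<bar> > \<delta>} (\<Delta> N i \<omega>) \<partial>M) \<le> \<epsilon> / 2 + Q * inverse (real N)"
    if N: "N > 0" for N
  proof -
    define s where "s i = T * real i / real N" for i
    have s: "0 \<le> s i" "s i \<le> s (Suc i)" "s (Suc i) - s i = T / real N" for i
      using T N by (auto simp: s_def field_simps)
    have sT: "s (Suc i) \<le> T" if "i < N" for i
      using that T N by (simp add: s_def pos_divide_le_eq)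
    define A where "A i \<omega> = simple_integral W n \<tau> \<xi> (s (Suc i)) \<omega> - simple_integral W n \<tau> \<xi> (s i) \<omega>" for i \<omega>
    define D where "D i \<omega> = \<Delta> N i \<omega> - A i \<omega>" for i \<omega>
    define E where "E p = H (snd p) (fst p) - simple_value n \<tau> \<xi> (snd p) (fst p)" for p
    have iso: "(\<integral>\<omega>. (D i \<omega>)\<^sup>2 \<partial>M) = (\<integral>p. (indicat_real {s i<..s (Suc i)} (snd p) * E p)\<^sup>2 \<partial>time_product M T)"
      and sqD: "square_integrable M (D i)"
      and sqE: "square_integrable (time_product M T) (\<lambda>p. indicat_real {s i<..s (Suc i)} (snd p) * E p)"
      if "i < N" for i
      using ito_isometry_diff_simple[OF I p s(1) s(2) sT[OF that], of "\<lambda>_. 1" 1]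
      unfolding D_def[abs_def] \<Delta>_def A_def E_def s_def by auto
    have A4: "integrable M (\<lambda>\<omega>. A i \<omega> ^ 4)"
      "(\<integral>\<omega>. A i \<omega> ^ 4 \<partial>M) \<le> 3 * real n ^ 4 * K ^ 4 * (T / real N)\<^sup>2" for i
    proof -
      have "max (s i) (min (s (Suc i)) y) - max (s i) (min (s (Suc i)) x) \<le> T / real N" for x y
        using s(2,3)[of i] by linarith
      from elementary_integral_power4[OF simple_process_elementary[OF p s(1)[of i] s(2)[of i]] _ this, of K] K
      show "integrable M (\<lambda>\<omega>. A i \<omega> ^ 4)"
        "(\<integral>\<omega>. A i \<omega> ^ 4 \<partial>M) \<le> 3 * real n ^ 4 * K ^ 4 * (T / real N)\<^sup>2"
        by (auto simp: A_def simple_integral_increment[OF p s(1)[of i] s(2)[of i]])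
    qed
    have cell: "(\<integral>\<omega>. (\<Delta> N i \<omega>)\<^sup>2 * indicat_real {x. \<bar>x\<bar> > \<delta>} (\<Delta> N i \<omega>) \<partial>M)
      \<le> 4 * (\<integral>\<omega>. (D i \<omega>)\<^sup>2 \<partial>M) + 16 * (3 * real n ^ 4 * K ^ 4 * (T / real N)\<^sup>2) / \<delta>\<^sup>2" if i: "i < N" for i
    proof -
      have "square_integrable M (\<Delta> N i)"
        unfolding \<Delta>_def using s[of i, unfolded s_def] s(1)[of "Suc i", unfolded s_def]
        by (intro square_integrable_diff square_integrable_ito_integral[OF I]) auto
      then have D2: "integrable M (\<lambda>\<omega>. (\<Delta> N i \<omega>)\<^sup>2)" and [measurable]: "\<Delta> N i \<in> borel_measurable M"
        by (auto simp: square_integrable_def)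
      have "(\<integral>\<omega>. (\<Delta> N i \<omega>)\<^sup>2 * indicat_real {x. \<bar>x\<bar> > \<delta>} (\<Delta> N i \<omega>) \<partial>M)
        \<le> (\<integral>\<omega>. 4 * (D i \<omega>)\<^sup>2 + 16 * A i \<omega> ^ 4 / \<delta>\<^sup>2 \<partial>M)"
      proof (rule integral_mono)
        show "integrable M (\<lambda>\<omega>. (\<Delta> N i \<omega>)\<^sup>2 * indicat_real {x. \<bar>x\<bar> > \<delta>} (\<Delta> N i \<omega>))"
          by (rule Bochner_Integration.integrable_bound[OF D2]) (auto simp: indicator_def)
        show "(\<Delta> N i \<omega>)\<^sup>2 * indicat_real {x. \<bar>x\<bar> > \<delta>} (\<Delta> N i \<omega>) \<le> 4 * (D i \<omega>)\<^sup>2 + 16 * A i \<omega> ^ 4 / \<delta>\<^sup>2" for \<omega>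
          using square_truncated_le[OF \<delta>, of "A i \<omega>" "D i \<omega>"] by (simp add: D_def)
      qed (use sqD[OF i] A4 in \<open>auto simp: square_integrable_def\<close>)
      also have "\<dots> = 4 * (\<integral>\<omega>. (D i \<omega>)\<^sup>2 \<partial>M) + 16 * (\<integral>\<omega>. A i \<omega> ^ 4 \<partial>M) / \<delta>\<^sup>2"
        using sqD[OF i] A4(1)[of i] by (simp add: square_integrable_def)
      also have "\<dots> \<le> 4 * (\<integral>\<omega>. (D i \<omega>)\<^sup>2 \<partial>M) + 16 * (3 * real n ^ 4 * K ^ 4 * (T / real N)\<^sup>2) / \<delta>\<^sup>2"
        using A4(2)[of i] by (intro add_left_mono divide_right_mono mult_left_mono) auto
      finally show ?thesis .
    qed
    have "(\<Sum>i<N. \<integral>\<omega>. (D i \<omega>)\<^sup>2 \<partial>M) = (\<integral>p. (\<Sum>i<N. (indicat_real {s i<..s (Suc i)} (snd p) * E p)\<^sup>2) \<partial>time_product M T)"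
      using sqE by (simp add: iso square_integrable_def)
    also have "\<dots> = ?R n \<tau> \<xi>"
    proof (intro Bochner_Integration.integral_cong refl)
      fix p :: "'a \<times> real"
      \<comment> \<open>The indicators of the cells telescope to that of \<open>{0<..T}\<close>, and
        squaring leaves an indicator unchanged.\<close>
      have "indicat_real {s i<..s (Suc i)} u = indicat_real {0<..s (Suc i)} u - indicat_real {0<..s i} u" for i u
        using s[of i] by (auto simp: indicator_def)
      then have "(\<Sum>i<N. indicat_real {s i<..s (Suc i)} (snd p)) = indicat_real {0<..s N} (snd p) - indicat_real {0<..s 0} (snd p)"
        using sum_lessThan_telescope[of "\<lambda>i. indicat_real {0<..s i} (snd p)" N] by simp
      also have "\<dots> = indicat_real {0<..T} (snd p)" using N by (simp add: s_def)
      finally have "(\<Sum>i<N. indicat_real {s i<..s (Suc i)} (snd p)) = indicat_real {0<..T} (snd p)" .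
      moreover have "(indicat_real S u * e)\<^sup>2 = indicat_real S u * e\<^sup>2" for S :: "real set" and u e by (simp add: indicator_def)
      ultimately show "(\<Sum>i<N. (indicat_real {s i<..s (Suc i)} (snd p) * E p)\<^sup>2)
        = (indicat_real {0<..T} (snd p) * (H (snd p) (fst p) - simple_value n \<tau> \<xi> (snd p) (fst p)))\<^sup>2"
        by (simp only: sum_distrib_right[symmetric] E_def)
    qed
    finally have SD: "(\<Sum>i<N. \<integral>\<omega>. (D i \<omega>)\<^sup>2 \<partial>M) < \<epsilon> / 8" using R by simp
    have "(\<Sum>i<N. \<integral>\<omega>. (\<Delta> N i \<omega>)\<^sup>2 * indicat_real {x. \<bar>x\<bar> > \<delta>} (\<Delta> N i \<omega>) \<partial>M)
      \<le> (\<Sum>i<N. 4 * (\<integral>\<omega>. (D i \<omega>)\<^sup>2 \<partial>M) + 16 * (3 * real n ^ 4 * K ^ 4 * (T / real N)\<^sup>2) / \<delta>\<^sup>2)"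
      by (rule sum_mono) (use cell in auto)
    also have "\<dots> = 4 * (\<Sum>i<N. \<integral>\<omega>. (D i \<omega>)\<^sup>2 \<partial>M) + Q * inverse (real N)"
      using N by (simp add: sum.distrib sum_distrib_left[symmetric] Q_def power_divide power2_eq_square field_simps)
    finally show ?thesis using SD by simp
  qed
  have "(\<lambda>N. \<epsilon> / 2 + Q * inverse (real N)) \<longlonglongrightarrow> \<epsilon> / 2 + Q * 0"
    by (intro tendsto_intros lim_inverse_n)
  then have "\<forall>\<^sub>F N in sequentially. \<epsilon> / 2 + Q * inverse (real N) < \<epsilon>"
    by (rule order_tendstoD) (use \<epsilon> in simp)
  with eventually_gt_at_top[of 0] show ?thesis
  proof eventually_elim
    case (elim N)
    show ?case using bound[OF elim(1)] elim(2) by (rule order.strict_trans1)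
  qed
qed

end

section \<open>Processes with bounded coefficients\<close>

text \<open>Reaches every time through countably many rational ones, for the joint measurability of
  the process and for exchanging "for all times" with "almost surely".\<close>

lemma floor_approximation_tendsto:
  assumes u: "0 \<le> (u::real)"
  shows "(\<lambda>n. real (nat \<lfloor>real (Suc n) * u\<rfloor>) / real (Suc n)) \<longlonglongrightarrow> u"
proof (rule tendsto_sandwich)
  show "(\<lambda>n. u - inverse (real (Suc n))) \<longlonglongrightarrow> u"
    using tendsto_diff[OF tendsto_const LIMSEQ_inverse_real_of_nat] by simp
  show "\<forall>\<^sub>F n in sequentially. u - inverse (real (Suc n)) \<le> real (nat \<lfloor>real (Suc n) * u\<rfloor>) / real (Suc n)"
  proof (intro always_eventually allI)
    fix n
    have "real (Suc n) * u - 1 \<le> real (nat \<lfloor>real (Suc n) * u\<rfloor>)"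
      using u by (subst of_nat_nat) (simp, linarith)
    then have "(real (Suc n) * u - 1) / real (Suc n) \<le> real (nat \<lfloor>real (Suc n) * u\<rfloor>) / real (Suc n)"
      by (rule divide_right_mono) simp
    moreover have "(real (Suc n) * u - 1) / real (Suc n) = u - inverse (real (Suc n))"
      by (simp add: diff_divide_distrib inverse_eq_divide del: of_nat_Suc)
    ultimately show "u - inverse (real (Suc n)) \<le> real (nat \<lfloor>real (Suc n) * u\<rfloor>) / real (Suc n)" by simp
  qed
  show "\<forall>\<^sub>F n in sequentially. real (nat \<lfloor>real (Suc n) * u\<rfloor>) / real (Suc n) \<le> u"
    using u by (intro always_eventually allI) (simp add: field_simps)
qed simp

locale bounded_ito_process = brownian_motion M F W
  for M :: "'a measure" and F :: "real \<Rightarrow> 'a measure" and W :: "real \<Rightarrow> 'a \<Rightarrow> real" +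
  fixes X I :: "real \<Rightarrow> 'a \<Rightarrow> real" and \<sigma> b :: "real \<Rightarrow> real" and x :: real
  assumes ito: "ito_integral W (\<lambda>s \<omega>. \<sigma> (X s \<omega>)) I"
    and adapted: "continuous_adapted X"
    and equation: "AE \<omega> in M. \<forall>t\<ge>0. set_integrable lborel {0..t} (\<lambda>s. b (X s \<omega>)) \<and>
      X t \<omega> = x + I t \<omega> + (LINT s:{0..t}|lborel. b (X s \<omega>))"
    and \<sigma>_measurable [measurable]: "\<sigma> \<in> borel_measurable borel" and \<sigma>_bound: "\<And>y. \<bar>\<sigma> y\<bar> \<le> 1"
    and b_measurable [measurable]: "b \<in> borel_measurable borel" and b_bound: "\<And>y. \<bar>b y\<bar> \<le> 1"
begin

lemma X_measurable_F: "0 \<le> s \<Longrightarrow> X s \<in> borel_measurable (F s)"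
  using adapted by (simp add: continuous_adapted_def)

lemma X_measurable: "0 \<le> s \<Longrightarrow> X s \<in> borel_measurable M"
  using X_measurable_F measurable_M by blast

text \<open>The process is the pointwise limit of its values at times rounded down to multiples of
  \<open>1 / Suc n\<close>. Each approximation glues countably many random variables along
  measurable sets of times, and continuity of the paths gives the limit at every sample
  point.\<close>

lemma X_jointly_measurable: "(\<lambda>p. X (snd p) (fst p)) \<in> borel_measurable (time_product M T)"
proof (rule borel_measurable_LIMSEQ_real)
  define g where "g n u = nat \<lfloor>real (Suc n) * u\<rfloor>" for n :: nat and u :: real
  have g: "(\<lambda>p. g n (snd p)) \<in> time_product M T \<rightarrow>\<^sub>M count_space UNIV" for n
    by (rule measurable_snd_time_product) (simp add: g_def)
  show "(\<lambda>p. X (real (g n (snd p)) / real (Suc n)) (fst p)) \<in> borel_measurable (time_product M T)" for n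
    by (rule measurable_compose_countable[OF measurable_fst_time_product[OF X_measurable] g]) simp
  fix p assume "p \<in> space (time_product M T)"
  then have p: "fst p \<in> space M" "0 \<le> snd p" by (auto simp: space_time_product)
  have "(\<lambda>n. real (g n (snd p)) / real (Suc n)) \<longlonglongrightarrow> snd p"
    unfolding g_def by (rule floor_approximation_tendsto[OF p(2)])
  then show "(\<lambda>n. X (real (g n (snd p)) / real (Suc n)) (fst p)) \<longlonglongrightarrow> X (snd p) (fst p)"
    using adapted p
    by (intro continuous_on_tendsto_compose[where s="{0..}" and f="\<lambda>t. X t (fst p)"])
      (auto simp: continuous_adapted_def)
qed

definition drift :: "real \<Rightarrow> real \<Rightarrow> 'a \<Rightarrow> real" where
  "drift s t \<omega> = (\<integral>u. indicat_real {s<..t} u * b (X u \<omega>) \<partial>lborel)"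

lemma increment_eq:
  assumes st: "0 \<le> s" "s \<le> t"
  shows "AE \<omega> in M. X t \<omega> - X s \<omega> = (I t \<omega> - I s \<omega>) + drift s t \<omega>"
  using equation
proof eventually_elim
  case (elim \<omega>)
  then have i: "integrable lborel (\<lambda>u. indicat_real {0..r} u * b (X u \<omega>))" if "0 \<le> r" for r
    using that by (auto simp: set_integrable_def)
  have "(\<integral>u. indicat_real {0..t} u * b (X u \<omega>) \<partial>lborel) - (\<integral>u. indicat_real {0..s} u * b (X u \<omega>) \<partial>lborel)
    = (\<integral>u. indicat_real {0..t} u * b (X u \<omega>) - indicat_real {0..s} u * b (X u \<omega>) \<partial>lborel)"
    using st i by simp
  also have "\<dots> = drift s t \<omega>"
    unfolding drift_def using st by (intro Bochner_Integration.integral_cong) (auto simp: indicator_def)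
  finally show ?case using elim st by (simp add: set_lebesgue_integral_def)
qed

text \<open>Holds at every sample point, even where the path of the drift might fail to be
  integrable, since the Bochner integral is then 0.\<close>

lemma drift_bound:
  assumes "s \<le> t"
  shows "\<bar>drift s t \<omega>\<bar> \<le> t - s"
proof -
  have "\<bar>drift s t \<omega>\<bar> \<le> (\<integral>u. \<bar>indicat_real {s<..t} u * b (X u \<omega>)\<bar> \<partial>lborel)"
    unfolding drift_def by (rule integral_abs_bound)
  also have "\<dots> \<le> (\<integral>u. indicat_real {s<..t} u \<partial>lborel)"
  proof (rule integral_mono')
    show "integrable lborel (indicat_real {s<..t})" by (rule integrable_real_indicator) (use assms in auto)
  qed (use b_bound in \<open>auto simp: indicator_def\<close>)
  finally show ?thesis using assms by simp
qed

lemma integrable_time_product_bounded: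
  fixes \<Psi> :: "'a \<times> real \<Rightarrow> real"
  assumes "\<Psi> \<in> borel_measurable (time_product M T)" "\<And>p. p \<in> space (time_product M T) \<Longrightarrow> \<bar>\<Psi> p\<bar> \<le> C"
  shows "integrable (time_product M T) \<Psi>"
proof -
  interpret P: finite_measure "time_product M T" by (rule finite_measure_time_product)
  show ?thesis by (rule P.integrable_const_bound[where B=C, OF AE_I2 assms(1)]) (use assms(2) in simp)
qed

text \<open>Fubini. The drift term becomes an integral over the same product space as the isometry,
  so that the parts of the generator can later be added under one integral.\<close>

lemma
  assumes st: "0 \<le> s" "s \<le> t" "t \<le> T"
  shows drift_measurable: "drift s t \<in> borel_measurable M"
    and expectation_mult_drift: "\<And>G C. G \<in> borel_measurable M \<Longrightarrow> (\<And>\<omega>. \<omega> \<in> space M \<Longrightarrow> \<bar>G \<omega>\<bar> \<le> C) \<Longrightarrow>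
      (\<integral>\<omega>. G \<omega> * drift s t \<omega> \<partial>M)
      = (\<integral>p. G (fst p) * (indicat_real {s<..t} (snd p) * b (X (snd p) (fst p))) \<partial>time_product M T)"
proof -
  interpret P: pair_sigma_finite M "restrict_space lborel {0..T}" by (rule pair_sigma_finite_time)
  have drift: "drift s t \<omega> = (\<integral>u. indicat_real {s<..t} u * b (X u \<omega>) \<partial>restrict_space lborel {0..T})" for \<omega>
    unfolding drift_def using st
    by (subst integral_restrict_space) (auto intro!: Bochner_Integration.integral_cong simp: indicator_def)
  have m: "(\<lambda>p. indicat_real {s<..t} (snd p) * b (X (snd p) (fst p))) \<in> borel_measurable (time_product M T)"
    using measurable_compose[OF X_jointly_measurable b_measurable]
    by (intro borel_measurable_times measurable_snd_time_product) auto
  have bd: "\<bar>indicat_real {s<..t} u * b y\<bar> \<le> 1" for u y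
    using b_bound[of y] by (simp add: indicator_def)
  have "integrable (time_product M T) (\<lambda>p. indicat_real {s<..t} (snd p) * b (X (snd p) (fst p)))"
    using bd by (intro integrable_time_product_bounded[where C=1] m) auto
  from P.integrable_fst'[OF this[unfolded time_product_def]]
  have "integrable M (drift s t)" by (simp add: drift[abs_def])
  then show "drift s t \<in> borel_measurable M" by simp
  fix G :: "'a \<Rightarrow> real" and C
  assume G: "G \<in> borel_measurable M" "\<And>\<omega>. \<omega> \<in> space M \<Longrightarrow> \<bar>G \<omega>\<bar> \<le> C"
  have "\<bar>G \<omega> * (indicat_real {s<..t} u * b y)\<bar> \<le> \<bar>C\<bar> * 1" if "\<omega> \<in> space M" for u y \<omega>
    unfolding abs_mult[of "G \<omega>"] using G(2)[OF that] bd by (intro mult_mono) auto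
  then have "integrable (time_product M T) (\<lambda>p. G (fst p) * (indicat_real {s<..t} (snd p) * b (X (snd p) (fst p))))"
    by (intro integrable_time_product_bounded[where C="\<bar>C\<bar> * 1"] borel_measurable_times[OF _ m] measurable_fst_time_product G)
      (auto simp: space_time_product)
  from P.integral_fst'[OF this[unfolded time_product_def]]
  show "(\<integral>\<omega>. G \<omega> * drift s t \<omega> \<partial>M)
      = (\<integral>p. G (fst p) * (indicat_real {s<..t} (snd p) * b (X (snd p) (fst p))) \<partial>time_product M T)"
    by (simp add: drift time_product_def)
qed

lemma square_integrable_ito_increment:
  "0 \<le> s \<Longrightarrow> s \<le> t \<Longrightarrow> square_integrable M (\<lambda>\<omega>. I t \<omega> - I s \<omega>)"
  by (intro square_integrable_diff square_integrable_ito_integral[OF ito]) auto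

lemma \<sigma>_jointly_measurable: "(\<lambda>p. \<sigma> (X (snd p) (fst p))) \<in> borel_measurable (time_product M T)"
  by (rule measurable_compose[OF X_jointly_measurable \<sigma>_measurable])

lemma \<sigma>_square_bound: "(\<sigma> y)\<^sup>2 \<le> 1"
  using \<sigma>_bound[of y] by (simp add: abs_square_le_1)

lemma integral_indicator_time_product:
  assumes st: "0 \<le> s" "s \<le> t" "t \<le> T"
  shows "(\<integral>p. indicat_real {s<..t} (snd p) \<partial>time_product M T) = t - s"
proof -
  have "(\<integral>p. 1 * indicat_real {s<..t} (snd p) \<partial>time_product M T)
    = (\<integral>\<omega>. 1 \<partial>M) * (\<integral>u. indicat_real {0..T} u * indicat_real {s<..t} u \<partial>lborel)"
    by (rule integral_time_product_mult[where C=1 and D=1]) auto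
  also have "(\<integral>u. indicat_real {0..T} u * indicat_real {s<..t} u \<partial>lborel) = (\<integral>u. indicat_real {s<..t} u \<partial>lborel)"
    using st by (intro Bochner_Integration.integral_cong) (auto simp: indicator_def)
  finally show ?thesis using st by (simp add: prob_space)
qed

lemma expectation_ito_increment_square:
  assumes st: "0 \<le> s" "s \<le> t"
  shows "(\<integral>\<omega>. (I t \<omega> - I s \<omega>)\<^sup>2 \<partial>M) \<le> t - s"
proof -
  have "(\<integral>\<omega>. (I t \<omega> - I s \<omega>)\<^sup>2 \<partial>M)
    = (\<integral>p. indicat_real {s<..t} (snd p) * (\<sigma> (X (snd p) (fst p)))\<^sup>2 \<partial>time_product M t)"
    using ito_isometry[OF ito st order.refl, of "\<lambda>_. 1" 1] by simp
  also have "\<dots> \<le> (\<integral>p. indicat_real {s<..t} (snd p) \<partial>time_product M t)"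
  proof (rule integral_mono)
    show "integrable (time_product M t) (\<lambda>p. indicat_real {s<..t} (snd p) * (\<sigma> (X (snd p) (fst p)))\<^sup>2)"
      by (intro integrable_time_product_bounded[where C=1] borel_measurable_times borel_measurable_power
          \<sigma>_jointly_measurable measurable_snd_time_product)
         (auto simp: indicator_def \<sigma>_square_bound)
    show "integrable (time_product M t) (\<lambda>p. indicat_real {s<..t} (snd p))"
      by (intro integrable_time_product_bounded[where C=1] measurable_snd_time_product) auto
  qed (simp add: indicator_def \<sigma>_square_bound)
  finally show ?thesis using integral_indicator_time_product[OF st order.refl] by simp
qed

lemma expectation_increment_square:
  assumes st: "0 \<le> s" "s \<le> t"
  shows "integrable M (\<lambda>\<omega>. (X t \<omega> - X s \<omega>)\<^sup>2)"
    and "(\<integral>\<omega>. (X t \<omega> - X s \<omega>)\<^sup>2 \<partial>M) \<le> 2 * (t - s) + 2 * (t - s)\<^sup>2"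
proof -
  have [measurable]: "X t \<in> borel_measurable M" "X s \<in> borel_measurable M" using X_measurable st by auto
  have Ii: "integrable M (\<lambda>\<omega>. (I t \<omega> - I s \<omega>)\<^sup>2)"
    by (rule square_integrable_power2[OF square_integrable_ito_increment[OF st]])
  have le: "AE \<omega> in M. (X t \<omega> - X s \<omega>)\<^sup>2 \<le> 2 * (I t \<omega> - I s \<omega>)\<^sup>2 + 2 * (t - s)\<^sup>2"
    using increment_eq[OF st]
  proof eventually_elim
    case (elim \<omega>)
    have "(drift s t \<omega>)\<^sup>2 \<le> (t - s)\<^sup>2"
      using drift_bound[OF st(2), of \<omega>] st by (subst abs_le_square_iff[symmetric]) simp
    then show ?case
      using square_le_add[of "X t \<omega> - X s \<omega>" "drift s t \<omega>"] unfolding elim by simp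
  qed
  have Bi: "integrable M (\<lambda>\<omega>. 2 * (I t \<omega> - I s \<omega>)\<^sup>2 + 2 * (t - s)\<^sup>2)" using Ii by simp
  show i: "integrable M (\<lambda>\<omega>. (X t \<omega> - X s \<omega>)\<^sup>2)"
    by (rule Bochner_Integration.integrable_bound[OF Bi]) (use le in auto)
  have "(\<integral>\<omega>. (X t \<omega> - X s \<omega>)\<^sup>2 \<partial>M) \<le> (\<integral>\<omega>. 2 * (I t \<omega> - I s \<omega>)\<^sup>2 + 2 * (t - s)\<^sup>2 \<partial>M)"
    by (rule integral_mono_AE[OF i Bi le])
  also have "\<dots> = 2 * (\<integral>\<omega>. (I t \<omega> - I s \<omega>)\<^sup>2 \<partial>M) + 2 * (t - s)\<^sup>2"
    using Ii by (simp add: prob_space)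
  finally show "(\<integral>\<omega>. (X t \<omega> - X s \<omega>)\<^sup>2 \<partial>M) \<le> 2 * (t - s) + 2 * (t - s)\<^sup>2"
    using expectation_ito_increment_square[OF st] by simp
qed

text \<open>Chebyshev's inequality for the second moment.\<close>

lemma expectation_large_increment:
  assumes st: "0 \<le> s" "s \<le> t" and \<delta>: "0 < \<delta>"
  shows "(\<integral>\<omega>. indicat_real {y. \<bar>y\<bar> > \<delta>} (X t \<omega> - X s \<omega>) \<partial>M) \<le> (2 * (t - s) + 2 * (t - s)\<^sup>2) / \<delta>\<^sup>2"
proof -
  have [measurable]: "X t \<in> borel_measurable M" "X s \<in> borel_measurable M" using X_measurable st by auto
  have "(\<integral>\<omega>. indicat_real {y. \<bar>y\<bar> > \<delta>} (X t \<omega> - X s \<omega>) \<partial>M) \<le> (\<integral>\<omega>. (X t \<omega> - X s \<omega>)\<^sup>2 / \<delta>\<^sup>2 \<partial>M)"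
  proof (rule integral_mono)
    show "integrable M (\<lambda>\<omega>. indicat_real {y. \<bar>y\<bar> > \<delta>} (X t \<omega> - X s \<omega>))"
      by (rule integrable_const_bound[where B=1]) auto
    show "indicat_real {y. \<bar>y\<bar> > \<delta>} (X t \<omega> - X s \<omega>) \<le> (X t \<omega> - X s \<omega>)\<^sup>2 / \<delta>\<^sup>2" for \<omega>
    proof (cases "\<bar>X t \<omega> - X s \<omega>\<bar> > \<delta>")
      case True
      then have "\<delta>\<^sup>2 \<le> (X t \<omega> - X s \<omega>)\<^sup>2" using \<delta> by (intro abs_le_square_iff[THEN iffD1]) auto
      then show ?thesis using True \<delta> by simp
    qed simp
  qed (use expectation_increment_square[OF st] in simp)
  also have "\<dots> = (\<integral>\<omega>. (X t \<omega> - X s \<omega>)\<^sup>2 \<partial>M) / \<delta>\<^sup>2" by simp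
  also have "\<dots> \<le> (2 * (t - s) + 2 * (t - s)\<^sup>2) / \<delta>\<^sup>2"
    by (intro divide_right_mono expectation_increment_square(2)[OF st]) simp
  finally show ?thesis .
qed

text \<open>Measures the times at which the process is further than \<open>\<delta>\<close> from its
  position at \<open>s\<close>, where freezing the derivatives gives no small error. For fixed
  \<open>\<delta>\<close> the bound has order \<open>(t - s)^2\<close>.\<close>

lemma integral_large_increment:
  assumes st: "0 \<le> s" "s \<le> t" "t \<le> T" and \<delta>: "0 < \<delta>"
  shows "(\<integral>p. indicat_real {s<..t} (snd p) * indicat_real {y. \<bar>y\<bar> > \<delta>} (X (snd p) (fst p) - X s (fst p)) \<partial>time_product M T)
    \<le> (t - s) * ((2 * (t - s) + 2 * (t - s)\<^sup>2) / \<delta>\<^sup>2)"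
proof -
  interpret P: pair_sigma_finite M "restrict_space lborel {0..T}" by (rule pair_sigma_finite_time)
  interpret L: finite_measure "restrict_space lborel {0..T}" by (rule finite_measure_time)
  let ?A = "\<lambda>u \<omega>. indicat_real {y. \<bar>y\<bar> > \<delta>} (X u \<omega> - X s \<omega>)"
  let ?q = "(2 * (t - s) + 2 * (t - s)\<^sup>2) / \<delta>\<^sup>2"
  have m: "(\<lambda>p. X (snd p) (fst p) - X s (fst p)) \<in> borel_measurable (time_product M T)"
    by (intro borel_measurable_diff X_jointly_measurable measurable_fst_time_product X_measurable st)
  have "(\<lambda>p. ?A (snd p) (fst p)) \<in> borel_measurable (time_product M T)"
    by (rule measurable_compose[OF m]) simp
  then have i: "integrable (time_product M T) (\<lambda>p. indicat_real {s<..t} (snd p) * ?A (snd p) (fst p))"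
    by (intro integrable_time_product_bounded[where C=1] borel_measurable_times measurable_snd_time_product)
       (auto simp: indicator_def)
  then have i': "integrable (M \<Otimes>\<^sub>M restrict_space lborel {0..T}) (\<lambda>(\<omega>, u). indicat_real {s<..t} u * ?A u \<omega>)"
    by (simp add: time_product_def case_prod_beta')
  have "(\<integral>p. indicat_real {s<..t} (snd p) * ?A (snd p) (fst p) \<partial>time_product M T)
    = (\<integral>u. (\<integral>\<omega>. indicat_real {s<..t} u * ?A u \<omega> \<partial>M) \<partial>restrict_space lborel {0..T})"
    using P.integral_snd[OF i'] by (simp add: time_product_def case_prod_beta')
  also have "\<dots> \<le> (\<integral>u. ?q * indicat_real {s<..t} u \<partial>restrict_space lborel {0..T})"
  proof (rule integral_mono)
    show "integrable (restrict_space lborel {0..T}) (\<lambda>u. \<integral>\<omega>. indicat_real {s<..t} u * ?A u \<omega> \<partial>M)"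
      by (rule P.integrable_snd[OF i'])
    show "integrable (restrict_space lborel {0..T}) (\<lambda>u. ?q * indicat_real {s<..t} u)"
      by (rule L.integrable_const_bound[where B="\<bar>?q\<bar>"]) (auto simp: indicator_def intro!: measurable_restrict_space1)
    fix u
    show "(\<integral>\<omega>. indicat_real {s<..t} u * ?A u \<omega> \<partial>M) \<le> ?q * indicat_real {s<..t} u"
    proof (cases "u \<in> {s<..t}")
      case True
      then have "(\<integral>\<omega>. ?A u \<omega> \<partial>M) \<le> (2 * (u - s) + 2 * (u - s)\<^sup>2) / \<delta>\<^sup>2"
        using st \<delta> by (intro expectation_large_increment) auto
      also have "\<dots> \<le> ?q" using True by (intro divide_right_mono add_mono mult_left_mono power_mono) auto
      finally show ?thesis using True by simp
    qed simp
  qed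
  also have "\<dots> = ?q * (\<integral>u. indicat_real {0..T} u * indicat_real {s<..t} u \<partial>lborel)"
    by (subst integral_mult_right_zero, subst integral_restrict_space) simp_all
  also have "(\<integral>u. indicat_real {0..T} u * indicat_real {s<..t} u \<partial>lborel) = (\<integral>u. indicat_real {s<..t} u \<partial>lborel)"
    using st by (intro Bochner_Integration.integral_cong) (auto simp: indicator_def)
  finally show ?thesis using st by (simp add: mult.commute)
qed

end

section \<open>Functions annihilated by the generator\<close>

text \<open>Space derivatives are taken within \<open>S\<close>, so that \<open>S\<close> may be
  \<open>{0..1}\<close> with one-sided derivatives or the whole line. Bounds and uniform continuity
  are assumed outright, because on the whole line compactness does not supply them.\<close>

locale test_function =
  fixes T :: real and S :: "real set" and f fs fx fxx :: "real \<Rightarrow> real \<Rightarrow> real" and C :: real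
  assumes T: "0 < T" and C_nonneg: "0 \<le> C" and S: "convex S" "S \<in> sets borel"
    and deriv_s: "s \<in> {0..T} \<Longrightarrow> y \<in> S \<Longrightarrow> ((\<lambda>s. f s y) has_real_derivative fs s y) (at s within {0..T})"
    and deriv_x: "s \<in> {0..T} \<Longrightarrow> y \<in> S \<Longrightarrow> (f s has_real_derivative fx s y) (at y within S)"
    and deriv_xx: "s \<in> {0..T} \<Longrightarrow> y \<in> S \<Longrightarrow> (fx s has_real_derivative fxx s y) (at y within S)"
    and bound: "s \<in> {0..T} \<Longrightarrow> y \<in> S \<Longrightarrow> \<bar>f s y\<bar> \<le> C \<and> \<bar>fs s y\<bar> \<le> C \<and> \<bar>fx s y\<bar> \<le> C \<and> \<bar>fxx s y\<bar> \<le> C"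
    and uniform: "0 < \<eta> \<Longrightarrow> \<exists>\<delta>>0. \<forall>s\<in>{0..T}. \<forall>s'\<in>{0..T}. \<forall>y\<in>S. \<forall>y'\<in>S.
      \<bar>s - s'\<bar> \<le> \<delta> \<longrightarrow> \<bar>y - y'\<bar> \<le> \<delta> \<longrightarrow>
      \<bar>fs s y - fs s' y'\<bar> \<le> \<eta> \<and> \<bar>fx s y - fx s' y'\<bar> \<le> \<eta> \<and> \<bar>fxx s y - fxx s' y'\<bar> \<le> \<eta>"
begin

definition close :: "real \<Rightarrow> real \<Rightarrow> bool" where
  "close \<eta> \<delta> \<longleftrightarrow> 0 < \<eta> \<and> 0 < \<delta> \<and> (\<forall>s\<in>{0..T}. \<forall>s'\<in>{0..T}. \<forall>y\<in>S. \<forall>y'\<in>S.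
      \<bar>s - s'\<bar> \<le> \<delta> \<longrightarrow> \<bar>y - y'\<bar> \<le> \<delta> \<longrightarrow>
      \<bar>fs s y - fs s' y'\<bar> \<le> \<eta> \<and> \<bar>fx s y - fx s' y'\<bar> \<le> \<eta> \<and> \<bar>fxx s y - fxx s' y'\<bar> \<le> \<eta>)"

text \<open>Trades the condition \<open>|y - y'| \<le> \<delta>\<close> for an error of at most
  \<open>2 C\<close> on the event that it fails. In this form the estimate can be integrated over
  all sample points.\<close>

lemma close_bound:
  assumes c: "close \<eta> \<delta>" and s: "s \<in> {0..T}" "s' \<in> {0..T}" "\<bar>s - s'\<bar> \<le> \<delta>" and y: "y \<in> S" "y' \<in> S"
  shows "\<bar>fs s y - fs s' y'\<bar> \<le> \<eta> + 2 * C * indicat_real {z. \<bar>z\<bar> > \<delta>} (y - y')"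
    "\<bar>fx s y - fx s' y'\<bar> \<le> \<eta> + 2 * C * indicat_real {z. \<bar>z\<bar> > \<delta>} (y - y')"
    "\<bar>fxx s y - fxx s' y'\<bar> \<le> \<eta> + 2 * C * indicat_real {z. \<bar>z\<bar> > \<delta>} (y - y')"
proof -
  have "\<bar>fs s y - fs s' y'\<bar> \<le> \<eta> + 2 * C * indicat_real {z. \<bar>z\<bar> > \<delta>} (y - y') \<and>
    \<bar>fx s y - fx s' y'\<bar> \<le> \<eta> + 2 * C * indicat_real {z. \<bar>z\<bar> > \<delta>} (y - y') \<and>
    \<bar>fxx s y - fxx s' y'\<bar> \<le> \<eta> + 2 * C * indicat_real {z. \<bar>z\<bar> > \<delta>} (y - y')"
  proof (cases "\<bar>y - y'\<bar> > \<delta>")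
    case True
    have "0 < \<eta>" using c by (simp add: close_def)
    moreover have "\<bar>a - b\<bar> \<le> \<eta> + 2 * C" if "\<bar>a\<bar> \<le> C" "\<bar>b\<bar> \<le> C" "0 < \<eta>" for a b
      using that by linarith
    ultimately show ?thesis using True bound[OF s(1) y(1)] bound[OF s(2) y(2)] by simp
  next
    case False
    then have "\<bar>y - y'\<bar> \<le> \<delta>" by simp
    with c s y have "\<bar>fs s y - fs s' y'\<bar> \<le> \<eta> \<and> \<bar>fx s y - fx s' y'\<bar> \<le> \<eta> \<and> \<bar>fxx s y - fxx s' y'\<bar> \<le> \<eta>"
      unfolding close_def by blast
    then show ?thesis using False by simp
  qed
  then show "\<bar>fs s y - fs s' y'\<bar> \<le> \<eta> + 2 * C * indicat_real {z. \<bar>z\<bar> > \<delta>} (y - y')"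
    "\<bar>fx s y - fx s' y'\<bar> \<le> \<eta> + 2 * C * indicat_real {z. \<bar>z\<bar> > \<delta>} (y - y')"
    "\<bar>fxx s y - fxx s' y'\<bar> \<le> \<eta> + 2 * C * indicat_real {z. \<bar>z\<bar> > \<delta>} (y - y')" by auto
qed

section \<open>Taylor estimates with a modulus of continuity\<close>

lemma taylor_time:
  assumes c: "close \<eta> \<delta>" and s: "0 \<le> s" "s < t" "t \<le> T" "t - s \<le> \<delta>" and y: "y \<in> S" "y' \<in> S"
  shows "\<bar>f t y' - f s y' - (t - s) * fs s y\<bar> \<le> (t - s) * (\<eta> + 2 * C * indicat_real {z. \<bar>z\<bar> > \<delta>} (y' - y))"
proof -
  have "((\<lambda>s. f s y') has_derivative (\<lambda>z. fs r y' * z)) (at r within {s..t})" if "r \<in> {s..t}" for r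
    using deriv_s[of r y'] that s y(2)
    by (auto simp: has_field_derivative_def intro: has_derivative_subset)
  from mvt_simple[OF s(2), of "\<lambda>s. f s y'" "\<lambda>r z. fs r y' * z"] this
  obtain r where r: "r \<in> {s<..<t}" "f t y' - f s y' = fs r y' * (t - s)" by auto
  have "\<bar>f t y' - f s y' - (t - s) * fs s y\<bar> = (t - s) * \<bar>fs r y' - fs s y\<bar>"
  proof -
    have "f t y' - f s y' - (t - s) * fs s y = (t - s) * (fs r y' - fs s y)"
      unfolding r(2) by (simp add: algebra_simps)
    then show ?thesis using s by (simp add: abs_mult)
  qed
  also have "\<dots> \<le> (t - s) * (\<eta> + 2 * C * indicat_real {z. \<bar>z\<bar> > \<delta>} (y' - y))"
    using r s y by (intro mult_left_mono close_bound[OF c]) auto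
  finally show ?thesis .
qed

lemma taylor_space:
  assumes c: "close \<eta> \<delta>" and s: "s \<in> {0..T}" and y: "y \<in> S" "y' \<in> S"
  shows "\<bar>f s y' - f s y - (fx s y * (y' - y) + 1/2 * fxx s y * (y' - y)\<^sup>2)\<bar>
    \<le> (y' - y)\<^sup>2 * (\<eta> + 2 * C * indicat_real {z. \<bar>z\<bar> > \<delta>} (y' - y))"
proof -
  define B where "B = \<eta> + 2 * C * indicat_real {z. \<bar>z\<bar> > \<delta>} (y' - y)"
  define R where "R = closed_segment y y'"
  have R: "R \<subseteq> S" "convex R" using y S(1) by (auto simp: R_def closed_segment_subset)
  \<comment> \<open>Taylor's theorem is applied one order lower, to \<open>f s\<close> minus its
    quadratic term. The second derivative of this difference is the oscillation of
    \<open>fxx\<close>, so no third derivative appears.\<close>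
  define g where "g i = (\<lambda>z. if i = 0 then f s z - 1/2 * fxx s y * (z - y)\<^sup>2
    else if i = 1 then fx s z - fxx s y * (z - y) else fxx s z - fxx s y)" for i :: nat
  have "norm (g 0 y' - (\<Sum>i\<le>1. g i y * (y' - y) ^ i / fact i)) \<le> B * norm (y' - y) ^ Suc 1 / fact 1"
  proof (rule field_Taylor[OF R(2)])
    fix i :: nat and z assume z: "z \<in> R" "i \<le> 1"
    then have zS: "z \<in> S" using R by auto
    have 0: "(g 0 has_field_derivative g 1 z) (at z within R)"
      unfolding g_def using has_field_derivative_subset[OF deriv_x[OF s zS] R(1)]
      by (auto intro!: derivative_eq_intros)
    have 1: "(g 1 has_field_derivative g 2 z) (at z within R)"
      unfolding g_def using has_field_derivative_subset[OF deriv_xx[OF s zS] R(1)]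
      by (auto intro!: derivative_eq_intros)
    from z(2) have "i = 0 \<or> i = 1" by auto
    with 0 1 show "(g i has_field_derivative g (Suc i) z) (at z within R)" by (auto simp: numeral_2_eq_2)
  next
    fix z assume z: "z \<in> R"
    then have zS: "z \<in> S" using R by auto
    \<comment> \<open>Points of the segment are no further from \<open>y\<close> than
      \<open>y'\<close> is, so a large displacement at \<open>z\<close> implies one at
      \<open>y'\<close>.\<close>
    have "\<bar>z - y\<bar> \<le> \<bar>y' - y\<bar>" using z by (auto simp: R_def closed_segment_eq_real_ivl split: if_splits)
    then have "2 * C * indicat_real {z. \<bar>z\<bar> > \<delta>} (z - y) \<le> 2 * C * indicat_real {z. \<bar>z\<bar> > \<delta>} (y' - y)"
      using bound[OF s y(1)] by (auto simp: indicator_def)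
    then show "norm (g (Suc 1) z) \<le> B"
      using close_bound(3)[OF c s s _ zS y(1)] c by (simp add: g_def B_def close_def)
  qed (auto simp: R_def)
  then show ?thesis by (simp add: g_def B_def power2_eq_square algebra_simps)
qed

text \<open>Outside \<open>S\<close> the functions are arbitrary, so measurability is available only
  after multiplication by the indicator. On \<open>S\<close>, differentiability makes
  \<open>f\<close> and \<open>fx\<close> continuous, while \<open>fs\<close> and \<open>fxx\<close>
  are continuous by \<open>uniform\<close>.\<close>

lemma measurable_indicator_mult:
  assumes s: "s \<in> {0..T}"
  shows "(\<lambda>y. indicat_real S y * f s y) \<in> borel_measurable borel"
    "(\<lambda>y. indicat_real S y * fs s y) \<in> borel_measurable borel"
    "(\<lambda>y. indicat_real S y * fx s y) \<in> borel_measurable borel"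
    "(\<lambda>y. indicat_real S y * fxx s y) \<in> borel_measurable borel"
proof -
  have m: "(\<lambda>y. indicat_real S y * g y) \<in> borel_measurable borel" if "continuous_on S g" for g
    using borel_measurable_continuous_on_indicator[OF S(2) that] by simp
  have c: "continuous_on S (\<lambda>y. \<phi> s y)"
    if "\<And>\<eta>. 0 < \<eta> \<Longrightarrow> \<exists>\<delta>>0. \<forall>y\<in>S. \<forall>y'\<in>S. \<bar>y - y'\<bar> \<le> \<delta> \<longrightarrow> \<bar>\<phi> s y - \<phi> s y'\<bar> \<le> \<eta>" for \<phi> :: "real \<Rightarrow> real \<Rightarrow> real"
    unfolding continuous_on_iff
  proof (intro ballI allI impI)
    fix y e assume "y \<in> S" "(0::real) < e"
    with that[of "e / 2"] obtain \<delta> where "\<delta> > 0" "\<forall>y'\<in>S. \<bar>y' - y\<bar> \<le> \<delta> \<longrightarrow> \<bar>\<phi> s y' - \<phi> s y\<bar> \<le> e / 2" by auto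
    then show "\<exists>d>0. \<forall>y'\<in>S. dist y' y < d \<longrightarrow> dist (\<phi> s y') (\<phi> s y) < e"
      using \<open>0 < e\<close> by (intro exI[of _ \<delta>]) (force simp: dist_real_def)
  qed
  show "(\<lambda>y. indicat_real S y * fs s y) \<in> borel_measurable borel"
    "(\<lambda>y. indicat_real S y * fxx s y) \<in> borel_measurable borel"
    by (intro m c; use uniform s in \<open>fastforce\<close>)+
  show "(\<lambda>y. indicat_real S y * f s y) \<in> borel_measurable borel"
    "(\<lambda>y. indicat_real S y * fx s y) \<in> borel_measurable borel"
    using deriv_x[OF s] deriv_xx[OF s]
    by (intro m; auto intro!: DERIV_continuous_on)+
qed

end

context test_function
begin

text \<open>Here \<open>i\<close> is the noise part and \<open>a\<close> the drift part of the
  displacement. Of the quadratic term only \<open>i^2\<close> is kept, the part which the isometry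
  evaluates. Every term on the right is small after taking means and summing over a fine
  partition.\<close>

lemma taylor_increment:
  assumes c: "close \<eta> \<delta>" and st: "0 \<le> s" "s < t" "t \<le> T" "t - s \<le> \<delta> / 2" and y: "y \<in> S" "y' \<in> S"
    and ia: "y' - y = i + a" and a: "\<bar>a\<bar> \<le> t - s"
  shows "\<bar>f t y' - f s y - ((t - s) * fs s y + fx s y * i + fx s y * a + 1/2 * (fxx s y * i\<^sup>2))\<bar>
    \<le> (t - s) * (\<eta> + 2 * C * indicat_real {z. \<bar>z\<bar> > \<delta>} (y' - y)) + \<eta> * (y' - y)\<^sup>2
      + 8 * C * (i\<^sup>2 * indicat_real {z. \<bar>z\<bar> > \<delta> / 2} i) + C * (\<eta> * i\<^sup>2 + (t - s)\<^sup>2 / \<eta> + (t - s)\<^sup>2)"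
proof -
  let ?h = "t - s" and ?ind = "indicat_real {z. \<bar>z\<bar> > \<delta>} (y' - y)"
  have \<eta>: "0 < \<eta>" and \<delta>: "0 < \<delta>" using c by (auto simp: close_def)
  have sT: "s \<in> {0..T}" using st by auto
  have time: "\<bar>f t y' - f s y' - ?h * fs s y\<bar> \<le> ?h * (\<eta> + 2 * C * ?ind)"
    using st \<delta> y by (intro taylor_time[OF c]) auto
  have space: "\<bar>f s y' - f s y - (fx s y * (y' - y) + 1/2 * fxx s y * (y' - y)\<^sup>2)\<bar> \<le> (y' - y)\<^sup>2 * (\<eta> + 2 * C * ?ind)"
    by (rule taylor_space[OF c sT y])
  \<comment> \<open>The event of a large displacement is moved to the noise, where the Lindeberg
    condition applies: as \<open>|a| \<le> \<delta> / 2\<close>, a displacement beyond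
    \<open>\<delta>\<close> forces \<open>|i| > \<delta> / 2\<close> and is at most
    \<open>2 |i|\<close>.\<close>
  have ind: "(y' - y)\<^sup>2 * ?ind \<le> 4 * (i\<^sup>2 * indicat_real {z. \<bar>z\<bar> > \<delta> / 2} i)"
  proof (cases "\<bar>y' - y\<bar> > \<delta>")
    case True
    then have i: "\<bar>i\<bar> > \<delta> / 2" "\<bar>y' - y\<bar> \<le> \<bar>2 * i\<bar>" using ia a st by linarith+
    from i(2) have "(y' - y)\<^sup>2 \<le> (2 * i)\<^sup>2" by (simp only: abs_le_square_iff)
    with i(1) True show ?thesis by (simp add: power_mult_distrib)
  qed (simp add: zero_le_mult_iff)
  have a2: "a\<^sup>2 \<le> ?h\<^sup>2" using a by (intro abs_le_square_iff[THEN iffD1]) auto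
  \<comment> \<open>Young's inequality with parameter \<open>\<eta>\<close>: summed over the cells,
    the means of \<open>\<eta> i^2\<close> stay proportional to \<open>\<eta>\<close>, while
    \<open>h^2 / \<eta>\<close> vanishes with the mesh for fixed \<open>\<eta>\<close>.\<close>
  have "\<bar>a * i\<bar> \<le> a\<^sup>2 / \<eta> + \<eta> * i\<^sup>2" by (rule young_abs_mult[OF \<eta>])
  also have "\<dots> \<le> ?h\<^sup>2 / \<eta> + \<eta> * i\<^sup>2" using a2 \<eta> by (intro add_right_mono divide_right_mono) auto
  finally have "\<bar>a * i + a\<^sup>2 / 2\<bar> \<le> \<eta> * i\<^sup>2 + ?h\<^sup>2 / \<eta> + ?h\<^sup>2"
    using a2 abs_triangle_ineq[of "a * i" "a\<^sup>2 / 2"] zero_le_power2[of a] by linarith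
  then have "\<bar>fxx s y\<bar> * \<bar>a * i + a\<^sup>2 / 2\<bar> \<le> C * (\<eta> * i\<^sup>2 + ?h\<^sup>2 / \<eta> + ?h\<^sup>2)"
    using bound[OF sT y(1)] C_nonneg by (intro mult_mono) auto
  then have cross: "\<bar>fxx s y * (a * i + a\<^sup>2 / 2)\<bar> \<le> C * (\<eta> * i\<^sup>2 + ?h\<^sup>2 / \<eta> + ?h\<^sup>2)" by (simp only: abs_mult)
  have "f t y' - f s y - (?h * fs s y + fx s y * i + fx s y * a + 1/2 * (fxx s y * i\<^sup>2))
    = (f t y' - f s y' - ?h * fs s y)
    + (f s y' - f s y - (fx s y * (y' - y) + 1/2 * fxx s y * (y' - y)\<^sup>2)) + fxx s y * (a * i + a\<^sup>2 / 2)"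
    unfolding ia by (simp add: algebra_simps power2_eq_square)
  moreover have "(y' - y)\<^sup>2 * (\<eta> + 2 * C * ?ind) \<le> \<eta> * (y' - y)\<^sup>2 + 8 * C * (i\<^sup>2 * indicat_real {z. \<bar>z\<bar> > \<delta> / 2} i)"
    using mult_left_mono[OF ind, of "2 * C"] C_nonneg by (simp add: algebra_simps)
  ultimately show ?thesis using time space cross by linarith
qed

end

lemma (in brownian_motion) AE_time_product:
  assumes "AE \<omega> in M. Q \<omega>"
  shows "AE p in time_product M T. Q (fst p)"
proof -
  interpret L: sigma_finite_measure "restrict_space lborel {0..T}"
    by (rule finite_measure.axioms(1)[OF finite_measure_time])
  obtain A where A: "{\<omega> \<in> space M. \<not> Q \<omega>} \<subseteq> A" "A \<in> sets M" "emeasure M A = 0"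
    using AE_E[OF assms] by metis
  show ?thesis
  proof (rule AE_I)
    show "{p \<in> space (time_product M T). \<not> Q (fst p)} \<subseteq> A \<times> {0..T}"
      using A(1) by (auto simp: space_time_product)
    have I: "{0..T} \<in> sets (restrict_space lborel {0..T})" by (simp add: sets_restrict_space image_iff) (metis Int_absorb1 atLeastatMost_subset_iff order.refl borel_closed closed_atLeastAtMost)
    show "emeasure (time_product M T) (A \<times> {0..T}) = 0"
      unfolding time_product_def using A I by (simp add: L.emeasure_pair_measure_Times)
    show "A \<times> {0..T} \<in> sets (time_product M T)" unfolding time_product_def using A I by auto
  qed
qed

section \<open>Constancy of the expectation along the process\<close>

locale generator_annihilated =
  bounded_ito_process M F W X I \<sigma> b x + test_function T S f fs fx fxx C
  for M :: "'a measure" and F W X I \<sigma> b x T S f fs fx fxx C +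
  assumes X_in_S: "AE \<omega> in M. \<forall>t\<in>{0..T}. X t \<omega> \<in> S"
    and generator: "s \<in> {0..T} \<Longrightarrow> y \<in> S \<Longrightarrow> fs s y + b y * fx s y + 1/2 * (\<sigma> y)\<^sup>2 * fxx s y = 0"
begin

definition expected :: "real \<Rightarrow> real" where
  "expected s = (\<integral>\<omega>. indicat_real S (X s \<omega>) * f s (X s \<omega>) \<partial>M)"

text \<open>Two errors are added: the Taylor remainder, bounded by \<open>Bd\<close>, and the mean
  of the main term, which would be exactly 0 if the derivatives were taken at
  \<open>(u, X u)\<close> instead of \<open>(s, X s)\<close>. Summed over \<open>N\<close> intervals
  of length \<open>T / N\<close>, each term of the bound is either proportional to
  \<open>\<eta>\<close>, or vanishes as \<open>N\<close> grows, or is the Lindeberg sum of the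
  \<open>L\<close>.\<close>

lemma expected_increment:
  assumes c: "close \<eta> \<delta>" and st: "0 \<le> s" "s < t" "t \<le> T" "t - s \<le> \<delta> / 2"
  defines "h \<equiv> t - s" and "q \<equiv> 2 * (t - s) + 2 * (t - s)\<^sup>2"
    and "L \<equiv> \<integral>\<omega>. (I t \<omega> - I s \<omega>)\<^sup>2 * indicat_real {z. \<bar>z\<bar> > \<delta> / 2} (I t \<omega> - I s \<omega>) \<partial>M"
  shows "\<bar>expected t - expected s\<bar>
    \<le> 4 * h * \<eta> + 8 * C * h * (q / \<delta>\<^sup>2) + \<eta> * q + 8 * C * L + C * (\<eta> * h + h\<^sup>2 / \<eta> + h\<^sup>2)"
proof -
  interpret P: finite_measure "time_product M T" by (rule finite_measure_time_product)
  have \<eta>: "0 < \<eta>" and \<delta>: "0 < \<delta>" using c by (auto simp: close_def)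
  have st': "s \<le> t" "s \<in> {0..T}" "t \<in> {0..T}" "0 \<le> t" using st by auto
  note CC = C_nonneg
  define G0 where "G0 \<omega> = indicat_real S (X s \<omega>) * fs s (X s \<omega>)" for \<omega>
  define G1 where "G1 \<omega> = indicat_real S (X s \<omega>) * fx s (X s \<omega>)" for \<omega>
  define G2 where "G2 \<omega> = indicat_real S (X s \<omega>) * fxx s (X s \<omega>)" for \<omega>
  define Y where "Y r \<omega> = indicat_real S (X r \<omega>) * f r (X r \<omega>)" for r \<omega>
  define i where "i \<omega> = I t \<omega> - I s \<omega>" for \<omega>
  have GF: "G0 \<in> borel_measurable (F s)" "G1 \<in> borel_measurable (F s)" "G2 \<in> borel_measurable (F s)"
    unfolding G0_def[abs_def] G1_def[abs_def] G2_def[abs_def]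
    using measurable_compose[OF X_measurable_F[OF st(1)] measurable_indicator_mult(2)[OF st'(2)]]
      measurable_compose[OF X_measurable_F[OF st(1)] measurable_indicator_mult(3)[OF st'(2)]]
      measurable_compose[OF X_measurable_F[OF st(1)] measurable_indicator_mult(4)[OF st'(2)]] by auto
  have GM: "G0 \<in> borel_measurable M" "G1 \<in> borel_measurable M" "G2 \<in> borel_measurable M"
    using GF measurable_M[OF st(1)] by blast+
  have GC: "\<bar>G0 \<omega>\<bar> \<le> C" "\<bar>G1 \<omega>\<bar> \<le> C" "\<bar>G2 \<omega>\<bar> \<le> C" for \<omega>
    using bound[OF st'(2), of "X s \<omega>"] CC by (auto simp: G0_def G1_def G2_def indicator_def)
  have Yi: "integrable M (Y r)" if "r \<in> {0..T}" for r
  proof (rule integrable_const_bound[where B=C])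
    show "Y r \<in> borel_measurable M"
      unfolding Y_def[abs_def]
      using that by (intro measurable_compose[OF X_measurable measurable_indicator_mult(1)]) auto
    show "AE \<omega> in M. norm (Y r \<omega>) \<le> C"
      using bound[OF that] CC by (intro AE_I2) (auto simp: Y_def indicator_def)
  qed
  have isq: "square_integrable M i"
    unfolding i_def[abs_def] by (rule square_integrable_ito_increment[OF st(1) st'(1)])
  then have iM [measurable]: "i \<in> borel_measurable M" and i2: "integrable M (\<lambda>\<omega>. (i \<omega>)\<^sup>2)"
    by (auto simp: square_integrable_def)
  have one: "square_integrable M (\<lambda>_. 1)" by (intro square_integrable_bounded[where C=1]) auto
  have int0: "integrable M G0" using GC by (intro integrable_const_bound[where B=C, OF AE_I2 GM(1)]) auto
  have int1: "integrable M (\<lambda>\<omega>. G1 \<omega> * i \<omega>)"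
    using integrable_weighted_mult[OF isq one GM(2) GC(2)] by simp
  have intd: "integrable M (\<lambda>\<omega>. G1 \<omega> * drift s t \<omega>)"
  proof (rule integrable_const_bound[where B="C * (t - s)"])
    show "AE \<omega> in M. norm (G1 \<omega> * drift s t \<omega>) \<le> C * (t - s)"
      using GC(2) CC drift_bound[OF st'(1)] by (intro AE_I2) (auto simp: abs_mult intro!: mult_mono)
    show "(\<lambda>\<omega>. G1 \<omega> * drift s t \<omega>) \<in> borel_measurable M"
      using GM(2) drift_measurable[OF st(1) st'(1) st(3)] by measurable
  qed
  have int2: "integrable M (\<lambda>\<omega>. G2 \<omega> * (i \<omega>)\<^sup>2)"
    using integrable_weighted_mult[OF isq isq GM(3) GC(3)] by (simp add: power2_eq_square)
  define main where "main \<omega> = h * G0 \<omega> + G1 \<omega> * i \<omega> + G1 \<omega> * drift s t \<omega> + 1/2 * (G2 \<omega> * (i \<omega>)\<^sup>2)" for \<omega>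
  have main_int: "integrable M main"
    unfolding main_def[abs_def] using int0 int1 intd int2 by simp
  define Bd where "Bd \<omega> = h * (\<eta> + 2 * C * indicat_real {z. \<bar>z\<bar> > \<delta>} (X t \<omega> - X s \<omega>)) + \<eta> * (X t \<omega> - X s \<omega>)\<^sup>2
      + 8 * C * ((i \<omega>)\<^sup>2 * indicat_real {z. \<bar>z\<bar> > \<delta> / 2} (i \<omega>)) + C * (\<eta> * (i \<omega>)\<^sup>2 + h\<^sup>2 / \<eta> + h\<^sup>2)" for \<omega>
  have Z: "AE \<omega> in M. \<bar>Y t \<omega> - Y s \<omega> - main \<omega>\<bar> \<le> Bd \<omega>"
    using X_in_S increment_eq[OF st(1) st'(1)]
  proof eventually_elim
    case (elim \<omega>)
    then have "X s \<omega> \<in> S" "X t \<omega> \<in> S" using st'(2,3) by auto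
    then show ?case
      using taylor_increment[OF c st \<open>X s \<omega> \<in> S\<close> \<open>X t \<omega> \<in> S\<close> elim(2) drift_bound[OF st'(1)]]
      unfolding Bd_def main_def i_def h_def by (simp add: Y_def G0_def G1_def G2_def)
  qed
  have [measurable]: "X t \<in> borel_measurable M" "X s \<in> borel_measurable M" using X_measurable st st' by auto
  have j1: "integrable M (\<lambda>\<omega>. indicat_real {z. \<bar>z\<bar> > \<delta>} (X t \<omega> - X s \<omega>))"
    by (rule integrable_const_bound[where B=1]) auto
  have j2: "integrable M (\<lambda>\<omega>. (X t \<omega> - X s \<omega>)\<^sup>2)" by (rule expectation_increment_square(1)[OF st(1) st'(1)])
  have j3: "integrable M (\<lambda>\<omega>. (i \<omega>)\<^sup>2 * indicat_real {z. \<bar>z\<bar> > \<delta> / 2} (i \<omega>))"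
    by (rule Bochner_Integration.integrable_bound[OF i2]) (auto simp: indicator_def)
  have Bd_int: "integrable M Bd"
    unfolding Bd_def[abs_def] using j1 j2 j3 i2 by simp
  have "(\<integral>\<omega>. Bd \<omega> \<partial>M) = h * (\<eta> + 2 * C * (\<integral>\<omega>. indicat_real {z. \<bar>z\<bar> > \<delta>} (X t \<omega> - X s \<omega>) \<partial>M))
      + \<eta> * (\<integral>\<omega>. (X t \<omega> - X s \<omega>)\<^sup>2 \<partial>M) + 8 * C * L + C * (\<eta> * (\<integral>\<omega>. (i \<omega>)\<^sup>2 \<partial>M) + h\<^sup>2 / \<eta> + h\<^sup>2)"
    unfolding Bd_def L_def i_def[symmetric] using j1 j2 j3 i2 by (simp add: prob_space)
  also have "\<dots> \<le> h * (\<eta> + 2 * C * (q / \<delta>\<^sup>2)) + \<eta> * q + 8 * C * L + C * (\<eta> * h + h\<^sup>2 / \<eta> + h\<^sup>2)"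
    using expectation_large_increment[OF st(1) st'(1) \<delta>] expectation_increment_square(2)[OF st(1) st'(1)]
      expectation_ito_increment_square[OF st(1) st'(1)] \<eta> CC st'(1)
    unfolding h_def q_def i_def
    by (intro add_mono mult_left_mono order.refl) auto
  finally have Bd_le: "(\<integral>\<omega>. Bd \<omega> \<partial>M) \<le> \<dots>" .
  have "\<bar>\<integral>\<omega>. Y t \<omega> - Y s \<omega> - main \<omega> \<partial>M\<bar> \<le> (\<integral>\<omega>. \<bar>Y t \<omega> - Y s \<omega> - main \<omega>\<bar> \<partial>M)"
    by (rule integral_abs_bound)
  also have "\<dots> \<le> (\<integral>\<omega>. Bd \<omega> \<partial>M)"
    using Yi st' main_int Bd_int Z by (intro integral_mono_AE) auto
  also have "(\<integral>\<omega>. Y t \<omega> - Y s \<omega> - main \<omega> \<partial>M) = expected t - expected s - (\<integral>\<omega>. main \<omega> \<partial>M)"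
    unfolding expected_def Y_def[symmetric] using Yi st' main_int by simp
  finally have err: "\<bar>expected t - expected s - (\<integral>\<omega>. main \<omega> \<partial>M)\<bar> \<le> (\<integral>\<omega>. Bd \<omega> \<partial>M)" .

  have GP: "(\<lambda>p. G0 (fst p)) \<in> borel_measurable (time_product M T)"
    "(\<lambda>p. G1 (fst p)) \<in> borel_measurable (time_product M T)" "(\<lambda>p. G2 (fst p)) \<in> borel_measurable (time_product M T)"
    using GM by (auto intro: measurable_fst_time_product)
  have bP: "(\<lambda>p. b (X (snd p) (fst p))) \<in> borel_measurable (time_product M T)"
    by (rule measurable_compose[OF X_jointly_measurable b_measurable])
  have iP: "(\<lambda>p. indicat_real {s<..t} (snd p)) \<in> borel_measurable (time_product M T)"
    by (rule measurable_snd_time_product) auto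
  have e0: "h * (\<integral>\<omega>. G0 \<omega> \<partial>M) = (\<integral>p. G0 (fst p) * indicat_real {s<..t} (snd p) \<partial>time_product M T)"
  proof -
    have "(\<integral>u. indicat_real {0..T} u * indicat_real {s<..t} u \<partial>lborel) = (\<integral>u. indicat_real {s<..t} u \<partial>lborel)"
      using st by (intro Bochner_Integration.integral_cong) (auto simp: indicator_def)
    then show ?thesis
      using integral_time_product_mult[OF GM(1) GC(1), of "indicat_real {s<..t}" 1 T] st' by (simp add: h_def)
  qed
  have k0: "integrable (time_product M T) (\<lambda>p. G0 (fst p) * indicat_real {s<..t} (snd p))"
    using GC CC by (intro integrable_time_product_bounded[where C=C] borel_measurable_times GP iP) (auto simp: indicator_def)
  have k1: "integrable (time_product M T) (\<lambda>p. G1 (fst p) * (indicat_real {s<..t} (snd p) * b (X (snd p) (fst p))))"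
  proof (intro integrable_time_product_bounded[where C="C * 1"] borel_measurable_times GP iP bP)
    fix p show "\<bar>G1 (fst p) * (indicat_real {s<..t} (snd p) * b (X (snd p) (fst p)))\<bar> \<le> C * 1"
      unfolding abs_mult[of "G1 (fst p)"] using GC CC b_bound by (intro mult_mono) (auto simp: indicator_def)
  qed
  have k2: "integrable (time_product M T) (\<lambda>p. G2 (fst p) * (indicat_real {s<..t} (snd p) * (\<sigma> (X (snd p) (fst p)))\<^sup>2))"
  proof (intro integrable_time_product_bounded[where C="C * 1"] borel_measurable_times borel_measurable_power GP iP \<sigma>_jointly_measurable)
    fix p show "\<bar>G2 (fst p) * (indicat_real {s<..t} (snd p) * (\<sigma> (X (snd p) (fst p)))\<^sup>2)\<bar> \<le> C * 1"
      unfolding abs_mult[of "G2 (fst p)"] using GC CC \<sigma>_square_bound by (intro mult_mono) (auto simp: indicator_def)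
  qed
  \<comment> \<open>Derivatives at \<open>(s, X s)\<close>, coefficients at the running time: the
    main term written as one integrand on the product space.\<close>
  define \<Psi> where "\<Psi> p = G0 (fst p) * indicat_real {s<..t} (snd p)
    + G1 (fst p) * (indicat_real {s<..t} (snd p) * b (X (snd p) (fst p)))
    + 1/2 * (G2 (fst p) * (indicat_real {s<..t} (snd p) * (\<sigma> (X (snd p) (fst p)))\<^sup>2))" for p
  have \<Psi>_int: "integrable (time_product M T) \<Psi>" unfolding \<Psi>_def[abs_def] using k0 k1 k2 by simp
  have "(\<integral>\<omega>. main \<omega> \<partial>M) = h * (\<integral>\<omega>. G0 \<omega> \<partial>M) + (\<integral>\<omega>. G1 \<omega> * i \<omega> \<partial>M) + (\<integral>\<omega>. G1 \<omega> * drift s t \<omega> \<partial>M)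
     + 1/2 * (\<integral>\<omega>. G2 \<omega> * (i \<omega>)\<^sup>2 \<partial>M)"
    unfolding main_def using int0 int1 intd int2 by simp
  \<comment> \<open>The term linear in the noise drops out because its coefficient is known at time
    \<open>s\<close>.\<close>
  also have "(\<integral>\<omega>. G1 \<omega> * i \<omega> \<partial>M) = 0"
    unfolding i_def by (rule ito_increment_mean_zero[OF ito st(1) st'(1) GF(2) GC(2)])
  also have "(\<integral>\<omega>. G2 \<omega> * (i \<omega>)\<^sup>2 \<partial>M)
    = (\<integral>p. G2 (fst p) * (indicat_real {s<..t} (snd p) * (\<sigma> (X (snd p) (fst p)))\<^sup>2) \<partial>time_product M T)"
    unfolding i_def by (rule ito_isometry[OF ito st(1) st'(1) st(3) GF(3) GC(3)])
  also note expectation_mult_drift[OF st(1) st'(1) st(3) GM(2) GC(2)]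
  also note e0
  finally have main_eq: "(\<integral>\<omega>. main \<omega> \<partial>M) = (\<integral>p. \<Psi> p \<partial>time_product M T)"
    unfolding \<Psi>_def using k0 k1 k2 by simp
  \<comment> \<open>Three derivatives are moved from \<open>(s, X s)\<close> to
    \<open>(u, X u)\<close>, each with a coefficient of modulus at most 1 and an error of at most
    \<open>\<eta> + 2 C\<close> times the indicator of a large displacement.\<close>
  define B where "B p = 3 * \<eta> * indicat_real {s<..t} (snd p)
    + 6 * C * (indicat_real {s<..t} (snd p) * indicat_real {z. \<bar>z\<bar> > \<delta>} (X (snd p) (fst p) - X s (fst p)))" for p
  have m: "(\<lambda>p. X (snd p) (fst p) - X s (fst p)) \<in> borel_measurable (time_product M T)"
    by (intro borel_measurable_diff X_jointly_measurable measurable_fst_time_product X_measurable st)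
  have b1: "integrable (time_product M T) (\<lambda>p. indicat_real {s<..t} (snd p))"
    by (intro integrable_time_product_bounded[where C=1] iP) auto
  have "(\<lambda>p. indicat_real {z. \<bar>z\<bar> > \<delta>} (X (snd p) (fst p) - X s (fst p))) \<in> borel_measurable (time_product M T)"
    by (rule measurable_compose[OF m]) simp
  then have b2: "integrable (time_product M T)
    (\<lambda>p. indicat_real {s<..t} (snd p) * indicat_real {z. \<bar>z\<bar> > \<delta>} (X (snd p) (fst p) - X s (fst p)))"
    by (intro integrable_time_product_bounded[where C=1] borel_measurable_times iP) (auto simp: indicator_def)
  have B_int: "integrable (time_product M T) B" unfolding B_def[abs_def] using b1 b2 by simp
  have "AE p in time_product M T. \<forall>t\<in>{0..T}. X t (fst p) \<in> S" by (rule AE_time_product[OF X_in_S])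
  then have \<Psi>B: "AE p in time_product M T. \<bar>\<Psi> p\<bar> \<le> B p"
  proof eventually_elim
    case (elim p)
    show ?case
    proof (cases "snd p \<in> {s<..t}")
      case True
      define u y' y where "u = snd p" and "y' = X (snd p) (fst p)" and "y = X s (fst p)"
      have u: "u \<in> {0..T}" "\<bar>u - s\<bar> \<le> \<delta>" using True st \<delta> by (auto simp: u_def)
      have yS: "y \<in> S" "y' \<in> S" using elim u st' by (auto simp: y_def y'_def u_def)
      let ?e = "\<eta> + 2 * C * indicat_real {z. \<bar>z\<bar> > \<delta>} (y' - y)"
      note cb = close_bound[OF c u(1) st'(2) u(2) yS(2,1)]
      have e0: "0 \<le> ?e" using \<eta> CC by (simp add: indicator_def)
      have "\<bar>fx s y - fx u y'\<bar> * \<bar>b y'\<bar> \<le> ?e * 1"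
        using cb(2) b_bound e0 by (intro mult_mono) (auto simp: abs_minus_commute)
      moreover have "\<bar>fxx s y - fxx u y'\<bar> * \<bar>1/2 * (\<sigma> y')\<^sup>2\<bar> \<le> ?e * 1"
        using cb(3) \<sigma>_square_bound[of y'] e0 by (intro mult_mono) (auto simp: abs_minus_commute)
      ultimately have 1: "\<bar>fs s y - fs u y'\<bar> + \<bar>(fx s y - fx u y') * b y'\<bar> + \<bar>(fxx s y - fxx u y') * (1/2 * (\<sigma> y')\<^sup>2)\<bar> \<le> 3 * ?e"
        using cb(1) by (simp add: abs_mult abs_minus_commute)
      have "\<Psi> p = fs s y + fx s y * b y' + 1/2 * (fxx s y * (\<sigma> y')\<^sup>2)"
        using True yS by (simp add: \<Psi>_def G0_def G1_def G2_def y_def[symmetric] y'_def[symmetric])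
      \<comment> \<open>The generator at \<open>(u, y')\<close> is subtracted and added; it is 0
        there, and the remaining differences are those of \<open>close_bound\<close>.\<close>
      also have "\<dots> = (fs s y - fs u y') + (fx s y - fx u y') * b y' + (fxx s y - fxx u y') * (1/2 * (\<sigma> y')\<^sup>2)
        + (fs u y' + b y' * fx u y' + 1/2 * (\<sigma> y')\<^sup>2 * fxx u y')" by (simp add: field_simps)
      finally have "\<bar>\<Psi> p\<bar> \<le> 3 * ?e" unfolding generator[OF u(1) yS(2)] using 1 by linarith
      also have "3 * ?e = B p" using True by (simp add: B_def y_def y'_def)
      finally show ?thesis .
    next
      case False
      then show ?thesis by (simp add: \<Psi>_def B_def)
    qed
  qed
  have "\<bar>\<integral>\<omega>. main \<omega> \<partial>M\<bar> \<le> (\<integral>p. \<bar>\<Psi> p\<bar> \<partial>time_product M T)"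
    unfolding main_eq by (rule integral_abs_bound)
  also have "\<dots> \<le> (\<integral>p. B p \<partial>time_product M T)"
    using \<Psi>_int B_int \<Psi>B by (intro integral_mono_AE) auto
  also have "\<dots> = 3 * \<eta> * h + 6 * C * (\<integral>p. indicat_real {s<..t} (snd p) * indicat_real {z. \<bar>z\<bar> > \<delta>} (X (snd p) (fst p) - X s (fst p)) \<partial>time_product M T)"
    unfolding B_def using b1 b2 integral_indicator_time_product[OF st(1) st'(1) st(3)] by (simp add: h_def)
  also have "\<dots> \<le> 3 * \<eta> * h + 6 * C * (h * (q / \<delta>\<^sup>2))"
    using integral_large_increment[OF st(1) st'(1) st(3) \<delta>] CC unfolding h_def q_def
    by (intro add_left_mono mult_left_mono) auto
  finally have "\<bar>\<integral>\<omega>. main \<omega> \<partial>M\<bar> \<le> 3 * \<eta> * h + 6 * C * (h * (q / \<delta>\<^sup>2))" .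
  with err Bd_le have "\<bar>expected t - expected s\<bar>
    \<le> 3 * \<eta> * h + 6 * C * (h * (q / \<delta>\<^sup>2)) + (h * (\<eta> + 2 * C * (q / \<delta>\<^sup>2)) + \<eta> * q + 8 * C * L + C * (\<eta> * h + h\<^sup>2 / \<eta> + h\<^sup>2))"
    by linarith
  \<comment> \<open>The coefficients combine freezing and Taylor errors: \<open>4 = 3 + 1\<close>
    and \<open>8 = 6 + 2\<close>.\<close>
  also have "\<dots> = 4 * h * \<eta> + 8 * C * h * (q / \<delta>\<^sup>2) + \<eta> * q + 8 * C * L + C * (\<eta> * h + h\<^sup>2 / \<eta> + h\<^sup>2)"
    by (simp add: algebra_simps)
  finally show ?thesis .
qed

text \<open>The increments are summed over \<open>N\<close> equal cells. First \<open>N\<close>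
  tends to infinity with \<open>\<eta>\<close> and \<open>\<delta>\<close> fixed, which removes all
  that carries a surplus factor of the mesh; then \<open>\<eta>\<close> is made small.\<close>

lemma expected_constant: "expected T = expected 0"
proof -
  \<comment> \<open>The coefficient of \<open>\<eta>\<close> in the limit: \<open>4 T\<close> and
    \<open>2 T\<close> from the freezing and Taylor errors, \<open>C T\<close> from Young's
    inequality, \<open>8 C\<close> from the Lindeberg sum, which is eventually below
    \<open>\<eta>\<close>.\<close>
  define K where "K = 6 * T + C * T + 8 * C"
  have K0: "0 \<le> K" using T C_nonneg by (simp add: K_def)
  have le: "\<bar>expected T - expected 0\<bar> \<le> K * \<eta>" if \<eta>: "0 < \<eta>" for \<eta>
  proof -
    obtain \<delta> where c: "close \<eta> \<delta>" using uniform[OF \<eta>] \<eta> unfolding close_def by blast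
    then have \<delta>: "0 < \<delta>" by (simp add: close_def)
    define h where "h N = T * inverse (real N)" for N
    define q where "q N = 2 * h N + 2 * (h N)\<^sup>2" for N
    define \<Delta> where "\<Delta> N i \<omega> = I (T * real (Suc i) / real N) \<omega> - I (T * real i / real N) \<omega>" for N i \<omega>
    define L where "L N i = (\<integral>\<omega>. (\<Delta> N i \<omega>)\<^sup>2 * indicat_real {z. \<bar>z\<bar> > \<delta> / 2} (\<Delta> N i \<omega>) \<partial>M)" for N i
    define e where "e N = 4 * T * \<eta> + 8 * C * T * (q N / \<delta>\<^sup>2) + \<eta> * (2 * T + 2 * T * h N) + 8 * C * \<eta>
      + C * (\<eta> * T + T * h N / \<eta> + T * h N)" for N
    have h0: "h \<longlonglongrightarrow> 0" unfolding h_def[abs_def] using tendsto_mult[OF tendsto_const lim_inverse_n, of T] by simp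
    have "\<forall>\<^sub>F N in sequentially. (\<Sum>i<N. L N i) < \<eta>"
      unfolding L_def \<Delta>_def using ito_lindeberg[OF ito T _ \<eta>, of "\<delta> / 2"] \<delta> by simp
    moreover have "\<forall>\<^sub>F N in sequentially. h N < \<delta> / 2" by (rule order_tendstoD(2)[OF h0]) (use \<delta> in simp)
    ultimately have "\<forall>\<^sub>F N in sequentially. \<bar>expected T - expected 0\<bar> \<le> e N"
      using eventually_gt_at_top[of 0]
    proof eventually_elim
      case (elim N)
      define s where "s i = T * real i / real N" for i
      have hN: "real N * h N = T" using elim(3) by (simp add: h_def)
      have s: "0 \<le> s i" "s i < s (Suc i)" "s (Suc i) - s i = h N" for i
        using T elim(3) by (auto simp: s_def h_def field_simps)
      have sT: "s (Suc i) \<le> T" if "i < N" for i using that T elim(3) by (simp add: s_def pos_divide_le_eq)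
      have "expected T - expected 0 = expected (s N) - expected (s 0)" using elim(3) by (simp add: s_def)
      also have "\<dots> = (\<Sum>i<N. expected (s (Suc i)) - expected (s i))"
        by (rule sum_lessThan_telescope[symmetric])
      also have "\<bar>\<dots>\<bar> \<le> (\<Sum>i<N. \<bar>expected (s (Suc i)) - expected (s i)\<bar>)" by (rule sum_abs)
      also have "\<dots> \<le> (\<Sum>i<N. 4 * h N * \<eta> + 8 * C * h N * (q N / \<delta>\<^sup>2) + \<eta> * q N + 8 * C * L N i
        + C * (\<eta> * h N + (h N)\<^sup>2 / \<eta> + (h N)\<^sup>2))"
      proof (rule sum_mono)
        fix i assume "i \<in> {..<N}"
        then have i: "s (Suc i) \<le> T" using sT by simp
        have lt: "s (Suc i) - s i \<le> \<delta> / 2" using elim(2) by (simp only: s(3))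
        have Li: "L N i = (\<integral>\<omega>. (I (s (Suc i)) \<omega> - I (s i) \<omega>)\<^sup>2 *
            indicat_real {z. \<bar>z\<bar> > \<delta> / 2} (I (s (Suc i)) \<omega> - I (s i) \<omega>) \<partial>M)"
          by (simp only: L_def \<Delta>_def s_def)
        show "\<bar>expected (s (Suc i)) - expected (s i)\<bar> \<le> 4 * h N * \<eta> + 8 * C * h N * (q N / \<delta>\<^sup>2) + \<eta> * q N + 8 * C * L N i
          + C * (\<eta> * h N + (h N)\<^sup>2 / \<eta> + (h N)\<^sup>2)"
          using expected_increment[OF c s(1) s(2) i lt] unfolding s(3) q_def Li .
      qed
      also have "\<dots> = real N * (4 * h N * \<eta> + 8 * C * h N * (q N / \<delta>\<^sup>2) + \<eta> * q N
        + C * (\<eta> * h N + (h N)\<^sup>2 / \<eta> + (h N)\<^sup>2)) + 8 * C * (\<Sum>i<N. L N i)"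
        by (simp add: sum.distrib sum_distrib_left[symmetric] distrib_left)
      also have "\<dots> = 4 * (real N * h N) * \<eta> + 8 * C * (real N * h N) * (q N / \<delta>\<^sup>2)
        + \<eta> * (2 * (real N * h N) + 2 * (real N * h N) * h N) + 8 * C * (\<Sum>i<N. L N i)
        + C * (\<eta> * (real N * h N) + (real N * h N) * h N / \<eta> + (real N * h N) * h N)"
        by (simp add: q_def[of N] power2_eq_square algebra_simps)
      also have "\<dots> \<le> e N"
        unfolding hN e_def using elim(1) C_nonneg by (intro add_mono mult_left_mono order.refl) auto
      finally show ?case .
    qed
    moreover have "e \<longlonglongrightarrow> 4 * T * \<eta> + 8 * C * T * ((2 * 0 + 2 * 0\<^sup>2) / \<delta>\<^sup>2) + \<eta> * (2 * T + 2 * T * 0) + 8 * C * \<eta>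
      + C * (\<eta> * T + T * 0 / \<eta> + T * 0)"
      unfolding e_def[abs_def] q_def using \<eta> \<delta> by (intro tendsto_intros h0) auto
    ultimately have "\<bar>expected T - expected 0\<bar> \<le> 4 * T * \<eta> + 8 * C * T * ((2 * 0 + 2 * 0\<^sup>2) / \<delta>\<^sup>2) + \<eta> * (2 * T + 2 * T * 0) + 8 * C * \<eta>
      + C * (\<eta> * T + T * 0 / \<eta> + T * 0)"
      by (intro tendsto_lowerbound[of e _ sequentially]) auto
    then show ?thesis by (simp add: K_def algebra_simps)
  qed
  show ?thesis
  proof (rule ccontr)
    assume "expected T \<noteq> expected 0"
    then have d: "0 < \<bar>expected T - expected 0\<bar>" by simp
    \<comment> \<open>With this \<open>\<eta>\<close> the bound \<open>K \<eta>\<close> is at most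
      half of the difference; the summand 1 covers \<open>K = 0\<close>.\<close>
    define \<eta> where "\<eta> = \<bar>expected T - expected 0\<bar> / (2 * (K + 1))"
    have "0 < \<eta>" using d K0 by (simp add: \<eta>_def)
    from le[OF this] have "\<bar>expected T - expected 0\<bar> \<le> K * \<eta>" .
    also have "\<dots> \<le> (K + 1) * \<eta>" using \<open>0 < \<eta>\<close> by (simp add: distrib_right)
    also have "\<dots> = \<bar>expected T - expected 0\<bar> / 2" using K0 by (simp add: \<eta>_def field_simps)
    finally show False using d by simp
  qed
qed

end

section \<open>Confinement to the unit interval\<close>

definition uniformly_close :: "real \<Rightarrow> real set \<Rightarrow> (real \<Rightarrow> real \<Rightarrow> real) \<Rightarrow> bool" where
  "uniformly_close T S \<phi> \<longleftrightarrow> (\<forall>\<eta>>0. \<exists>\<delta>>0. \<forall>s\<in>{0..T}. \<forall>s'\<in>{0..T}. \<forall>y\<in>S. \<forall>y'\<in>S.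
      \<bar>s - s'\<bar> \<le> \<delta> \<longrightarrow> \<bar>y - y'\<bar> \<le> \<delta> \<longrightarrow> \<bar>\<phi> s y - \<phi> s' y'\<bar> \<le> \<eta>)"

lemma uniformly_close_conj:
  assumes "uniformly_close T S f" "uniformly_close T S g" "uniformly_close T S h" "0 < \<eta>"
  shows "\<exists>\<delta>>0. \<forall>s\<in>{0..T}. \<forall>s'\<in>{0..T}. \<forall>y\<in>S. \<forall>y'\<in>S.
      \<bar>s - s'\<bar> \<le> \<delta> \<longrightarrow> \<bar>y - y'\<bar> \<le> \<delta> \<longrightarrow>
      \<bar>f s y - f s' y'\<bar> \<le> \<eta> \<and> \<bar>g s y - g s' y'\<bar> \<le> \<eta> \<and> \<bar>h s y - h s' y'\<bar> \<le> \<eta>"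
proof -
  have *: "\<exists>\<delta>>0. \<forall>s\<in>{0..T}. \<forall>s'\<in>{0..T}. \<forall>y\<in>S. \<forall>y'\<in>S.
      \<bar>s - s'\<bar> \<le> \<delta> \<longrightarrow> \<bar>y - y'\<bar> \<le> \<delta> \<longrightarrow> \<bar>\<phi> s y - \<phi> s' y'\<bar> \<le> \<eta>" if "uniformly_close T S \<phi>" for \<phi>
    using that \<open>0 < \<eta>\<close> by (simp add: uniformly_close_def)
  obtain d1 where d1: "d1 > 0" "\<forall>s\<in>{0..T}. \<forall>s'\<in>{0..T}. \<forall>y\<in>S. \<forall>y'\<in>S.
      \<bar>s - s'\<bar> \<le> d1 \<longrightarrow> \<bar>y - y'\<bar> \<le> d1 \<longrightarrow> \<bar>f s y - f s' y'\<bar> \<le> \<eta>" using *[OF assms(1)] by blast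
  obtain d2 where d2: "d2 > 0" "\<forall>s\<in>{0..T}. \<forall>s'\<in>{0..T}. \<forall>y\<in>S. \<forall>y'\<in>S.
      \<bar>s - s'\<bar> \<le> d2 \<longrightarrow> \<bar>y - y'\<bar> \<le> d2 \<longrightarrow> \<bar>g s y - g s' y'\<bar> \<le> \<eta>" using *[OF assms(2)] by blast
  obtain d3 where d3: "d3 > 0" "\<forall>s\<in>{0..T}. \<forall>s'\<in>{0..T}. \<forall>y\<in>S. \<forall>y'\<in>S.
      \<bar>s - s'\<bar> \<le> d3 \<longrightarrow> \<bar>y - y'\<bar> \<le> d3 \<longrightarrow> \<bar>h s y - h s' y'\<bar> \<le> \<eta>" using *[OF assms(3)] by blast
  show ?thesis
  proof (intro exI[of _ "min d1 (min d2 d3)"] conjI ballI impI)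
    fix s s' y y' assume a: "s \<in> {0..T}" "s' \<in> {0..T}" "y \<in> S" "y' \<in> S"
      "\<bar>s - s'\<bar> \<le> min d1 (min d2 d3)" "\<bar>y - y'\<bar> \<le> min d1 (min d2 d3)"
    have "\<bar>s - s'\<bar> \<le> d1" "\<bar>y - y'\<bar> \<le> d1" "\<bar>s - s'\<bar> \<le> d2" "\<bar>y - y'\<bar> \<le> d2" "\<bar>s - s'\<bar> \<le> d3" "\<bar>y - y'\<bar> \<le> d3"
      using a(5,6) by auto
    then show "\<bar>f s y - f s' y'\<bar> \<le> \<eta>" "\<bar>g s y - g s' y'\<bar> \<le> \<eta>" "\<bar>h s y - h s' y'\<bar> \<le> \<eta>"
      using d1(2) d2(2) d3(2) a(1-4) by blast+
  qed (use d1(1) d2(1) d3(1) in auto)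
qed

lemma compact_real_bound:
  fixes g :: "'b::topological_space \<Rightarrow> real"
  assumes "compact K" "continuous_on K g"
  obtains C where "0 \<le> C" "\<And>p. p \<in> K \<Longrightarrow> \<bar>g p\<bar> \<le> C"
proof -
  have "bounded (g ` K)" using assms by (intro compact_imp_bounded compact_continuous_image)
  then obtain C where "\<forall>p\<in>K. \<bar>g p\<bar> \<le> C" by (auto simp: bounded_iff)
  then have "\<bar>g p\<bar> \<le> max 0 C" if "p \<in> K" for p using that by (auto simp: le_max_iff_disj)
  with that[of "max 0 C"] show ?thesis by simp
qed

text \<open>The cube of \<open>ramp\<close> is bounded and positive exactly on \<open>{0<..}\<close>, and its first two derivatives are
  bounded, uniformly continuous and zero on \<open>{..0}\<close>.\<close>

definition ramp :: "real \<Rightarrow> real" where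
  "ramp z = 1 - 1 / (1 + max 0 z)"

lemma ramp_le0: "z \<le> 0 \<Longrightarrow> ramp z = 0" by (simp add: ramp_def)

lemma ramp_pos: "0 < z \<Longrightarrow> 0 < ramp z" by (simp add: ramp_def)

lemma ramp_unit: "ramp z \<in> {0..1}" by (auto simp: ramp_def)

lemma ramp_lipschitz: "\<bar>ramp z - ramp z'\<bar> \<le> \<bar>z - z'\<bar>"
proof -
  let ?p = "1 + max 0 z" and ?q = "1 + max 0 z'"
  have "ramp z - ramp z' = (?p - ?q) / (?p * ?q)"
    by (simp add: ramp_def divide_simps add_pos_nonneg add_nonneg_eq_0_iff) (simp add: algebra_simps max_def)
  moreover have "1 \<le> ?p * ?q" using mult_mono[of 1 ?p 1 ?q] by simp
  ultimately have "\<bar>ramp z - ramp z'\<bar> = \<bar>?p - ?q\<bar> / (?p * ?q)" by (simp add: abs_div)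
  also have "\<dots> \<le> \<bar>?p - ?q\<bar> / 1" using \<open>1 \<le> ?p * ?q\<close> by (intro divide_left_mono) auto
  also have "\<dots> \<le> \<bar>z - z'\<bar>" by (auto simp: max_def)
  finally show ?thesis .
qed

text \<open>\<open>ramp\<close> has a corner at 0, but a function of quadratic order there smooths
  it. To the right of 0 the derivative of \<open>ramp\<close> is \<open>1 / (1 + z)^2\<close>, which
  equals \<open>(1 - ramp z)^2\<close>; to the left the condition \<open>G' 0 = 0\<close> makes the
  same formula correct.\<close>

lemma DERIV_ramp_compose:
  assumes G: "\<And>y. (G has_real_derivative G' y) (at y)" and K: "\<And>y. y \<in> {0..1} \<Longrightarrow> \<bar>G y\<bar> \<le> K * y\<^sup>2"
    and G0: "G' 0 = 0"
  shows "((\<lambda>z. G (ramp z)) has_real_derivative G' (ramp z) * (1 - ramp z)\<^sup>2) (at z)"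
proof -
  have Gz: "G 0 = 0" using K[of 0] by simp
  consider "z < 0" | "z = 0" | "0 < z" by linarith
  then show ?thesis
  proof cases
    case 1
    have "((\<lambda>_. 0) has_real_derivative G' (ramp z) * (1 - ramp z)\<^sup>2) (at z)"
      using 1 by (simp add: ramp_le0 G0)
    then show ?thesis
      by (rule has_field_derivative_transform_within_open[of _ _ _ "{..<0}"]) (use 1 in \<open>auto simp: ramp_le0 Gz\<close>)
  next
    case 2
    have "\<bar>G (ramp h) / h\<bar> \<le> \<bar>K\<bar> * \<bar>h\<bar>" for h
    proof (cases "h = 0")
      case False
      have "\<bar>ramp h\<bar> \<le> \<bar>h\<bar>" using ramp_lipschitz[of h 0] by (simp add: ramp_le0)
      then have "(ramp h)\<^sup>2 \<le> h\<^sup>2" by (simp only: abs_le_square_iff)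
      have "\<bar>G (ramp h)\<bar> \<le> K * (ramp h)\<^sup>2" by (rule K[OF ramp_unit])
      also have "\<dots> \<le> \<bar>K\<bar> * h\<^sup>2" using \<open>(ramp h)\<^sup>2 \<le> h\<^sup>2\<close> by (intro mult_mono) auto
      finally have "\<bar>G (ramp h)\<bar> \<le> \<bar>K\<bar> * \<bar>h\<bar> * \<bar>h\<bar>" by (simp add: power2_eq_square)
      then show ?thesis using False by (simp add: pos_divide_le_eq)
    qed simp
    then have "\<forall>\<^sub>F h in at 0. norm (G (ramp h) / h) \<le> \<bar>K\<bar> * \<bar>h\<bar>" by (intro always_eventually) simp
    moreover have "((\<lambda>h::real. \<bar>K\<bar> * \<bar>h\<bar>) \<longlongrightarrow> 0) (at 0)" by (auto intro!: tendsto_eq_intros)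
    ultimately have "((\<lambda>h. G (ramp h) / h) \<longlongrightarrow> 0) (at 0)" by (rule Lim_null_comparison)
    then show ?thesis using 2 by (simp add: DERIV_def ramp_le0 Gz G0)
  next
    case 3
    have "((\<lambda>z. 1 - 1 / (1 + z)) has_real_derivative (1 / (1 + z))\<^sup>2) (at z)"
      using 3 by (auto intro!: derivative_eq_intros simp: power2_eq_square)
    then have "(ramp has_real_derivative (1 / (1 + z))\<^sup>2) (at z)"
      by (rule has_field_derivative_transform_within_open[of _ _ _ "{0<..}"]) (use 3 in \<open>auto simp: ramp_def\<close>)
    from DERIV_chain2[OF G this] show ?thesis using 3 by (simp add: ramp_def)
  qed
qed

text \<open>The first two derivatives of the cube of \<open>ramp\<close>, as polynomials in the
  value of \<open>ramp\<close>. The cube is chosen because its first derivative is still of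
  quadratic order at 0, so that \<open>DERIV_ramp_compose\<close> applies twice; for the square it
  would be of linear order only.\<close>

definition cube1 :: "real \<Rightarrow> real" where "cube1 y = 3 * y\<^sup>2 * (1 - y)\<^sup>2"
definition cube2 :: "real \<Rightarrow> real" where "cube2 y = (6 * y * (1 - y)\<^sup>2 - 6 * y\<^sup>2 * (1 - y)) * (1 - y)\<^sup>2"

lemma DERIV_ramp_cube:
  "((\<lambda>z. (ramp z) ^ 3) has_real_derivative cube1 (ramp z)) (at z)"
  "((\<lambda>z. cube1 (ramp z)) has_real_derivative cube2 (ramp z)) (at z)"
proof -
  have "((\<lambda>z. (ramp z) ^ 3) has_real_derivative 3 * (ramp z)\<^sup>2 * (1 - ramp z)\<^sup>2) (at z)"
  proof (rule DERIV_ramp_compose[where K=1 and G'="\<lambda>y. 3 * y\<^sup>2"])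
    show "\<bar>y ^ 3\<bar> \<le> 1 * y\<^sup>2" if "y \<in> {0..1}" for y :: real
      using that by (simp add: power3_eq_cube power2_eq_square mult_left_le)
  qed (auto intro!: derivative_eq_intros)
  then show "((\<lambda>z. (ramp z) ^ 3) has_real_derivative cube1 (ramp z)) (at z)" by (simp add: cube1_def)
  have "((\<lambda>z. cube1 (ramp z)) has_real_derivative
    (6 * ramp z * (1 - ramp z)\<^sup>2 - 6 * (ramp z)\<^sup>2 * (1 - ramp z)) * (1 - ramp z)\<^sup>2) (at z)"
  proof (rule DERIV_ramp_compose[where K=3 and G'="\<lambda>y. 6 * y * (1 - y)\<^sup>2 - 6 * y\<^sup>2 * (1 - y)"])
    show "\<bar>cube1 y\<bar> \<le> 3 * y\<^sup>2" if "y \<in> {0..1}" for y :: real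
    proof -
      have "(1 - y)\<^sup>2 \<le> 1" using that by (simp add: abs_square_le_1)
      then have "3 * y\<^sup>2 * (1 - y)\<^sup>2 \<le> 3 * y\<^sup>2 * 1" by (intro mult_left_mono) auto
      then show ?thesis by (simp add: cube1_def)
    qed
    show "(cube1 has_real_derivative 6 * y * (1 - y)\<^sup>2 - 6 * y\<^sup>2 * (1 - y)) (at y)" for y
      unfolding cube1_def[abs_def] by (auto intro!: derivative_eq_intros simp: power2_eq_square algebra_simps)
  qed simp
  then show "((\<lambda>z. cube1 (ramp z)) has_real_derivative cube2 (ramp z)) (at z)" by (simp add: cube2_def)
qed

text \<open>\<open>P\<close> is uniformly continuous on the compact interval where
  \<open>ramp\<close> takes its values, and \<open>ramp\<close> is 1-Lipschitz, so uniformity holds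
  on the whole line.\<close>

lemma uniformly_close_ramp:
  assumes P: "continuous_on {0..1} P" and k: "\<bar>k\<bar> = 1"
  shows "uniformly_close T UNIV (\<lambda>_ y. P (ramp (k * (y - c))))"
  unfolding uniformly_close_def
proof (intro allI impI)
  fix \<eta> :: real assume "0 < \<eta>"
  moreover have "uniformly_continuous_on {0..1} P" by (rule compact_uniformly_continuous[OF P]) simp
  ultimately obtain d where d: "d > 0" "\<And>q q'. q \<in> {0..1} \<Longrightarrow> q' \<in> {0..1} \<Longrightarrow> \<bar>q' - q\<bar> < d \<Longrightarrow> \<bar>P q' - P q\<bar> < \<eta>"
    unfolding uniformly_continuous_on_def dist_real_def by metis
  show "\<exists>\<delta>>0. \<forall>s\<in>{0..T}. \<forall>s'\<in>{0..T}. \<forall>y\<in>UNIV. \<forall>y'\<in>UNIV. \<bar>s - s'\<bar> \<le> \<delta> \<longrightarrow> \<bar>y - y'\<bar> \<le> \<delta> \<longrightarrow>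
    \<bar>P (ramp (k * (y - c))) - P (ramp (k * (y' - c)))\<bar> \<le> \<eta>"
  proof (intro exI[of _ "d / 2"] conjI ballI impI)
    fix y y' :: real assume "\<bar>y - y'\<bar> \<le> d / 2"
    moreover have "\<bar>k * (y - c) - k * (y' - c)\<bar> = \<bar>y - y'\<bar>"
      using k by (simp add: right_diff_distrib[symmetric] abs_mult)
    ultimately have "\<bar>ramp (k * (y - c)) - ramp (k * (y' - c))\<bar> < d"
      using ramp_lipschitz[of "k * (y - c)" "k * (y' - c)"] d(1) by linarith
    from d(2)[OF ramp_unit ramp_unit this] show "\<bar>P (ramp (k * (y - c))) - P (ramp (k * (y' - c)))\<bar> \<le> \<eta>" by simp
  qed (use d(1) in auto)
qed

context bounded_ito_process
begin

text \<open>\<open>k = 1\<close> bounds the process from above, \<open>k = -1\<close> from below.\<close>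

lemma confined_halfline:
  assumes k: "\<bar>k\<bar> = 1" and start: "AE \<omega> in M. X 0 \<omega> = x" "k * (x - c) \<le> 0"
    and vanish: "\<And>y. 0 < k * (y - c) \<Longrightarrow> \<sigma> y = 0 \<and> b y = 0" and t: "0 < t"
  shows "AE \<omega> in M. k * (X t \<omega> - c) \<le> 0"
proof -
  have cont: "continuous_on {0..1} (\<lambda>q::real. q ^ 3)" "continuous_on {0..1} cube1" "continuous_on {0..1} cube2"
    unfolding cube1_def[abs_def] cube2_def[abs_def] by (auto intro!: continuous_intros)
  obtain C0 where C0: "0 \<le> C0" "\<And>q. q \<in> {0..1} \<Longrightarrow> \<bar>q ^ 3\<bar> \<le> (C0::real)"
    using compact_real_bound[OF _ cont(1)] by auto
  obtain C1 where C1: "0 \<le> C1" "\<And>q. q \<in> {0..1} \<Longrightarrow> \<bar>cube1 q\<bar> \<le> C1"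
    using compact_real_bound[OF _ cont(2)] by auto
  obtain C2 where C2: "0 \<le> C2" "\<And>q. q \<in> {0..1} \<Longrightarrow> \<bar>cube2 q\<bar> \<le> C2"
    using compact_real_bound[OF _ cont(3)] by auto
  define f where "f = (\<lambda>(s::real) y. ramp (k * (y - c)) ^ 3)"
  define fx where "fx = (\<lambda>(s::real) y. k * cube1 (ramp (k * (y - c))))"
  define fxx where "fxx = (\<lambda>(s::real) y. cube2 (ramp (k * (y - c))))"
  have kk: "k * k = 1" using k by (metis abs_mult_self_eq mult_1)
  interpret G: generator_annihilated M F W X I \<sigma> b x t UNIV f "\<lambda>_ _. 0" fx fxx "C0 + C1 + C2"
  proof unfold_locales
    have lin: "((\<lambda>y. k * (y - c)) has_real_derivative k) (at y)" for y by (auto intro!: derivative_eq_intros)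
    show "(f s has_real_derivative fx s y) (at y)" for s y
      unfolding f_def fx_def using DERIV_chain2[OF DERIV_ramp_cube(1) lin] by (simp add: mult.commute)
    show "(fx s has_real_derivative fxx s y) (at y)" for s y
    proof -
      have "((\<lambda>y. k * cube1 (ramp (k * (y - c)))) has_real_derivative k * (cube2 (ramp (k * (y - c))) * k)) (at y)"
        by (rule DERIV_cmult[OF DERIV_chain2[OF DERIV_ramp_cube(2) lin]])
      moreover have "k * (q * k) = q" for q using kk by (metis mult.assoc mult.commute mult_1)
      ultimately show ?thesis unfolding fx_def fxx_def by simp
    qed
    show "\<bar>f s y\<bar> \<le> C0 + C1 + C2 \<and> \<bar>0::real\<bar> \<le> C0 + C1 + C2 \<and> \<bar>fx s y\<bar> \<le> C0 + C1 + C2 \<and> \<bar>fxx s y\<bar> \<le> C0 + C1 + C2" for s y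
      using C0(2)[OF ramp_unit[of "k * (y - c)"]] C1(2)[OF ramp_unit[of "k * (y - c)"]]
        C2(2)[OF ramp_unit[of "k * (y - c)"]] C0(1) C1(1) C2(1) k
      by (auto simp: f_def fx_def fxx_def abs_mult)
    have "uniformly_close t UNIV (\<lambda>_ _. 0)" by (auto simp: uniformly_close_def intro: exI[of _ 1])
    moreover have "uniformly_close t UNIV fx"
      unfolding fx_def by (rule uniformly_close_ramp[of "\<lambda>q. k * cube1 q", OF _ k]) (intro continuous_intros cont)
    moreover have "uniformly_close t UNIV fxx"
      unfolding fxx_def by (rule uniformly_close_ramp[OF cont(3) k])
    ultimately show "\<exists>\<delta>>0. \<forall>s\<in>{0..t}. \<forall>s'\<in>{0..t}. \<forall>y\<in>UNIV. \<forall>y'\<in>UNIV.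
      \<bar>s - s'\<bar> \<le> \<delta> \<longrightarrow> \<bar>y - y'\<bar> \<le> \<delta> \<longrightarrow>
      \<bar>(0::real) - 0\<bar> \<le> \<eta> \<and> \<bar>fx s y - fx s' y'\<bar> \<le> \<eta> \<and> \<bar>fxx s y - fxx s' y'\<bar> \<le> \<eta>" if "0 < \<eta>" for \<eta>
      by (rule uniformly_close_conj[OF _ _ _ that])
    \<comment> \<open>Where \<open>k * (y - c) > 0\<close> both coefficients vanish; elsewhere both
      derivatives of the test function do.\<close>
    show "0 + b y * fx s y + 1/2 * (\<sigma> y)\<^sup>2 * fxx s y = 0" for s y
      using vanish[of y] by (cases "0 < k * (y - c)") (auto simp: fx_def fxx_def ramp_le0 cube1_def cube2_def)
  qed (use t C0(1) C1(1) C2(1) in \<open>auto simp: f_def\<close>)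
  have "G.expected 0 = (\<integral>\<omega>. 0 \<partial>M)"
    unfolding G.expected_def
  proof (rule integral_cong_AE)
    have "(\<lambda>\<omega>. indicat_real UNIV (X 0 \<omega>) * f 0 (X 0 \<omega>)) \<in> borel_measurable M"
      by (rule measurable_compose[OF X_measurable G.measurable_indicator_mult(1)]) (use t in auto)
    then show "(\<lambda>\<omega>. indicat_real UNIV (X 0 \<omega>) * f 0 (X 0 \<omega>)) \<in> borel_measurable M" .
    show "AE \<omega> in M. indicat_real UNIV (X 0 \<omega>) * f 0 (X 0 \<omega>) = 0"
      using start(1) by eventually_elim (use start(2) in \<open>simp add: f_def ramp_le0\<close>)
  qed simp
  then have zero: "(\<integral>\<omega>. f t (X t \<omega>) \<partial>M) = 0"
    using G.expected_constant by (simp add: G.expected_def)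
  have m: "(\<lambda>\<omega>. f t (X t \<omega>)) \<in> borel_measurable M"
    using measurable_compose[OF X_measurable G.measurable_indicator_mult(1)[of t]] t by simp
  have nonneg: "0 \<le> f t y" for y using ramp_unit[of "k * (y - c)"] by (simp add: f_def)
  have "integrable M (\<lambda>\<omega>. f t (X t \<omega>))"
    by (rule integrable_const_bound[where B="C0 + C1 + C2", OF AE_I2 m]) (use G.bound[of t] t in auto)
  \<comment> \<open>A nonnegative function with mean 0 vanishes almost surely, and \<open>f\<close>
    is positive exactly beyond \<open>c\<close>.\<close>
  then have "AE \<omega> in M. f t (X t \<omega>) = 0"
    using zero nonneg by (subst integral_nonneg_eq_0_iff_AE[symmetric]) auto
  then show ?thesis
  proof eventually_elim
    case (elim \<omega>)
    then show ?case using ramp_pos[of "k * (X t \<omega> - c)"] by (force simp: f_def not_le[symmetric])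
  qed
qed

text \<open>The exceptional null set may depend on \<open>t\<close>. It is made common to the
  countably many rational times, and continuity of the paths with closedness of \<open>S\<close>
  extends the conclusion to all times.\<close>

lemma AE_all_times_in_closed:
  assumes S: "closed S" and AE: "\<And>t. 0 \<le> t \<Longrightarrow> AE \<omega> in M. X t \<omega> \<in> S"
  shows "AE \<omega> in M. \<forall>t\<ge>0. X t \<omega> \<in> S"
proof -
  have "AE \<omega> in M. \<forall>i j. X (real i / real (Suc j)) \<omega> \<in> S"
    by (intro AE_all_countable[THEN iffD2] allI AE) simp
  with AE_space show ?thesis
  proof eventually_elim
    case (elim \<omega>)
    show ?case
    proof (intro allI impI)
      fix t :: real assume t: "0 \<le> t"
      have "(\<lambda>n. X (real (nat \<lfloor>real (Suc n) * t\<rfloor>) / real (Suc n)) \<omega>) \<longlonglongrightarrow> X t \<omega>"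
        using adapted elim(1) t
        by (intro continuous_on_tendsto_compose[where s="{0..}" and f="\<lambda>t. X t \<omega>", OF _ floor_approximation_tendsto[OF t]])
          (auto simp: continuous_adapted_def)
      then show "X t \<omega> \<in> S"
        by (rule closed_sequentially[OF S, rotated]) (use elim(2) in blast)
    qed
  qed
qed

end

section \<open>The Feynman-Kac representation\<close>

lemma C21_derivatives:
  assumes u: "C21 u" and y: "y \<in> {0..1}" and s: "0 < s"
  shows "((\<lambda>x. u x s) has_real_derivative d_r u y s) (at y within {0..1})"
    "((\<lambda>x. d_r u x s) has_real_derivative d_r (d_r u) y s) (at y within {0..1})"
    "((\<lambda>s. u y s) has_real_derivative d_t u y s) (at s)"
proof -
  have d: "(\<lambda>x. u x s) differentiable (at y within {0..1})" "(\<lambda>x. d_r u x s) differentiable (at y within {0..1})"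
    "(\<lambda>s. u y s) differentiable (at s)"
    using u y s by (auto simp: C21_def)
  show "((\<lambda>x. u x s) has_real_derivative d_r u y s) (at y within {0..1})"
    using d(1) by (simp add: has_real_derivative_iff_has_vector_derivative vector_derivative_works d_r_def)
  show "((\<lambda>x. d_r u x s) has_real_derivative d_r (d_r u) y s) (at y within {0..1})"
    using d(2) by (simp add: has_real_derivative_iff_has_vector_derivative vector_derivative_works d_r_def[of "d_r u"])
  show "((\<lambda>s. u y s) has_real_derivative d_t u y s) (at s)"
    using d(3) by (simp add: d_t_def DERIV_deriv_iff_real_differentiable)
qed

text \<open>As \<open>s\<close> runs through \<open>{0..T}\<close>, the time argument stays in
  \<open>{\<epsilon>..T + \<epsilon>}\<close>, a compact interval away from 0, on which joint
  continuity becomes uniform.\<close>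

lemma uniformly_close_shift:
  assumes \<phi>: "continuous_on ({0..1} \<times> {0<..}) (\<lambda>(r, t). \<phi> r t)" and \<epsilon>: "0 < \<epsilon>"
  shows "uniformly_close T {0..1} (\<lambda>s y. \<phi> y (T + \<epsilon> - s))"
  unfolding uniformly_close_def
proof (intro allI impI)
  fix \<eta> :: real assume "0 < \<eta>"
  let ?K = "{0..1} \<times> {\<epsilon>..T + \<epsilon>}"
  have "uniformly_continuous_on ?K (\<lambda>(r, t). \<phi> r t)"
    by (intro compact_uniformly_continuous continuous_on_subset[OF \<phi>] compact_Times) (use \<epsilon> in force)+
  with \<open>0 < \<eta>\<close> obtain d where d: "d > 0"
    "\<And>p p'. p \<in> ?K \<Longrightarrow> p' \<in> ?K \<Longrightarrow> dist p' p < d \<Longrightarrow> dist (case p' of (r, t) \<Rightarrow> \<phi> r t) (case p of (r, t) \<Rightarrow> \<phi> r t) < \<eta>"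
    unfolding uniformly_continuous_on_def by metis
  show "\<exists>\<delta>>0. \<forall>s\<in>{0..T}. \<forall>s'\<in>{0..T}. \<forall>y\<in>{0..1}. \<forall>y'\<in>{0..1}. \<bar>s - s'\<bar> \<le> \<delta> \<longrightarrow> \<bar>y - y'\<bar> \<le> \<delta> \<longrightarrow>
    \<bar>\<phi> y (T + \<epsilon> - s) - \<phi> y' (T + \<epsilon> - s')\<bar> \<le> \<eta>"
  \<comment> \<open>The distance in the plane is at most the sum of the coordinate differences, here
    \<open>2 d / 3\<close>, hence strictly below \<open>d\<close>.\<close>
  proof (intro exI[of _ "d / 3"] conjI ballI impI)
    fix s s' y y' :: real
    assume a: "s \<in> {0..T}" "s' \<in> {0..T}" "y \<in> {0..1}" "y' \<in> {0..1}" "\<bar>s - s'\<bar> \<le> d / 3" "\<bar>y - y'\<bar> \<le> d / 3"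
    have "dist (y, T + \<epsilon> - s) (y', T + \<epsilon> - s') \<le> \<bar>y - y'\<bar> + \<bar>s - s'\<bar>"
      using sqrt_sum_squares_le_sum_abs[of "y - y'" "(T + \<epsilon> - s) - (T + \<epsilon> - s')"]
      by (simp add: dist_prod_def dist_real_def abs_minus_commute power2_commute[of y])
    also have "\<dots> < d" using a(5,6) d(1) by linarith
    finally have "dist (y, T + \<epsilon> - s) (y', T + \<epsilon> - s') < d" .
    from d(2)[OF _ _ this] a(1-4)
    show "\<bar>\<phi> y (T + \<epsilon> - s) - \<phi> y' (T + \<epsilon> - s')\<bar> \<le> \<eta>" by (simp add: dist_real_def)
  qed (use d(1) in auto)
qed

lemma C21_continuous:
  assumes "C21 u"
  shows "continuous_on ({0..1} \<times> {0<..}) (\<lambda>(r, t). u r t)"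
    "continuous_on ({0..1} \<times> {0<..}) (\<lambda>(r, t). d_r u r t)"
    "continuous_on ({0..1} \<times> {0<..}) (\<lambda>(r, t). d_r (d_r u) r t)"
    "continuous_on ({0..1} \<times> {0<..}) (\<lambda>(r, t). d_t u r t)"
  using assms by (auto simp: C21_def)

lemma shift_bound:
  fixes \<phi> :: "real \<Rightarrow> real \<Rightarrow> real"
  assumes \<phi>: "continuous_on ({0..1} \<times> {0<..}) (\<lambda>(r, t). \<phi> r t)" and \<epsilon>: "0 < \<epsilon>"
  obtains C :: real where "0 \<le> C" "\<And>s y. s \<in> {0..T} \<Longrightarrow> y \<in> {0..1} \<Longrightarrow> \<bar>\<phi> y (T + \<epsilon> - s)\<bar> \<le> C"
proof -
  have "continuous_on ({0..1} \<times> {\<epsilon>..T + \<epsilon>}) (\<lambda>(r, t). \<phi> r t)"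
    by (rule continuous_on_subset[OF \<phi>]) (use \<epsilon> in force)
  then obtain C where "0 \<le> C" and C: "\<And>p. p \<in> {0..1} \<times> {\<epsilon>..T + \<epsilon>} \<Longrightarrow> \<bar>case p of (r, t) \<Rightarrow> \<phi> r t\<bar> \<le> C"
    by (rule compact_real_bound[rotated]) (auto intro: compact_Times)
  moreover have "\<bar>\<phi> y (T + \<epsilon> - s)\<bar> \<le> C" if "s \<in> {0..T}" "y \<in> {0..1}" for s y
    using C[of "(y, T + \<epsilon> - s)"] that by auto
  ultimately show ?thesis using that by blast
qed

theorem theorem3p4:
  fixes u0 :: "real \<Rightarrow> real" and v0m v0p :: real
    and u :: "real \<Rightarrow> real \<Rightarrow> real"
    and M :: "'a measure" and F :: "real \<Rightarrow> 'a measure"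
    and W B :: "real \<Rightarrow> 'a \<Rightarrow> real"
    and r t :: real
  assumes "continuous_on {0<..<1} u0" and "u0 ` {0<..<1} \<subseteq> {0..1}"
    and "v0m \<in> {0..1}" and "v0p \<in> {0..1}"
    and "C21 u"
    and "bounded ((\<lambda>(r, t). u r t) ` ({0..1} \<times> {0<..}))"
    and "\<forall>r\<in>{0<..<1}. \<forall>t>0. d_t u r t = 1/2 * d_r (d_r u) r t"
    and "\<forall>r\<in>{0<..<1}. ((\<lambda>t. u r t) \<longlongrightarrow> u0 r) (at_right 0)"
    and "\<forall>t>0. ((\<lambda>s. u 0 s) has_real_derivative 1/2 * d_r u 0 t) (at t)"
    and "\<forall>t>0. ((\<lambda>s. u 1 s) has_real_derivative - (1/2) * d_r u 1 t) (at t)"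
    and "((\<lambda>t. u 0 t) \<longlongrightarrow> v0m) (at_right 0)"
    and "((\<lambda>t. u 1 t) \<longlongrightarrow> v0p) (at_right 0)"
    and "r \<in> {0..1}" and "t > 0"
    and "weak_solution
           (indicat_real {0<..<1})
           (\<lambda>x. 1/2 * indicat_real {0} x - 1/2 * indicat_real {1} x)
           r M F W B"
  shows "u r t = (LINT \<omega>|M. u0 (B t \<omega>) * indicat_real {0<..<1} (B t \<omega>)
                          + v0m * indicat_real {0} (B t \<omega>)
                          + v0p * indicat_real {1} (B t \<omega>))"
proof -
  note u0 = assms(1) and u = assms(5) and bdd = assms(6) and heat = assms(7) and init = assms(8)
    and bdry0 = assms(9) and bdry1 = assms(10) and init0 = assms(11) and init1 = assms(12)
    and r = assms(13) and t = assms(14)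
  define \<sigma> where "\<sigma> = indicat_real {0<..<1::real}"
  define b where "b = (\<lambda>x. 1/2 * indicat_real {0} x - 1/2 * indicat_real {1::real} x)"
  have sol: "weak_solution \<sigma> b r M F W B" using assms(15) by (simp only: \<sigma>_def b_def)
  interpret filtered_prob_space M F using sol by (simp add: weak_solution_def)
  from sol obtain I where W: "standard_brownian_motion W" and B: "continuous_adapted B"
    and start: "AE \<omega> in M. B 0 \<omega> = r" and I: "ito_integral W (\<lambda>s \<omega>. \<sigma> (B s \<omega>)) I"
    and eq: "AE \<omega> in M. \<forall>t\<ge>0. set_integrable lborel {0..t} (\<lambda>s. b (B s \<omega>)) \<and>
           B t \<omega> = r + I t \<omega> + (LINT s:{0..t}|lborel. b (B s \<omega>))"
    unfolding weak_solution_def by blast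
  interpret bounded_ito_process M F W B I \<sigma> b r
  proof unfold_locales
    show "\<sigma> \<in> borel_measurable borel" "b \<in> borel_measurable borel" by (simp_all add: \<sigma>_def b_def)
    show "\<bar>\<sigma> y\<bar> \<le> 1" "\<bar>b y\<bar> \<le> 1" for y by (simp_all add: \<sigma>_def b_def indicator_def)
  qed (fact W I B eq)+
  \<comment> \<open>Both coefficients vanish above 1 and below 0, and the start lies in
    \<open>{0..1}\<close>, so each half-line bound applies.\<close>
  have "AE \<omega> in M. B s \<omega> \<in> {0..1}" if "0 \<le> s" for s
  proof (cases "s = 0")
    case True
    then show ?thesis using start r by auto
  next
    case False
    with that have s: "0 < s" by simp
    have "AE \<omega> in M. 1 * (B s \<omega> - 1) \<le> 0"
      by (rule confined_halfline[OF _ start _ _ s]) (use r in \<open>auto simp: \<sigma>_def b_def\<close>)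
    moreover have "AE \<omega> in M. - 1 * (B s \<omega> - 0) \<le> 0"
      by (rule confined_halfline[OF _ start _ _ s]) (use r in \<open>auto simp: \<sigma>_def b_def\<close>)
    ultimately show ?thesis by eventually_elim auto
  qed
  then have inside: "AE \<omega> in M. \<forall>s\<ge>0. B s \<omega> \<in> {0..1}" by (intro AE_all_times_in_closed) auto

  have shifted: "(\<integral>\<omega>. indicat_real {0..1} (B t \<omega>) * u (B t \<omega>) \<epsilon> \<partial>M) = u r (t + \<epsilon>)"
    and shifted_measurable: "(\<lambda>\<omega>. indicat_real {0..1} (B t \<omega>) * u (B t \<omega>) \<epsilon>) \<in> borel_measurable M"
    if \<epsilon>: "0 < \<epsilon>" for \<epsilon>
  proof -
    obtain C0 where C0: "0 \<le> C0" "\<And>s y. s \<in> {0..t} \<Longrightarrow> y \<in> {0..1} \<Longrightarrow> \<bar>u y (t + \<epsilon> - s)\<bar> \<le> C0"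
      using shift_bound[OF C21_continuous(1)[OF u] \<epsilon>, of t] by blast
    obtain C1 where C1: "0 \<le> C1" "\<And>s y. s \<in> {0..t} \<Longrightarrow> y \<in> {0..1} \<Longrightarrow> \<bar>d_r u y (t + \<epsilon> - s)\<bar> \<le> C1"
      using shift_bound[OF C21_continuous(2)[OF u] \<epsilon>, of t] by blast
    obtain C2 where C2: "0 \<le> C2" "\<And>s y. s \<in> {0..t} \<Longrightarrow> y \<in> {0..1} \<Longrightarrow> \<bar>d_r (d_r u) y (t + \<epsilon> - s)\<bar> \<le> C2"
      using shift_bound[OF C21_continuous(3)[OF u] \<epsilon>, of t] by blast
    obtain C3 where C3: "0 \<le> C3" "\<And>s y. s \<in> {0..t} \<Longrightarrow> y \<in> {0..1} \<Longrightarrow> \<bar>d_t u y (t + \<epsilon> - s)\<bar> \<le> C3"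
      using shift_bound[OF C21_continuous(4)[OF u] \<epsilon>, of t] by blast
    \<comment> \<open>Reversing time gives \<open>fs\<close> the opposite sign of
      \<open>d_t u\<close>, so that the forward heat equation cancels the generator. At
      \<open>s = t\<close> the time argument is \<open>\<epsilon>\<close>, at \<open>s = 0\<close>
      it is \<open>t + \<epsilon>\<close>.\<close>
    interpret G: generator_annihilated M F W B I \<sigma> b r t "{0..1}" "\<lambda>s y. u y (t + \<epsilon> - s)"
      "\<lambda>s y. - d_t u y (t + \<epsilon> - s)" "\<lambda>s y. d_r u y (t + \<epsilon> - s)" "\<lambda>s y. d_r (d_r u) y (t + \<epsilon> - s)"
      "C0 + C1 + C2 + C3"
    proof unfold_locales
      fix s y assume s: "s \<in> {0..t}" and y: "y \<in> {0..1::real}"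
      then have pos: "0 < t + \<epsilon> - s" using \<epsilon> by auto
      note D = C21_derivatives[OF u y pos]
      have "((\<lambda>s. t + \<epsilon> - s) has_real_derivative - 1) (at s)" by (auto intro!: derivative_eq_intros)
      from DERIV_chain2[OF D(3) this]
      show "((\<lambda>s. u y (t + \<epsilon> - s)) has_real_derivative - d_t u y (t + \<epsilon> - s)) (at s within {0..t})"
        by (auto intro: has_field_derivative_at_within)
      show "((\<lambda>y. u y (t + \<epsilon> - s)) has_real_derivative d_r u y (t + \<epsilon> - s)) (at y within {0..1})"
        "((\<lambda>y. d_r u y (t + \<epsilon> - s)) has_real_derivative d_r (d_r u) y (t + \<epsilon> - s)) (at y within {0..1})"
        using D by auto
      show "\<bar>u y (t + \<epsilon> - s)\<bar> \<le> C0 + C1 + C2 + C3 \<and> \<bar>- d_t u y (t + \<epsilon> - s)\<bar> \<le> C0 + C1 + C2 + C3 \<and>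
        \<bar>d_r u y (t + \<epsilon> - s)\<bar> \<le> C0 + C1 + C2 + C3 \<and> \<bar>d_r (d_r u) y (t + \<epsilon> - s)\<bar> \<le> C0 + C1 + C2 + C3"
        using C0(1) C1(1) C2(1) C3(1) C0(2)[OF s y] C1(2)[OF s y] C2(2)[OF s y] C3(2)[OF s y] by auto
      \<comment> \<open>At the end points \<open>\<sigma>\<close> is 0, so the second derivative
        disappears and \<open>b\<close> leaves plus or minus half of \<open>d_r u\<close>.
        Uniqueness of the derivative in time identifies \<open>d_t u\<close> there with the boundary
        condition.\<close>
      consider "0 < y" "y < 1" | "y = 0" | "y = 1" using y by fastforce
      then show "- d_t u y (t + \<epsilon> - s) + b y * d_r u y (t + \<epsilon> - s) + 1/2 * (\<sigma> y)\<^sup>2 * d_r (d_r u) y (t + \<epsilon> - s) = 0"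
      proof cases
        case 1
        then show ?thesis using heat pos by (simp add: \<sigma>_def b_def)
      next
        case 2
        then show ?thesis using DERIV_unique[OF D(3), of "1/2 * d_r u 0 (t + \<epsilon> - s)"] bdry0 pos by (simp add: \<sigma>_def b_def)
      next
        case 3
        then show ?thesis using DERIV_unique[OF D(3), of "- (1/2) * d_r u 1 (t + \<epsilon> - s)"] bdry1 pos by (simp add: \<sigma>_def b_def)
      qed
    next
      have "uniformly_close t {0..1} (\<lambda>s y. - d_t u y (t + \<epsilon> - s))"
        using uniformly_close_shift[OF C21_continuous(4)[OF u] \<epsilon>, of t]
        by (simp add: uniformly_close_def abs_minus_commute)
      then show "\<exists>\<delta>>0. \<forall>s\<in>{0..t}. \<forall>s'\<in>{0..t}. \<forall>y\<in>{0..1}. \<forall>y'\<in>{0..1}.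
        \<bar>s - s'\<bar> \<le> \<delta> \<longrightarrow> \<bar>y - y'\<bar> \<le> \<delta> \<longrightarrow>
        \<bar>- d_t u y (t + \<epsilon> - s) - - d_t u y' (t + \<epsilon> - s')\<bar> \<le> \<eta> \<and>
        \<bar>d_r u y (t + \<epsilon> - s) - d_r u y' (t + \<epsilon> - s')\<bar> \<le> \<eta> \<and>
        \<bar>d_r (d_r u) y (t + \<epsilon> - s) - d_r (d_r u) y' (t + \<epsilon> - s')\<bar> \<le> \<eta>" if "0 < \<eta>" for \<eta>
        by (rule uniformly_close_conj[OF _ uniformly_close_shift[OF C21_continuous(2)[OF u] \<epsilon>]
            uniformly_close_shift[OF C21_continuous(3)[OF u] \<epsilon>] that])
      show "AE \<omega> in M. \<forall>s\<in>{0..t}. B s \<omega> \<in> {0..1}" using inside by eventually_elim auto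
    qed (use t C0(1) C1(1) C2(1) C3(1) in auto)
    have meas: "(\<lambda>\<omega>. indicat_real {0..1} (B s \<omega>) * u (B s \<omega>) (t + \<epsilon> - s)) \<in> borel_measurable M"
      if "s \<in> {0..t}" for s
      using that by (intro measurable_compose[OF X_measurable G.measurable_indicator_mult(1)]) auto
    show "(\<lambda>\<omega>. indicat_real {0..1} (B t \<omega>) * u (B t \<omega>) \<epsilon>) \<in> borel_measurable M"
      using meas[of t] t by simp
    have "(\<integral>\<omega>. indicat_real {0..1} (B t \<omega>) * u (B t \<omega>) \<epsilon> \<partial>M) = G.expected t" by (simp add: G.expected_def)
    also have "\<dots> = G.expected 0" by (rule G.expected_constant)
    also have "\<dots> = (\<integral>\<omega>. u r (t + \<epsilon>) \<partial>M)"
      unfolding G.expected_def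
    proof (rule integral_cong_AE)
      show "(\<lambda>\<omega>. indicat_real {0..1} (B 0 \<omega>) * u (B 0 \<omega>) (t + \<epsilon> - 0)) \<in> borel_measurable M"
        using meas[of 0] t by simp
      show "AE \<omega> in M. indicat_real {0..1} (B 0 \<omega>) * u (B 0 \<omega>) (t + \<epsilon> - 0) = u r (t + \<epsilon>)"
        using start by eventually_elim (use r in simp)
    qed simp
    finally show "(\<integral>\<omega>. indicat_real {0..1} (B t \<omega>) * u (B t \<omega>) \<epsilon> \<partial>M) = u r (t + \<epsilon>)"
      by (simp add: prob_space)
  qed

  define \<epsilon> where "\<epsilon> n = inverse (real (Suc n))" for n
  have \<epsilon>: "0 < \<epsilon> n" for n by (simp add: \<epsilon>_def)
  have \<epsilon>0: "\<epsilon> \<longlonglongrightarrow> 0" unfolding \<epsilon>_def by (rule LIMSEQ_inverse_real_of_nat)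
  have \<epsilon>_right: "filterlim \<epsilon> (at_right 0) sequentially"
    by (rule tendsto_imp_filterlim_at_right[OF \<epsilon>0]) (simp add: \<epsilon>)
  \<comment> \<open>The integrand of the claim as a function of position. It is 0 outside
    \<open>{0..1}\<close>, and the indicator makes \<open>u0\<close>, known only on the open
    interval, measurable on the line.\<close>
  define g where "g y = u0 y * indicat_real {0<..<1} y + v0m * indicat_real {0} y + v0p * indicat_real {1} y" for y
  have "(\<lambda>y. indicat_real {0<..<1} y *\<^sub>R u0 y) \<in> borel_measurable borel"
    by (rule borel_measurable_continuous_on_indicator[OF _ u0]) simp
  then have "g \<in> borel_measurable borel"
    unfolding g_def[abs_def] by (simp add: mult.commute)
  then have gM: "(\<lambda>\<omega>. g (B t \<omega>)) \<in> borel_measurable M"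
    by (rule measurable_compose[OF X_measurable, rotated]) (use t in simp)
  have lim: "(\<lambda>n. indicat_real {0..1} y * u y (\<epsilon> n)) \<longlonglongrightarrow> g y" for y
  proof -
    consider "0 < y" "y < 1" | "y = 0" | "y = 1" | "y \<notin> {0..1}" by fastforce
    then show ?thesis
    proof cases
      case 1
      then show ?thesis using filterlim_compose[OF init[rule_format, of y] \<epsilon>_right] by (simp add: g_def)
    next
      case 2
      then show ?thesis using filterlim_compose[OF init0 \<epsilon>_right] by (simp add: g_def)
    next
      case 3
      then show ?thesis using filterlim_compose[OF init1 \<epsilon>_right] by (simp add: g_def)
    next
      case 4
      then show ?thesis by (auto simp: g_def indicator_def)
    qed
  qed
  obtain C where C: "\<And>y s. y \<in> {0..1} \<Longrightarrow> 0 < s \<Longrightarrow> \<bar>u y s\<bar> \<le> C"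
    using bdd by (force simp: bounded_iff)
  have "(\<lambda>n. \<integral>\<omega>. indicat_real {0..1} (B t \<omega>) * u (B t \<omega>) (\<epsilon> n) \<partial>M) \<longlonglongrightarrow> (\<integral>\<omega>. g (B t \<omega>) \<partial>M)"
  proof (rule integral_dominated_convergence[where w="\<lambda>_. \<bar>C\<bar>"])
    show "(\<lambda>\<omega>. indicat_real {0..1} (B t \<omega>) * u (B t \<omega>) (\<epsilon> n)) \<in> borel_measurable M" for n
      by (rule shifted_measurable[OF \<epsilon>])
    show "AE \<omega> in M. norm (indicat_real {0..1} (B t \<omega>) * u (B t \<omega>) (\<epsilon> n)) \<le> \<bar>C\<bar>" for n
      using C[OF _ \<epsilon>[of n]] by (intro AE_I2) (force simp: indicator_def)
  qed (use gM lim in auto)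
  then have "(\<lambda>n. u r (t + \<epsilon> n)) \<longlonglongrightarrow> (\<integral>\<omega>. g (B t \<omega>) \<partial>M)" by (simp add: shifted[OF \<epsilon>])
  \<comment> \<open>On the other side of the identity, \<open>u\<close> is evaluated near the
    positive time \<open>t\<close>, where it is differentiable in time and hence continuous.\<close>
  moreover have "(\<lambda>n. u r (t + \<epsilon> n)) \<longlonglongrightarrow> u r t"
  proof (rule isCont_tendsto_compose[where g="u r"])
    show "isCont (u r) t" by (rule DERIV_isCont[OF C21_derivatives(3)[OF u r t]])
    show "(\<lambda>n. t + \<epsilon> n) \<longlonglongrightarrow> t" using tendsto_add[OF tendsto_const \<epsilon>0, of t] by simp
  qed
  ultimately have "(\<integral>\<omega>. g (B t \<omega>) \<partial>M) = u r t" by (rule LIMSEQ_unique)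
  then show ?thesis by (simp only: g_def)
qed

end
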